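(* Let $M$ be a compact, connected, irreducible and orientable $3$-manifold and let $\Sigma$ be an essential tribranched surface in $M$. Then the homomorphism $\phi_{\Sigma,*}\colon\pi_1(G(\mathcal{Y}_\Sigma),\sigma_0)\to\pi_1(M,x_0)$ induced from the morphism $\phi_\Sigma\colon G(\mathcal{Y}_\Sigma)\to\pi_1(M,x_0)$ is surjective. Here $G(\mathcal{Y}_\Sigma)$ is the complex of groups associated to $\Sigma$, $x_0$ is a fixed point of $M(\Sigma)$, and $\sigma_0$ is the vertex of $\mathcal{Y}_\Sigma$ corresponding to the component of $M(\Sigma)$ containing $x_0$.
   Context: **Tribranched surfaces.** Put $\overline{\mathbb{H}}=\{(z,s)\in\mathbb{C}\times\mathbb{R}\mid s\ge 0\}$ and $Y=\{re^{\sqrt{-1}\theta}\in\mathbb{C}\mid r\ge 0,\ \theta=0,\pm 2\pi/3\}$. Let $\Sigma$ be a compact subset of $M$ such that $(M,\Sigma)$ is locally homeomorphic to $(\overline{\mathbb{H}},Y\times[0,\infty))$. Let $C(\Sigma)$ be the set of branched points (corresponding to $\{0\}\times[0,\infty)$), $S(\Sigma)$ the complement of a sufficiently small tubular neighbourhood of $C(\Sigma)$ in $\Sigma$, and $M(\Sigma)$ the complement of a regular neighbourhood of $\Sigma$ in $M$. $\Sigma$ is a *tribranched surface* if (TBS1) the intersection of $\Sigma$ and a sufficiently small tubular neighbourhood of $C(\Sigma)$ in $M$ is homeomorphic to $Y\times C(\Sigma)$, and (TBS2) $S(\Sigma)$ is orientable. It is *essential* if moreover: (ETBS1) for any component $N$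 of $M(\Sigma)$, the homomorphism $\pi_1(N)\to\pi_1(M)$ induced by inclusion is not surjective; (ETBS2) for any components $C,S,N$ of $C(\Sigma),S(\Sigma),M(\Sigma)$ respectively, if the homomorphisms $\pi_1(C)\to\pi_1(S)$ and $\pi_1(S)\to\pi_1(N)$ are induced by the natural inclusion maps, they are injective; (ETBS3) no component of $\Sigma$ is contained in a $3$-ball in $M$ or a collar of $\partial M$. **Neighbourhoods.** Let $D^2$ and $\mathring{D}^2$ be the closed and open unit disks in $\mathbb{C}$. For each component $C$ of $C(\Sigma)$ fix a tubular neighbourhood $h_C\colon C\times D^2\to M$ with $h_C(x,0)=x$, mapping $C\times(\mathring{D}^2\cap Y)$ onto a regular neighbourhood of $C$ in $\Sigma$; put $U_C=h_C(C\times\mathring{D}^2)$, $\bar U_C=h_C(C\times D^2)$, and $S(\Sigma)=\Sigma\setminus\bigcup_C U_C$. For each component $S$ of $S(\Sigma)$ fix a bicollar neighbourhood $h_S\colon S\times[-1,1]\to M\setminus\bigcup_C U_C$ with $h_S(x,0)=x$, the images being pairwise disjoint; put $U_S=h_S(S\times(-1,1))$, $\bar U_S=h_S(S\times[-1,1])$. Then $M(\Sigma)$ is the complement of all the $U_C$ and $U_S$ in $M$. For a component $N$ of $M(\Sigma)$ put $U_N=\bar U_N=N$. **The scwol $\mathcal{Y}_\Sigma$.** A scwol consists of a set of vertices and a set of edges $a$, each with initial vertex $i(a)$ and terminal vertex $t(a)\neq i(a)$, together with an associative composition $ab$ for composable pairs $(a,b)$ (those with $i(a)=t(b)$), satisfying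 $i(ab)=i(b)$ and $t(ab)=t(a)$. Let $Y_\Sigma$ (the dual $2$-complex) be the quotient of $M$ that collapses to a point each component $N$ of $M(\Sigma)$, each $h_S(S\times\{t\})$ ($t\in(-1,1)$) and each $h_C(C\times\{s\})$ ($s\in\mathring{D}^2$). It is a combinatorial CW-complex with $0$-, $1$- and $2$-cells $e_\lambda$ labelled by $\pi_0(M(\Sigma))$, $\pi_0(S(\Sigma))$ and $\pi_0(C(\Sigma))$ respectively, each $2$-cell being identified with a $2$-simplex with boundary appropriately glued to the $1$-skeleton. Let $\Lambda=\pi_0(C(\Sigma))\sqcup\pi_0(S(\Sigma))\sqcup\pi_0(M(\Sigma))$. The vertices of $\mathcal{Y}_\Sigma$ are the (barycentres of) cells of $Y_\Sigma$, written $\sigma_\lambda$ ($\lambda\in\Lambda$); its edges are the $1$-cells of the first barycentric subdivision of $Y_\Sigma$, an edge $a$ connecting $\sigma_\lambda$ and $\sigma_\mu$ having $i(a)=\sigma_\lambda$, $t(a)=\sigma_\mu$ if $e_\mu$ occurs in the boundary of $e_\lambda$. For a composable pair $(a,b)$, $ab$ is the unique edge $c$ with $i(c)=i(b)$, $t(c)=t(a)$ such that $a,b,c$ all occur in the boundary of a single $2$-cell of the first barycentric subdivision. **Complexes of groups.** A complex of groups $G(\mathcal{Y})$ over a scwol $\mathcal{Y}$ consists of local groups $G_\sigma$, injective homomorphisms $\psi_a\colon G_{i(a)}\to G_{t(a)}$ and twisting elements $g_{a,b}\in G_{t(a)}$ for composable $(a,b)$, such that $g_{a,b}\psi_{ab}(x)g_{a,b}^{-1}=\psi_a\psi_b(x)$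 and $\psi_a(g_{b,c})g_{a,bc}=g_{a,b}g_{ab,c}$. A morphism $\phi$ from $G(\mathcal{Y})$ to a group $G$ consists of homomorphisms $\phi_\sigma\colon G_\sigma\to G$ and elements $\phi(a)\in G$ with $\phi(a)\phi_{i(a)}(x)\phi(a)^{-1}=\phi_{t(a)}(\psi_a(x))$ and $\phi_{t(a)}(g_{a,b})\phi(ab)=\phi(a)\phi(b)$. **The complex of groups $G(\mathcal{Y}_\Sigma)$.** Fix a point $x_\lambda\in\lambda$ for each $\lambda\in\Lambda$; the local group at $\sigma_\lambda$ is $G^\Sigma_\lambda=\pi_1(\lambda,x_\lambda)$. For each edge $a$ with $i(a)=\sigma_\lambda$, $t(a)=\sigma_\mu$, fix a path $l_{\lambda,\mu}$ in $\bar U_\lambda\cup\bar U_\mu$ from $x_\lambda$ to $x_\mu$. Paths are concatenated from left to right. Using that $\mu$ is a deformation retract of $\bar U_\lambda\cup\bar U_\mu$, define $\psi^\Sigma_a\colon G^\Sigma_\lambda\to G^\Sigma_\mu$ as the composition $\pi_1(\lambda,x_\lambda)\to\pi_1(\bar U_\lambda\cup\bar U_\mu,x_\lambda)\to\pi_1(\bar U_\lambda\cup\bar U_\mu,x_\mu)\cong\pi_1(\mu,x_\mu)$, where the first map is induced by inclusion, the second is $[c]\mapsto[l_{\lambda,\mu}^{-1}\,c\,l_{\lambda,\mu}]$, and the last is induced by a deformation retraction. For a composable pair $(a,b)$ with $i(b)=\sigma_C$, $t(b)=i(a)=\sigma_S$, $t(a)=\sigma_N$, the twisting element $g^\Sigma_{a,b}\in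 G^\Sigma_N$ is the image of $[l_{S,N}^{-1}l_{C,S}^{-1}l_{C,N}]$ under the map $\pi_1(N\cup\bar U_S\cup\bar U_C,x_N)\to\pi_1(N,x_N)$ induced by a deformation retraction of $N\cup\bar U_S\cup\bar U_C$ to $N$. **Fundamental group.** Let $FG(\mathcal{Y})$ be the group generated by the elements of all $G_\sigma$ and symbols $a^+,a^-$ for all edges $a$, subject to the relations of each $G_\sigma$, $(a^{\pm})^{-1}=a^{\mp}$, $a^+b^+=g_{a,b}(ab)^+$ for composable $(a,b)$, and $\psi_a(x)=a^+xa^-$ for $x\in G_{i(a)}$. Put $i(a^+)=t(a)$, $t(a^+)=i(a)$, $i(a^-)=i(a)$, $t(a^-)=t(a)$. Then $\pi_1(G(\mathcal{Y}),\sigma_0)$ is the subgroup of $FG(\mathcal{Y})$ consisting of the elements $g_0e_1g_1\cdots e_kg_k$, where each $e_j$ is some $a^{\pm}$, $t(e_j)=i(e_{j+1})$, the path $(e_1,\dots,e_k)$ starts and ends at $\sigma_0$, $g_0\in G_{\sigma_0}$ and $g_j\in G_{t(e_j)}$. **The morphism $\phi_\Sigma$.** Fix a path $l_\lambda$ in $M$ from $x_0$ to $x_\lambda$ for each $\lambda\in\Lambda$. The homomorphism $\phi_{\Sigma,\lambda}\colon G^\Sigma_\lambda\to\pi_1(M,x_0)$ is $[c]\mapsto[l_\lambda\,c\,l_\lambda^{-1}]$, and $\phi_\Sigma(a)=[l_\mu l_{\lambda,\mu}^{-1}l_\lambda^{-1}]$ for an edge $a$ with $i(a)=\sigma_\lambda$,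 $t(a)=\sigma_\mu$. The induced homomorphism $\phi_{\Sigma,*}$ is the restriction to $\pi_1(G(\mathcal{Y}_\Sigma),\sigma_0)$ of the homomorphism $FG(\mathcal{Y}_\Sigma)\to\pi_1(M,x_0)$ sending $g\in G^\Sigma_\lambda$ to $\phi_{\Sigma,\lambda}(g)$ and $a^+$ to $\phi_\Sigma(a)$.
   Formalization: If several edges join σ_λ to σ_μ (e.g. Σ a fibre), μ is no deformation retract of Ū_λ∪Ū_μ; so each l_{λ,μ} must be homotopic there to a path along its own edge, and ψ_a, g_{a,b} use retractions of the part of the neighbourhoods along the edges. For single edges nothing changes. *)

theory Defs
  imports "HOL-Homology.Homology"
begin

section \<open>Fundamental groups\<close>

definition loops :: "'a::topological_space set \<Rightarrow> 'a \<Rightarrow> (real \<Rightarrow> 'a) set" where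
  "loops X x = {p. path p \<and> path_image p \<subseteq> X \<and> pathstart p = x \<and> pathfinish p = x}"

definition path_class :: "'a::topological_space set \<Rightarrow> (real \<Rightarrow> 'a) \<Rightarrow> (real \<Rightarrow> 'a) set" where
  "path_class X p = {q. homotopic_paths X p q}"

definition fundamental_group ::
    "'a::topological_space set \<Rightarrow> 'a \<Rightarrow> (real \<Rightarrow> 'a) set monoid" where
  "fundamental_group X x =
     \<lparr>carrier = path_class X ` loops X x,
      monoid.mult = (\<lambda>A B. {r. \<exists>p\<in>A. \<exists>q\<in>B. homotopic_paths X (p +++ q) r}),
      one = path_class X (\<lambda>_. x)\<rparr>"

text \<open>The map on homotopy classes induced by an operation \<open>F\<close> on paths.\<close>

definition class_map ::
    "'b::topological_space set \<Rightarrow> ((real \<Rightarrow> 'a) \<Rightarrow> real \<Rightarrow> 'b) \<Rightarrow> (real \<Rightarrow> 'a) set \<Rightarrow> (real \<Rightarrow> 'b) set" where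
  "class_map Y F A = {q. \<exists>p\<in>A. homotopic_paths Y (F p) q}"

text \<open>The homotopy need not fix \<open>A\<close>; the induced map of fundamental groups is in any case the
  inverse of the one induced by the inclusion of \<open>A\<close>.\<close>

definition deformation_retraction ::
    "'a::topological_space set \<Rightarrow> 'a set \<Rightarrow> ('a \<Rightarrow> 'a) \<Rightarrow> bool" where
  "deformation_retraction X A r \<longleftrightarrow>
     retraction X A r \<and> homotopic_with_canon (\<lambda>_. True) X X id r"

section \<open>Manifolds with boundary\<close>

text \<open>\<open>complex \<times> real\<close> carries the Euclidean norm and serves as the model of Euclidean 3-space.\<close>

definition half_space :: "(complex \<times> real) set" where
  "half_space = {(z, s). 0 \<le> s}"

definition three_manifold :: "'a::t2_space set \<Rightarrow> bool" where
  "three_manifold M \<longleftrightarrow>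
     (\<forall>x\<in>M. \<exists>U V. x \<in> U \<and> openin (top_of_set M) U \<and>
        openin (top_of_set half_space) V \<and> U homeomorphic V)"

definition manifold_interior ::
    "'e::euclidean_space itself \<Rightarrow> 'a::topological_space set \<Rightarrow> 'a set" where
  "manifold_interior (E :: 'e itself) X =
     {x. \<exists>U. x \<in> U \<and> openin (top_of_set X) U \<and> U homeomorphic (UNIV :: 'e set)}"

definition boundary3 :: "'a::topological_space set \<Rightarrow> 'a set" where
  "boundary3 M = M - manifold_interior TYPE(complex \<times> real) M"

text \<open>
  Orientability of a manifold of dimension \<open>DIM('e)\<close>, possibly with boundary: there is a locally
  consistent choice of generators of the local homology groups \<open>H\<^sub>n(I, I - {x})\<close> at the points \<open>x\<close>
  of the interior \<open>I\<close>.
\<close>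

definition orientable ::
    "'e::euclidean_space itself \<Rightarrow> 'a::topological_space set \<Rightarrow> bool" where
  "orientable (E :: 'e itself) X \<longleftrightarrow>
     (let I = manifold_interior E X;
          H = (\<lambda>A. relative_homology_group (int DIM('e)) (top_of_set I) (I - A))
      in \<exists>\<mu>. (\<forall>x\<in>I. \<mu> x \<in> carrier (H {x}) \<and> generate (H {x}) {\<mu> x} = carrier (H {x})) \<and>
             (\<forall>x\<in>I. \<exists>B. x \<in> B \<and> openin (top_of_set I) B \<and>
                (\<exists>\<beta>\<in>carrier (H B). \<forall>y\<in>B.
                   hom_induced (int DIM('e)) (top_of_set I) (I - B) (top_of_set I) (I - {y}) id \<beta>
                     = \<mu> y)))"

text \<open>\<open>pair_chart X A H K U f\<close>: \<open>f\<close> maps the open subset \<open>U\<close> of \<open>X\<close> homeomorphically onto an open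
  subset of \<open>H\<close>, taking \<open>U \<inter> A\<close> to the part lying in \<open>K\<close>.\<close>

definition pair_chart ::
    "'a::topological_space set \<Rightarrow> 'a set \<Rightarrow> 'b::topological_space set \<Rightarrow> 'b set \<Rightarrow> 'a set \<Rightarrow> ('a \<Rightarrow> 'b) \<Rightarrow> bool" where
  "pair_chart X A H K U f \<longleftrightarrow>
     openin (top_of_set X) U \<and>
     (\<exists>V g. openin (top_of_set H) V \<and> homeomorphism U V f g \<and> f ` (U \<inter> A) = V \<inter> K)"

text \<open>
  Every 2-sphere in \<open>M\<close> bounds a 3-ball.  In the topological category the spheres have to be
  locally flat, which is automatic in the smooth and piecewise linear categories.
\<close>

definition irreducible3 :: "'a::topological_space set \<Rightarrow> bool" where
  "irreducible3 M \<longleftrightarrow>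
     (\<forall>S\<subseteq>M. S homeomorphic (sphere 0 1 :: (complex \<times> real) set) \<and>
        (\<forall>x\<in>S. \<exists>U f. x \<in> U \<and> pair_chart M S (UNIV :: (complex \<times> real) set) {(z, s). s = 0} U f) \<longrightarrow>
        (\<exists>B f g. B \<subseteq> M \<and> homeomorphism (cball 0 1 :: (complex \<times> real) set) B f g \<and>
           f ` sphere 0 1 = S))"

definition collar_of_boundary :: "'a::topological_space set \<Rightarrow> ('a \<times> real \<Rightarrow> 'a) \<Rightarrow> bool" where
  "collar_of_boundary M c \<longleftrightarrow>
     (\<exists>g. homeomorphism (boundary3 M \<times> {0..1}) (c ` (boundary3 M \<times> {0..1})) c g) \<and>
     c ` (boundary3 M \<times> {0..1}) \<subseteq> M \<and>
     openin (top_of_set M) (c ` (boundary3 M \<times> {0..<1})) \<and>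
     (\<forall>x\<in>boundary3 M. c (x, 0) = x)"

section \<open>Tribranched surfaces\<close>

definition Y_graph :: "complex set" where
  "Y_graph = {of_real r * cis \<theta> | r \<theta>. 0 \<le> r \<and> \<theta> \<in> {0, 2 * pi / 3, - 2 * pi / 3}}"

text \<open>The three rays of \<open>Y_graph\<close> end at \<open>ray k\<close> on the unit circle, \<open>k < 3\<close>, and \<open>sector k\<close> is the
  closed sector between the rays \<open>k\<close> and \<open>k + 1\<close>.\<close>

definition ray :: "nat \<Rightarrow> complex" where
  "ray k = cis (2 * pi * real k / 3)"

definition sector :: "nat \<Rightarrow> complex set" where
  "sector k = {of_real r * cis \<theta> | r \<theta>.
     0 \<le> r \<and> 2 * pi * real k / 3 \<le> \<theta> \<and> \<theta> \<le> 2 * pi * real (Suc k) / 3}"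

definition tribranched_chart ::
    "'a::topological_space set \<Rightarrow> 'a set \<Rightarrow> 'a set \<Rightarrow> ('a \<Rightarrow> complex \<times> real) \<Rightarrow> bool" where
  "tribranched_chart M \<Sigma> U f \<longleftrightarrow> pair_chart M \<Sigma> half_space (Y_graph \<times> {0..}) U f"

definition branch_set :: "'a::topological_space set \<Rightarrow> 'a set \<Rightarrow> 'a set" where
  "branch_set M \<Sigma> =
     {x \<in> \<Sigma>. \<exists>U f. x \<in> U \<and> tribranched_chart M \<Sigma> U f \<and> f x \<in> {0} \<times> {0..}}"

definition tubular_nbhd :: "'a::topological_space set \<Rightarrow> 'a set \<Rightarrow> ('a \<times> complex \<Rightarrow> 'a) \<Rightarrow> bool" where
  "tubular_nbhd M C f \<longleftrightarrow>
     (\<exists>g. homeomorphism (C \<times> cball 0 1) (f ` (C \<times> cball 0 1)) f g) \<and>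
     f ` (C \<times> cball 0 1) \<subseteq> M \<and>
     openin (top_of_set M) (f ` (C \<times> ball 0 1)) \<and>
     (\<forall>x\<in>C. f (x, 0) = x) \<and>
     (\<forall>x\<in>C. \<forall>z\<in>cball 0 1. f (x, z) \<in> boundary3 M \<longleftrightarrow> x \<in> boundary3 M)"

text \<open>The chosen neighbourhoods \<open>h\<^sub>C\<close> and \<open>h\<^sub>S\<close>, indexed by components.\<close>

record 'a tbs_nbhds =
  tub :: "'a set \<Rightarrow> 'a \<times> complex \<Rightarrow> 'a"
  bicol :: "'a set \<Rightarrow> 'a \<times> real \<Rightarrow> 'a"

definition tub_open :: "'a tbs_nbhds \<Rightarrow> 'a set \<Rightarrow> 'a set" where
  "tub_open h C = tub h C ` (C \<times> ball 0 1)"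

definition tub_closed :: "'a tbs_nbhds \<Rightarrow> 'a set \<Rightarrow> 'a set" where
  "tub_closed h C = tub h C ` (C \<times> cball 0 1)"

definition bicol_open :: "'a tbs_nbhds \<Rightarrow> 'a set \<Rightarrow> 'a set" where
  "bicol_open h S = bicol h S ` (S \<times> {-1<..<1})"

definition bicol_closed :: "'a tbs_nbhds \<Rightarrow> 'a set \<Rightarrow> 'a set" where
  "bicol_closed h S = bicol h S ` (S \<times> {-1..1})"

definition tubes :: "'a::topological_space set \<Rightarrow> 'a set \<Rightarrow> 'a tbs_nbhds \<Rightarrow> 'a set" where
  "tubes M \<Sigma> h = (\<Union>C\<in>components (branch_set M \<Sigma>). tub_open h C)"

text \<open>\<open>sheets\<close> and \<open>regions\<close> are \<open>S(\<Sigma>)\<close> and \<open>M(\<Sigma>)\<close>.\<close>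

definition sheets :: "'a::topological_space set \<Rightarrow> 'a set \<Rightarrow> 'a tbs_nbhds \<Rightarrow> 'a set" where
  "sheets M \<Sigma> h = \<Sigma> - tubes M \<Sigma> h"

definition regions :: "'a::topological_space set \<Rightarrow> 'a set \<Rightarrow> 'a tbs_nbhds \<Rightarrow> 'a set" where
  "regions M \<Sigma> h = M - tubes M \<Sigma> h - (\<Union>S\<in>components (sheets M \<Sigma> h). bicol_open h S)"

text \<open>
  The last two conditions on bicollars say that \<open>S\<close> is collared as a properly embedded surface:
  over boundary points of \<open>S\<close>, and only there, the collar runs in the corresponding part of the
  boundary of the complement of the tubes.
\<close>

definition nbhd_system :: "'a::topological_space set \<Rightarrow> 'a set \<Rightarrow> 'a tbs_nbhds \<Rightarrow> bool" where
  "nbhd_system M \<Sigma> h \<longleftrightarrow>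
     (\<forall>C\<in>components (branch_set M \<Sigma>).
        tubular_nbhd M C (tub h C) \<and>
        tub h C ` (C \<times> (cball 0 1 \<inter> Y_graph)) = tub_closed h C \<inter> \<Sigma>) \<and>
     disjoint_family_on (tub_closed h) (components (branch_set M \<Sigma>)) \<and>
     (\<forall>S\<in>components (sheets M \<Sigma> h).
        (\<exists>g. homeomorphism (S \<times> {-1..1}) (bicol_closed h S) (bicol h S) g) \<and>
        bicol_closed h S \<subseteq> M - tubes M \<Sigma> h \<and>
        openin (top_of_set (M - tubes M \<Sigma> h)) (bicol_open h S) \<and>
        (\<forall>x\<in>S. bicol h S (x, 0) = x) \<and>
        (\<forall>x\<in>S. \<forall>t\<in>{-1..1}. \<forall>C\<in>components (branch_set M \<Sigma>).
           bicol h S (x, t) \<in> tub_closed h C \<longleftrightarrow> x \<in> tub_closed h C) \<and>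
        (\<forall>x\<in>S. \<forall>t\<in>{-1..1}. bicol h S (x, t) \<in> boundary3 M \<longleftrightarrow> x \<in> boundary3 M)) \<and>
     disjoint_family_on (bicol_closed h) (components (sheets M \<Sigma> h))"

definition tribranched_surface :: "'a::topological_space set \<Rightarrow> 'a set \<Rightarrow> 'a tbs_nbhds \<Rightarrow> bool" where
  "tribranched_surface M \<Sigma> h \<longleftrightarrow>
     \<Sigma> \<subseteq> M \<and> compact \<Sigma> \<and>
     (\<forall>x\<in>M. \<exists>U f. x \<in> U \<and> tribranched_chart M \<Sigma> U f) \<and>
     \<comment> \<open>such tubular neighbourhoods exist in every neighbourhood of the branch set\<close>
     (\<forall>W. openin (top_of_set M) W \<and> branch_set M \<Sigma> \<subseteq> W \<longrightarrow>
        (\<exists>f. tubular_nbhd M (branch_set M \<Sigma>) f \<and>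
             f ` (branch_set M \<Sigma> \<times> cball 0 1) \<subseteq> W \<and>
             (\<Sigma> \<inter> f ` (branch_set M \<Sigma> \<times> ball 0 1)) homeomorphic (Y_graph \<times> branch_set M \<Sigma>))) \<and>
     orientable TYPE(complex) (sheets M \<Sigma> h)"

section \<open>The scwol of a tribranched surface\<close>

datatype 'a cell = Branch "'a set" | Sheet "'a set" | Region "'a set"

text \<open>
  The edges are the 1-cells of the first barycentric subdivision of the dual 2-complex.
  The 2-cell dual to \<open>C\<close> is a triangle whose sides are crossed by the three prongs of \<open>\<Sigma>\<close> at \<open>C\<close>
  and whose corners come from the three sectors between them, so its barycentre is joined to the
  midpoints of the sides (\<open>Prong C k\<close>) and to the corners (\<open>Sector C k\<close>), \<open>k < 3\<close>.
  The 1-cell dual to \<open>S\<close> is cut by its midpoint into two halves \<open>Side S e\<close>, one for each side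
  \<open>e = 1\<close>, \<open>e = -1\<close> of the bicollar.  Distinct edges may have the same end points.
\<close>

datatype 'a edge = Prong "'a set" nat | Sector "'a set" nat | Side "'a set" real

fun cell_set :: "'a cell \<Rightarrow> 'a set" where
  "cell_set (Branch C) = C"
| "cell_set (Sheet S) = S"
| "cell_set (Region N) = N"

fun cell_nbhd :: "'a tbs_nbhds \<Rightarrow> 'a cell \<Rightarrow> 'a set" where
  "cell_nbhd h (Branch C) = tub_closed h C"
| "cell_nbhd h (Sheet S) = bicol_closed h S"
| "cell_nbhd h (Region N) = N"

fun init_cell :: "'a edge \<Rightarrow> 'a cell" where
  "init_cell (Prong C k) = Branch C"
| "init_cell (Sector C k) = Branch C"
| "init_cell (Side S e) = Sheet S"

fun term_cell :: "'a::topological_space set \<Rightarrow> 'a set \<Rightarrow> 'a tbs_nbhds \<Rightarrow> 'a edge \<Rightarrow> 'a cell" where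
  "term_cell M \<Sigma> h (Prong C k) =
     Sheet (THE S. S \<in> components (sheets M \<Sigma> h) \<and> tub h C ` (C \<times> {ray k}) \<subseteq> S)"
| "term_cell M \<Sigma> h (Sector C k) =
     Region (THE N. N \<in> components (regions M \<Sigma> h) \<and>
       tub h C ` (C \<times> sector k \<inter> UNIV \<times> sphere 0 1) \<inter> regions M \<Sigma> h \<subseteq> N)"
| "term_cell M \<Sigma> h (Side S e) =
     Region (THE N. N \<in> components (regions M \<Sigma> h) \<and> bicol h S ` (S \<times> {e}) \<subseteq> N)"

definition tbs_cells :: "'a::topological_space set \<Rightarrow> 'a set \<Rightarrow> 'a tbs_nbhds \<Rightarrow> 'a cell set" where
  "tbs_cells M \<Sigma> h =
     Branch ` components (branch_set M \<Sigma>) \<union> Sheet ` components (sheets M \<Sigma> h) \<union>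
     Region ` components (regions M \<Sigma> h)"

definition tbs_edges :: "'a::topological_space set \<Rightarrow> 'a set \<Rightarrow> 'a tbs_nbhds \<Rightarrow> 'a edge set" where
  "tbs_edges M \<Sigma> h =
     {Prong C k | C k. C \<in> components (branch_set M \<Sigma>) \<and> k < 3} \<union>
     {Sector C k | C k. C \<in> components (branch_set M \<Sigma>) \<and> k < 3} \<union>
     {Side S e | S e. S \<in> components (sheets M \<Sigma> h) \<and> (e = 1 \<or> e = -1)}"

text \<open>
  A composable pair consists of a prong of \<open>C\<close> and a side of the sheet it lies on; the small triangle
  they span has as third edge the sector of \<open>C\<close> into which that side of the sheet points there.
\<close>

fun comp_edge :: "'a tbs_nbhds \<Rightarrow> 'a edge \<Rightarrow> 'a edge \<Rightarrow> 'a edge" where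
  "comp_edge h (Side S e) (Prong C k) =
     Sector C (THE j. j < 3 \<and>
       bicol h S ` (tub h C ` (C \<times> {ray k}) \<times> {e}) \<subseteq> tub h C ` (C \<times> (sector j \<inter> cball 0 1)))"
| "comp_edge h _ _ = undefined"

record ('v, 'e) scwol =
  verts :: "'v set"
  edges :: "'e set"
  ini :: "'e \<Rightarrow> 'v"
  ter :: "'e \<Rightarrow> 'v"
  cmp :: "'e \<Rightarrow> 'e \<Rightarrow> 'e"

definition composable :: "('v, 'e, 'x) scwol_scheme \<Rightarrow> 'e \<Rightarrow> 'e \<Rightarrow> bool" where
  "composable Y a b \<longleftrightarrow> a \<in> edges Y \<and> b \<in> edges Y \<and> ini Y a = ter Y b"

definition tbs_scwol ::
    "'a::topological_space set \<Rightarrow> 'a set \<Rightarrow> 'a tbs_nbhds \<Rightarrow> ('a cell, 'a edge) scwol" where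
  "tbs_scwol M \<Sigma> h =
     \<lparr>verts = tbs_cells M \<Sigma> h, edges = tbs_edges M \<Sigma> h,
      ini = init_cell, ter = term_cell M \<Sigma> h, cmp = comp_edge h\<rparr>"

section \<open>Essential tribranched surfaces\<close>

text \<open>
  Since \<open>S(\<Sigma>)\<close> and \<open>M(\<Sigma>)\<close> are complements of neighbourhoods, the natural inclusions \<open>C \<rightarrow> S\<close>
  and \<open>S \<rightarrow> N\<close> are the pushes along a prong of \<open>C\<close>, respectively to one side of \<open>S\<close>.
\<close>

definition essential_tribranched_surface ::
    "'a::topological_space set \<Rightarrow> 'a set \<Rightarrow> 'a tbs_nbhds \<Rightarrow> bool" where
  "essential_tribranched_surface M \<Sigma> h \<longleftrightarrow>
     tribranched_surface M \<Sigma> h \<and>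
     (\<forall>N\<in>components (regions M \<Sigma> h). \<forall>x\<in>N.
        class_map M id ` carrier (fundamental_group N x) \<noteq> carrier (fundamental_group M x)) \<and>
     (\<forall>C\<in>components (branch_set M \<Sigma>). \<forall>k<3. \<forall>x\<in>C.
        inj_on (class_map (cell_set (term_cell M \<Sigma> h (Prong C k))) ((\<circ>) (\<lambda>y. tub h C (y, ray k))))
          (carrier (fundamental_group C x))) \<and>
     (\<forall>S\<in>components (sheets M \<Sigma> h). \<forall>e\<in>{1, -1}. \<forall>x\<in>S.
        inj_on (class_map (cell_set (term_cell M \<Sigma> h (Side S e))) ((\<circ>) (\<lambda>y. bicol h S (y, e))))
          (carrier (fundamental_group S x))) \<and>
     (\<forall>F\<in>components \<Sigma>.
        \<not> (\<exists>B. F \<subseteq> B \<and> B \<subseteq> M \<and> B homeomorphic (cball 0 1 :: (complex \<times> real) set)) \<and>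
        \<not> (\<exists>c. collar_of_boundary M c \<and> F \<subseteq> c ` (boundary3 M \<times> {0..1})))"

section \<open>Group presentations\<close>

text \<open>A word is a list of generators, each marked \<open>True\<close> for the generator itself and \<open>False\<close> for its
  formal inverse; a relation \<open>u = v\<close> is the pair \<open>(u, v)\<close>.\<close>

type_synonym 'x word = "('x \<times> bool) list"

definition words :: "'x set \<Rightarrow> 'x word set" where
  "words X = {w. fst ` set w \<subseteq> X}"

inductive pres_eq :: "'x set \<Rightarrow> ('x word \<times> 'x word) set \<Rightarrow> 'x word \<Rightarrow> 'x word \<Rightarrow> bool"
  for X :: "'x set" and R :: "('x word \<times> 'x word) set" where
  refl: "u \<in> words X \<Longrightarrow> pres_eq X R u u"
| sym: "pres_eq X R u v \<Longrightarrow> pres_eq X R v u"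
| trans: "pres_eq X R u v \<Longrightarrow> pres_eq X R v w \<Longrightarrow> pres_eq X R u w"
| append: "pres_eq X R u u' \<Longrightarrow> pres_eq X R v v' \<Longrightarrow> pres_eq X R (u @ v) (u' @ v')"
| cancel: "x \<in> X \<Longrightarrow> pres_eq X R [(x, b), (x, \<not> b)] []"
| rel: "(u, v) \<in> R \<Longrightarrow> u \<in> words X \<Longrightarrow> v \<in> words X \<Longrightarrow> pres_eq X R u v"

definition pres_class :: "'x set \<Rightarrow> ('x word \<times> 'x word) set \<Rightarrow> 'x word \<Rightarrow> 'x word set" where
  "pres_class X R u = {v. pres_eq X R u v}"

definition presented_group :: "'x set \<Rightarrow> ('x word \<times> 'x word) set \<Rightarrow> 'x word set monoid" where
  "presented_group X R =
     \<lparr>carrier = pres_class X R ` words X,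
      monoid.mult = (\<lambda>A B. {w. \<exists>u\<in>A. \<exists>v\<in>B. pres_eq X R (u @ v) w}),
      one = pres_class X R []\<rparr>"

text \<open>The homomorphism from a presented group to \<open>H\<close> given on generators by \<open>f\<close>.\<close>

definition eval_word :: "('g, 'm) monoid_scheme \<Rightarrow> ('x \<Rightarrow> 'g) \<Rightarrow> 'x word \<Rightarrow> 'g" where
  "eval_word H f w =
     foldr (\<lambda>(x, b) g. (if b then f x else inv\<^bsub>H\<^esub> (f x)) \<otimes>\<^bsub>H\<^esub> g) w \<one>\<^bsub>H\<^esub>"

definition eval_class :: "('g, 'm) monoid_scheme \<Rightarrow> ('x \<Rightarrow> 'g) \<Rightarrow> 'x word set \<Rightarrow> 'g" where
  "eval_class H f A = the_elem (eval_word H f ` A)"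

section \<open>Complexes of groups and their fundamental groups\<close>

record ('v, 'e, 'g) complex_of_groups = "('v, 'e) scwol" +
  grp :: "'v \<Rightarrow> 'g monoid"
  emb :: "'e \<Rightarrow> 'g \<Rightarrow> 'g"
  twist :: "'e \<Rightarrow> 'e \<Rightarrow> 'g"

text \<open>\<open>Pos a\<close> and \<open>Neg a\<close> are the symbols \<open>a\<^sup>+\<close> and \<open>a\<^sup>-\<close>.\<close>

datatype ('v, 'e, 'g) fg_gen = Elt 'v 'g | Pos 'e | Neg 'e

definition fg_gens :: "('v, 'e, 'g) complex_of_groups \<Rightarrow> ('v, 'e, 'g) fg_gen set" where
  "fg_gens G =
     {Elt v g | v g. v \<in> verts G \<and> g \<in> carrier (grp G v)} \<union> Pos ` edges G \<union> Neg ` edges G"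

definition fg_rels ::
    "('v, 'e, 'g) complex_of_groups \<Rightarrow> (('v, 'e, 'g) fg_gen word \<times> ('v, 'e, 'g) fg_gen word) set" where
  "fg_rels G =
     {([(Elt v g, True), (Elt v g', True)], [(Elt v (g \<otimes>\<^bsub>grp G v\<^esub> g'), True)]) | v g g'.
        v \<in> verts G \<and> g \<in> carrier (grp G v) \<and> g' \<in> carrier (grp G v)} \<union>
     {([(Pos a, False)], [(Neg a, True)]) | a. a \<in> edges G} \<union>
     {([(Neg a, False)], [(Pos a, True)]) | a. a \<in> edges G} \<union>
     {([(Pos a, True), (Pos b, True)],
       [(Elt (ter G a) (twist G a b), True), (Pos (cmp G a b), True)]) | a b. composable G a b} \<union>
     {([(Elt (ter G a) (emb G a g), True)],
       [(Pos a, True), (Elt (ini G a) g, True), (Neg a, True)]) | a g.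
        a \<in> edges G \<and> g \<in> carrier (grp G (ini G a))}"

definition FG :: "('v, 'e, 'g) complex_of_groups \<Rightarrow> ('v, 'e, 'g) fg_gen word set monoid" where
  "FG G = presented_group (fg_gens G) (fg_rels G)"

text \<open>\<open>edge_path_word G v w u\<close>: the word \<open>w\<close> has the form \<open>g\<^sub>0 e\<^sub>1 g\<^sub>1 \<dots> e\<^sub>k g\<^sub>k\<close> over an edge path from
  \<open>v\<close> to \<open>u\<close>, where \<open>a\<^sup>+\<close> leads from \<open>t(a)\<close> to \<open>i(a)\<close> and \<open>a\<^sup>-\<close> from \<open>i(a)\<close> to \<open>t(a)\<close>.\<close>

inductive edge_path_word ::
    "('v, 'e, 'g) complex_of_groups \<Rightarrow> 'v \<Rightarrow> ('v, 'e, 'g) fg_gen word \<Rightarrow> 'v \<Rightarrow> bool"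
  for G :: "('v, 'e, 'g) complex_of_groups" and v :: 'v where
  start: "v \<in> verts G \<Longrightarrow> g \<in> carrier (grp G v) \<Longrightarrow> edge_path_word G v [(Elt v g, True)] v"
| pos: "edge_path_word G v w (ter G a) \<Longrightarrow> a \<in> edges G \<Longrightarrow> g \<in> carrier (grp G (ini G a)) \<Longrightarrow>
    edge_path_word G v (w @ [(Pos a, True), (Elt (ini G a) g, True)]) (ini G a)"
| neg: "edge_path_word G v w (ini G a) \<Longrightarrow> a \<in> edges G \<Longrightarrow> g \<in> carrier (grp G (ter G a)) \<Longrightarrow>
    edge_path_word G v (w @ [(Neg a, True), (Elt (ter G a) g, True)]) (ter G a)"

definition pi1_cog ::
    "('v, 'e, 'g) complex_of_groups \<Rightarrow> 'v \<Rightarrow> ('v, 'e, 'g) fg_gen word set monoid" where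
  "pi1_cog G v =
     (FG G)\<lparr>carrier := {pres_class (fg_gens G) (fg_rels G) w | w. edge_path_word G v w v}\<rparr>"

text \<open>A morphism to a group \<open>H\<close> is given by \<open>\<phi>\<^sub>v\<close> on the local groups and by elements \<open>\<phi>(a)\<close>.\<close>

fun gen_image :: "('h, 'm) monoid_scheme \<Rightarrow> ('v \<Rightarrow> 'g \<Rightarrow> 'h) \<Rightarrow> ('e \<Rightarrow> 'h) \<Rightarrow> ('v, 'e, 'g) fg_gen \<Rightarrow> 'h" where
  "gen_image H \<phi>v \<phi>e (Elt v g) = \<phi>v v g"
| "gen_image H \<phi>v \<phi>e (Pos a) = \<phi>e a"
| "gen_image H \<phi>v \<phi>e (Neg a) = inv\<^bsub>H\<^esub> (\<phi>e a)"

section \<open>The complex of groups of a tribranched surface\<close>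

text \<open>
  \<open>cone_at h C A\<close> joins \<open>A\<close>, a part of the boundary of the tube around \<open>C\<close>, to \<open>C\<close> by radial segments.
\<close>

definition cone_at :: "'a tbs_nbhds \<Rightarrow> 'a set \<Rightarrow> 'a set \<Rightarrow> 'a set" where
  "cone_at h C A = {tub h C (x, of_real r * z) | x r z.
     x \<in> C \<and> z \<in> sphere 0 1 \<and> tub h C (x, z) \<in> A \<and> 0 \<le> r \<and> r \<le> 1}"

text \<open>
  \<open>strand M \<Sigma> h a\<close> is the part of the neighbourhood of \<open>i(a)\<close> that is swept out towards \<open>t(a)\<close> along
  the edge \<open>a\<close>, together with \<open>t(a)\<close>; it deformation retracts to \<open>t(a)\<close>.  If \<open>a\<close> is the only edge
  from \<open>\<lambda> = i(a)\<close> to \<open>\<mu> = t(a)\<close>, its inclusion into the union of the closed neighbourhoods of \<open>\<lambda>\<close>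
  and \<open>\<mu>\<close> is a homotopy equivalence.  If there are several such edges, then that union does
  not retract to \<open>\<mu>\<close>, and the strands tell the edges apart.
\<close>

fun strand :: "'a::topological_space set \<Rightarrow> 'a set \<Rightarrow> 'a tbs_nbhds \<Rightarrow> 'a edge \<Rightarrow> 'a set" where
  "strand M \<Sigma> h (Prong C k) =
     cone_at h C (tub h C ` (C \<times> {ray k})) \<union> cell_set (term_cell M \<Sigma> h (Prong C k))"
| "strand M \<Sigma> h (Sector C k) =
     cone_at h C (tub h C ` (C \<times> sector k \<inter> UNIV \<times> sphere 0 1) \<inter> regions M \<Sigma> h) \<union>
     cell_set (term_cell M \<Sigma> h (Sector C k))"
| "strand M \<Sigma> h (Side S e) =
     bicol h S ` (S \<times> closed_segment 0 e) \<union> cell_set (term_cell M \<Sigma> h (Side S e))"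

text \<open>
  The analogue for a composable pair \<open>(a, b)\<close>: the strands of \<open>a\<close>, \<open>b\<close>, \<open>ab\<close> and the part of the tube
  between those of \<open>b\<close> and \<open>ab\<close>, coned off from the edge of the half collar.
\<close>

fun flag_strand :: "'a::topological_space set \<Rightarrow> 'a set \<Rightarrow> 'a tbs_nbhds \<Rightarrow> 'a edge \<Rightarrow> 'a edge \<Rightarrow> 'a set" where
  "flag_strand M \<Sigma> h (Side S e) (Prong C k) =
     strand M \<Sigma> h (Side S e) \<union> strand M \<Sigma> h (Prong C k) \<union>
     strand M \<Sigma> h (comp_edge h (Side S e) (Prong C k)) \<union>
     cone_at h C (bicol h S ` (tub h C ` (C \<times> {ray k}) \<times> closed_segment 0 e))"
| "flag_strand M \<Sigma> h _ _ = undefined"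

text \<open>
  The choices: base points \<open>x\<^sub>\<lambda>\<close>, the paths \<open>l\<close> for the edges (\<open>link\<close>), a path homotopic
  to \<open>l\<close> in the strand (\<open>slink\<close>), deformation retractions, and the paths \<open>l\<^sub>\<lambda>\<close> from \<open>x\<^sub>0\<close> (\<open>spoke\<close>).
\<close>

record 'a cog_choices =
  base :: "'a cell \<Rightarrow> 'a"
  link :: "'a edge \<Rightarrow> real \<Rightarrow> 'a"
  slink :: "'a edge \<Rightarrow> real \<Rightarrow> 'a"
  retr :: "'a edge \<Rightarrow> 'a \<Rightarrow> 'a"
  flag_retr :: "'a edge \<Rightarrow> 'a edge \<Rightarrow> 'a \<Rightarrow> 'a"
  spoke :: "'a cell \<Rightarrow> real \<Rightarrow> 'a"

text \<open>
  When \<open>a\<close> is the only edge from \<open>i(a)\<close> to \<open>t(a)\<close>, every path \<open>l\<close> in the union of the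
  closed neighbourhoods is homotopic there to a path in the strand, so that the existence of
  \<open>slink\<close> is no restriction on \<open>link\<close>.
\<close>

definition valid_choices ::
    "'a::topological_space set \<Rightarrow> 'a set \<Rightarrow> 'a tbs_nbhds \<Rightarrow> 'a \<Rightarrow> 'a cog_choices \<Rightarrow> bool" where
  "valid_choices M \<Sigma> h x0 P \<longleftrightarrow>
     (\<forall>v\<in>tbs_cells M \<Sigma> h. base P v \<in> cell_set v) \<and>
     (\<forall>a\<in>tbs_edges M \<Sigma> h.
        let U = cell_nbhd h (init_cell a) \<union> cell_nbhd h (term_cell M \<Sigma> h a)
        in path (link P a) \<and> path_image (link P a) \<subseteq> U \<and>
           pathstart (link P a) = base P (init_cell a) \<and>
           pathfinish (link P a) = base P (term_cell M \<Sigma> h a) \<and>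
           path_image (slink P a) \<subseteq> strand M \<Sigma> h a \<and>
           homotopic_paths U (link P a) (slink P a) \<and>
           deformation_retraction (strand M \<Sigma> h a) (cell_set (term_cell M \<Sigma> h a)) (retr P a)) \<and>
     (\<forall>a b. composable (tbs_scwol M \<Sigma> h) a b \<longrightarrow>
        deformation_retraction (flag_strand M \<Sigma> h a b) (cell_set (term_cell M \<Sigma> h a))
          (flag_retr P a b)) \<and>
     (\<forall>v\<in>tbs_cells M \<Sigma> h. path (spoke P v) \<and> path_image (spoke P v) \<subseteq> M \<and>
        pathstart (spoke P v) = x0 \<and> pathfinish (spoke P v) = base P v)"

definition tbs_cog ::
    "'a::topological_space set \<Rightarrow> 'a set \<Rightarrow> 'a tbs_nbhds \<Rightarrow> 'a cog_choices \<Rightarrow>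
     ('a cell, 'a edge, (real \<Rightarrow> 'a) set) complex_of_groups" where
  "tbs_cog M \<Sigma> h P =
     scwol.extend (tbs_scwol M \<Sigma> h)
       (complex_of_groups.fields
         (\<lambda>v. fundamental_group (cell_set v) (base P v))
         (\<lambda>a. class_map (cell_set (term_cell M \<Sigma> h a))
                (\<lambda>c. retr P a \<circ> (reversepath (slink P a) +++ c +++ slink P a)))
         (\<lambda>a b. path_class (cell_set (term_cell M \<Sigma> h a))
                (flag_retr P a b \<circ>
                  (reversepath (slink P a) +++ reversepath (slink P b) +++ slink P (comp_edge h a b)))))"

definition tbs_phi_vertex ::
    "'a::topological_space set \<Rightarrow> 'a cog_choices \<Rightarrow> 'a cell \<Rightarrow> (real \<Rightarrow> 'a) set \<Rightarrow> (real \<Rightarrow> 'a) set" where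
  "tbs_phi_vertex M P v = class_map M (\<lambda>c. spoke P v +++ c +++ reversepath (spoke P v))"

definition tbs_phi_edge ::
    "'a::topological_space set \<Rightarrow> 'a set \<Rightarrow> 'a tbs_nbhds \<Rightarrow> 'a cog_choices \<Rightarrow> 'a edge \<Rightarrow> (real \<Rightarrow> 'a) set" where
  "tbs_phi_edge M \<Sigma> h P a =
     path_class M (spoke P (term_cell M \<Sigma> h a) +++ reversepath (link P a) +++
                   reversepath (spoke P (init_cell a)))"

definition tbs_phi_star ::
    "'a::topological_space set \<Rightarrow> 'a set \<Rightarrow> 'a tbs_nbhds \<Rightarrow> 'a \<Rightarrow> 'a cog_choices \<Rightarrow>
     ('a cell, 'a edge, (real \<Rightarrow> 'a) set) fg_gen word set \<Rightarrow> (real \<Rightarrow> 'a) set" where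
  "tbs_phi_star M \<Sigma> h x0 P =
     eval_class (fundamental_group M x0)
       (gen_image (fundamental_group M x0) (tbs_phi_vertex M P) (tbs_phi_edge M \<Sigma> h P))"

end

theory Submission
  imports Defs "HOL-Analysis.Analysis"
begin

text \<open>
  That \<open>\<phi>\<^sub>\<Sigma>\<close> respects the relations comes down to one fact: a deformation retraction onto \<open>A\<close> moves a
  loop based in \<open>A\<close> only within its homotopy class, so the retractions in the definitions of \<open>\<psi>\<^sub>a\<close> and
  \<open>g\<^sub>a\<^sub>,\<^sub>b\<close> are invisible in \<open>\<pi>\<^sub>1(M)\<close>.

  For surjectivity every cell gets an open neighbourhood that deforms onto it: the open tube of a
  branch curve, and the preimages of the open bicollar of a sheet and of a region with its half
  collars under the radial push out of the tubes.  A loop in \<open>M\<close> runs through finitely many of them.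
  By connectedness of the parameter interval it suffices to see what happens when the cell is
  switched at a point \<open>y\<close> common to two neighbourhoods: \<open>y\<close> can be slid inside both to a point of the
  strand of an edge joining the two cells, and a path in that strand is the chosen path \<open>l\<close> up to an
  element of a local group.

  The geometric input is that the branch set is closed, by invariance of domain, so that there are
  finitely many tubes and collars and the pushes are continuous.
\<close>

section \<open>Calculus of path classes\<close>

text \<open>What is followed along a loop is a partial loop: run up to time t, close up by a path
  inside the neighbourhood of a cell around the current point, return along the spoke of that cell.
  The claim is that its class is the value of an edge path word ending at that cell. It is made for
  all such cells and all closing paths at once; this makes it symmetric between nearby times, so
  that no subdivision is chosen.

  The obstacle is the switch of cells. Two cells can be joined by several edges, and the edge has to
  be read off from the point itself. Inside a tube the point is projected radially to the tube
  boundary and slid there along a line of the bicollar; the ray or arc that is reached names the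
  edge, and the slide is then copied at the original radius. This rests on the condition in
  \<open>nbhd_system\<close> that a collar line which touches a closed tube stays in it. Both pushes
  are singular on their cores, which is why the neighbourhoods of sheets avoid the branch set and
  those of regions avoid in addition what is pushed onto the sheets.\<close>

definition path_from_to :: "'a::topological_space set \<Rightarrow> 'a \<Rightarrow> (real \<Rightarrow> 'a) \<Rightarrow> 'a \<Rightarrow> bool" where
  "path_from_to X a p b \<longleftrightarrow> path p \<and> path_image p \<subseteq> X \<and> pathstart p = a \<and> pathfinish p = b"

lemma path_from_to_join:
  "path_from_to X a p b \<Longrightarrow> path_from_to X b q c \<Longrightarrow> path_from_to X a (p +++ q) c"
  by (auto simp: path_from_to_def subset_path_image_join)

lemma path_from_to_rev: "path_from_to X a p b \<Longrightarrow> path_from_to X b (reversepath p) a"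
  by (auto simp: path_from_to_def)

lemma path_from_to_const: "a \<in> X \<Longrightarrow> path_from_to X a (\<lambda>_. a) a"
  by (auto simp: path_from_to_def path_def path_image_def pathstart_def pathfinish_def)

lemma path_from_to_mono: "path_from_to X a p b \<Longrightarrow> X \<subseteq> Y \<Longrightarrow> path_from_to Y a p b"
  by (auto simp: path_from_to_def)

lemma path_from_to_image:
  assumes "path_from_to X a p b" "continuous_on X f" "f ` X \<subseteq> Y"
  shows "path_from_to Y (f a) (f \<circ> p) (f b)"
  using assms unfolding path_from_to_def
  by (auto simp: path_continuous_image continuous_on_subset path_image_compose pathstart_compose pathfinish_compose)

lemma path_from_to_in: 
  assumes "path_from_to X a p b" shows "a \<in> X" "b \<in> X"
  using assms unfolding path_from_to_def by auto

lemma path_component_iff_path_from_to: "path_component X a b \<longleftrightarrow> (\<exists>p. path_from_to X a p b)"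
  by (auto simp: path_component_def path_from_to_def)

lemma loops_iff: "c \<in> loops X x \<longleftrightarrow> path_from_to X x c x"
  by (auto simp: loops_def path_from_to_def)

lemma homotopic_paths_path_from_to:
  "homotopic_paths X p q \<Longrightarrow> path_from_to X a p b \<Longrightarrow> path_from_to X a q b"
  unfolding path_from_to_def
  by (metis homotopic_paths_imp_path homotopic_paths_imp_pathfinish homotopic_paths_imp_pathstart
      homotopic_paths_imp_subset)

text \<open>Paths in the convex set [0,1] with common ends are homotopic along straight lines, and
  \<open>p\<close> carries this homotopy into \<open>X\<close>. As \<open>X\<close> has no linear
  structure, the unit and inverse laws below are all obtained this way, from paths in the parameter
  interval.\<close>

lemma homotopic_paths_unit_interval:
  assumes "path p" "path_image p \<subseteq> X"
    and "path_from_to {0..1} s u t" "path_from_to {0..1} s v t"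
  shows "homotopic_paths X (p \<circ> u) (p \<circ> v)"
proof (rule homotopic_paths_continuous_image)
  show "homotopic_paths {0..1} u v"
  proof (rule homotopic_paths_linear)
    fix r :: real assume "r \<in> {0..1}"
    then have "u r \<in> {0..1}" "v r \<in> {0..1}"
      using assms unfolding path_from_to_def path_image_def by blast+
    then show "closed_segment (u r) (v r) \<subseteq> {0..1}"
      by (simp add: closed_segment_subset)
  qed (use assms in \<open>auto simp: path_from_to_def\<close>)
  show "continuous_on {0..1} p" using assms by (simp add: path_def)
  show "p \<in> {0..1} \<rightarrow> X" using assms by (auto simp: path_image_def)
qed

lemma path_from_to_linepath:
  "a \<in> {0..1} \<Longrightarrow> b \<in> {0..1} \<Longrightarrow> path_from_to {0..1::real} a (linepath a b) b"
  by (simp add: path_from_to_def closed_segment_subset)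

lemma comp_linepath_0_1: "p \<circ> linepath 0 1 = (p :: real \<Rightarrow> 'a)"
  by (auto simp: linepath_def)

lemma homotopic_paths_rid_const:
  assumes "path_from_to X a p b"
  shows "homotopic_paths X (p +++ (\<lambda>_. b)) p"
proof -
  have "homotopic_paths X (p \<circ> (linepath 0 1 +++ linepath 1 1)) (p \<circ> linepath 0 1)"
    using assms by (intro homotopic_paths_unit_interval path_from_to_join path_from_to_linepath)
      (auto simp: path_from_to_def closed_segment_eq_real_ivl)
  moreover have "p \<circ> (linepath 0 1 +++ linepath 1 1) = p +++ (\<lambda>_. b)"
    using assms unfolding path_compose_join comp_linepath_0_1
    by (auto simp: path_from_to_def pathfinish_def o_def)
  ultimately show ?thesis by (simp add: comp_linepath_0_1)
qed

lemma homotopic_paths_lid_const: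
  assumes "path_from_to X a p b"
  shows "homotopic_paths X ((\<lambda>_. a) +++ p) p"
proof -
  have "homotopic_paths X (p \<circ> (linepath 0 0 +++ linepath 0 1)) (p \<circ> linepath 0 1)"
    using assms by (intro homotopic_paths_unit_interval path_from_to_join path_from_to_linepath)
      (auto simp: path_from_to_def closed_segment_eq_real_ivl)
  moreover have "p \<circ> (linepath 0 0 +++ linepath 0 1) = (\<lambda>_. a) +++ p"
    using assms unfolding path_compose_join comp_linepath_0_1
    by (auto simp: path_from_to_def pathstart_def o_def)
  ultimately show ?thesis by (simp add: comp_linepath_0_1)
qed

lemma homotopic_paths_rinv_const:
  assumes "path_from_to X a p b"
  shows "homotopic_paths X (p +++ reversepath p) (\<lambda>_. a)"
proof -
  have "homotopic_paths X (p \<circ> (linepath 0 1 +++ linepath 1 0)) (p \<circ> linepath 0 0)"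
    using assms by (intro homotopic_paths_unit_interval path_from_to_join path_from_to_linepath)
      (auto simp: path_from_to_def closed_segment_eq_real_ivl)
  moreover have "p \<circ> (linepath 0 1 +++ linepath 1 0) = p +++ reversepath p"
    unfolding path_compose_join comp_linepath_0_1
    by (auto simp: o_def linepath_def reversepath_def)
  moreover have "p \<circ> linepath 0 0 = (\<lambda>_. a)"
    using assms by (auto simp: path_from_to_def pathstart_def o_def)
  ultimately show ?thesis by simp
qed

lemma homotopic_paths_linv_const:
  assumes "path_from_to X a p b"
  shows "homotopic_paths X (reversepath p +++ p) (\<lambda>_. b)"
  using homotopic_paths_rinv_const[OF path_from_to_rev[OF assms]] by simp

lemma homotopic_paths_refl_from_to: "path_from_to X a p b \<Longrightarrow> homotopic_paths X p p"
  by (simp add: path_from_to_def)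

lemma homotopic_paths_join_from_to:
  assumes "homotopic_paths X p p'" "homotopic_paths X q q'" "path_from_to X a p b" "path_from_to X b q c"
  shows "homotopic_paths X (p +++ q) (p' +++ q')"
  using assms by (auto simp: path_from_to_def intro: homotopic_paths_join)

lemma homotopic_paths_assoc_from_to:
  assumes "path_from_to X a p b" "path_from_to X b q c" "path_from_to X c r d"
  shows "homotopic_paths X ((p +++ q) +++ r) (p +++ q +++ r)"
  using assms by (intro homotopic_paths_sym[OF homotopic_paths_assoc]) (auto simp: path_from_to_def)

lemma path_class_eq_iff:
  assumes "path_from_to X a p b"
  shows "path_class X p = path_class X q \<longleftrightarrow> homotopic_paths X p q"
  using assms unfolding path_class_def set_eq_iff
  by (metis homotopic_paths_refl_from_to homotopic_paths_sym homotopic_paths_trans mem_Collect_eq)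

lemma path_class_eqI: "homotopic_paths X p q \<Longrightarrow> path_class X p = path_class X q"
  unfolding path_class_def set_eq_iff
  by (metis homotopic_paths_sym homotopic_paths_trans mem_Collect_eq)

lemma fundamental_group_carrier:
  "A \<in> carrier (fundamental_group X x) \<longleftrightarrow> (\<exists>c. path_from_to X x c x \<and> A = path_class X c)"
  by (auto simp: fundamental_group_def loops_iff)

lemma path_class_in_carrier:
  "path_from_to X x c x \<Longrightarrow> path_class X c \<in> carrier (fundamental_group X x)"
  by (auto simp: fundamental_group_carrier)

lemma fundamental_group_one: "\<one>\<^bsub>fundamental_group X x\<^esub> = path_class X (\<lambda>_. x)"
  by (simp add: fundamental_group_def)

text \<open>The product in \<open>fundamental_group\<close> ranges over all representatives of both
  factors; compatibility of joining with homotopy reduces it to one pair.\<close>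

lemma path_class_mult:
  assumes "path_from_to X x p x" "path_from_to X x q x"
  shows "path_class X p \<otimes>\<^bsub>fundamental_group X x\<^esub> path_class X q = path_class X (p +++ q)"
proof -
  have "homotopic_paths X (p +++ q) r" 
    if "homotopic_paths X p p'" "homotopic_paths X q q'" "homotopic_paths X (p' +++ q') r" for p' q' r
    using homotopic_paths_join_from_to[OF that(1,2) assms] that(3) homotopic_paths_trans by blast
  then show ?thesis
    using homotopic_paths_refl_from_to[OF assms(1)] homotopic_paths_refl_from_to[OF assms(2)]
    unfolding fundamental_group_def path_class_def by auto (metis assms homotopic_paths_refl_from_to)
qed

lemma group_fundamental_group:
  assumes "x \<in> X" shows "group (fundamental_group X x)"
proof (rule groupI)
  let ?G = "fundamental_group X x"
  note fc = fundamental_group_carrier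
  show "\<one>\<^bsub>?G\<^esub> \<in> carrier ?G"
    unfolding fundamental_group_one by (rule path_class_in_carrier[OF path_from_to_const[OF assms]])
  show "A \<otimes>\<^bsub>?G\<^esub> B \<in> carrier ?G" if "A \<in> carrier ?G" "B \<in> carrier ?G" for A B
    using that path_from_to_join unfolding fc by (metis path_class_mult)
  show "A \<otimes>\<^bsub>?G\<^esub> B \<otimes>\<^bsub>?G\<^esub> D = A \<otimes>\<^bsub>?G\<^esub> (B \<otimes>\<^bsub>?G\<^esub> D)" 
    if ABD: "A \<in> carrier ?G" "B \<in> carrier ?G" "D \<in> carrier ?G" for A B D
  proof -
    obtain p q r where *: "path_from_to X x p x" "path_from_to X x q x" "path_from_to X x r x"
      "A = path_class X p" "B = path_class X q" "D = path_class X r"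
      using ABD unfolding fc by blast
    then show ?thesis
      using path_class_eqI[OF homotopic_paths_assoc_from_to[OF *(1-3)]]
      by (simp add: path_class_mult path_from_to_join[OF *(1,2)] path_from_to_join[OF *(2,3)])
  qed
  show "\<one>\<^bsub>?G\<^esub> \<otimes>\<^bsub>?G\<^esub> A = A" if A: "A \<in> carrier ?G" for A
  proof -
    obtain p where *: "path_from_to X x p x" "A = path_class X p"
      using A unfolding fc by blast
    then show ?thesis unfolding fundamental_group_one
      by (simp add: path_class_mult[OF path_from_to_const[OF assms]] path_class_eqI[OF homotopic_paths_lid_const])
  qed
  show "\<exists>B\<in>carrier ?G. B \<otimes>\<^bsub>?G\<^esub> A = \<one>\<^bsub>?G\<^esub>" if A: "A \<in> carrier ?G" for A
  proof -
    obtain p where *: "path_from_to X x p x" "A = path_class X p"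
      using A unfolding fc by blast
    then show ?thesis unfolding fundamental_group_one
      by (intro bexI[of _ "path_class X (reversepath p)"])
         (auto simp: path_class_mult path_from_to_rev path_class_eqI[OF homotopic_paths_linv_const] intro: path_class_in_carrier)
  qed
qed

lemma path_class_inv:
  assumes "path_from_to X x p x"
  shows "inv\<^bsub>fundamental_group X x\<^esub> (path_class X p) = path_class X (reversepath p)"
proof -
  interpret group "fundamental_group X x" by (rule group_fundamental_group[OF path_from_to_in(1)[OF assms]])
  have "path_class X (reversepath p) \<otimes>\<^bsub>fundamental_group X x\<^esub> path_class X p = \<one>\<^bsub>fundamental_group X x\<^esub>"
    unfolding fundamental_group_one 
    using path_class_eqI[OF homotopic_paths_linv_const[OF assms]] assms
    by (simp add: path_class_mult path_from_to_rev)
  then show ?thesis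
    using assms by (intro inv_equality) (auto intro!: path_class_in_carrier path_from_to_rev)
qed

text \<open>\<open>class_map\<close> collects the images of all representatives; the second
  assumption makes \<open>F\<close> well defined on classes, so a single representative
  suffices.\<close>

lemma class_map_path_class:
  assumes "path_from_to X a p b"
    and "\<And>q. homotopic_paths X p q \<Longrightarrow> homotopic_paths Y (F p) (F q)"
  shows "class_map Y F (path_class X p) = path_class Y (F p)"
proof -
  have "homotopic_paths X p p" using assms(1) by (rule homotopic_paths_refl_from_to)
  then show ?thesis
    unfolding class_map_def path_class_def
    using assms(2) homotopic_paths_trans by blast
qed

text \<open>The image of \<open>p\<close> when the fundamental groupoid is carried to the vertex
  group at \<open>x\<close> by means of the tails \<open>u\<close> and \<open>v\<close>. The next
  lemmas are functoriality of this assignment, so that path calculations in \<open>M\<close> turn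
  into group calculations.\<close>

definition tailed :: "'a::topological_space set \<Rightarrow> (real \<Rightarrow> 'a) \<Rightarrow> (real \<Rightarrow> 'a) \<Rightarrow> (real \<Rightarrow> 'a) \<Rightarrow> (real \<Rightarrow> 'a) set" where
  "tailed X u p v = path_class X (u +++ p +++ reversepath v)"

lemma tailed_loop:
  assumes "path_from_to X x u a" "path_from_to X a p b" "path_from_to X x v b"
  shows "path_from_to X x (u +++ p +++ reversepath v) x"
  by (rule path_from_to_join[OF assms(1) path_from_to_join[OF assms(2) path_from_to_rev[OF assms(3)]]])

lemma tailed_carrier:
  assumes "path_from_to X x u a" "path_from_to X a p b" "path_from_to X x v b"
  shows "tailed X u p v \<in> carrier (fundamental_group X x)"
  unfolding tailed_def using tailed_loop[OF assms] by (rule path_class_in_carrier)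

lemma tailed_cong:
  assumes "path_from_to X x u a" "path_from_to X a p b" "path_from_to X x v b" "homotopic_paths X p q"
  shows "tailed X u p v = tailed X u q v"
  unfolding tailed_def
  using path_from_to_rev[OF assms(3)]
  by (intro path_class_eqI homotopic_paths_join_from_to[OF homotopic_paths_refl_from_to[OF assms(1)] _ assms(1)]
      homotopic_paths_join_from_to[OF assms(4) homotopic_paths_refl_from_to assms(2)]
      path_from_to_join[OF assms(2)])

lemma tailed_const:
  assumes "path_from_to X x u a"
  shows "tailed X u (\<lambda>_. a) u = \<one>\<^bsub>fundamental_group X x\<^esub>"
proof -
  have "homotopic_paths X (u +++ (\<lambda>_. a) +++ reversepath u) (u +++ reversepath u)"
    using homotopic_paths_join_from_to[OF homotopic_paths_refl_from_to[OF assms]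
        homotopic_paths_lid_const[OF path_from_to_rev[OF assms]] assms
        path_from_to_join[OF path_from_to_const[OF path_from_to_in(2)[OF assms]] path_from_to_rev[OF assms]]] .
  also have "homotopic_paths X (u +++ reversepath u) (\<lambda>_. x)"
    using assms by (rule homotopic_paths_rinv_const)
  finally show ?thesis
    by (simp add: tailed_def fundamental_group_one path_class_eqI)
qed

text \<open>In the middle the tail \<open>v\<close> is run back and forth and cancels; everything
  else is reassociation.\<close>

lemma tailed_mult:
  assumes u: "path_from_to X x u a" and p: "path_from_to X a p b" and v: "path_from_to X x v b"
    and q: "path_from_to X b q c" and w: "path_from_to X x w c"
  shows "tailed X u p v \<otimes>\<^bsub>fundamental_group X x\<^esub> tailed X v q w = tailed X u (p +++ q) w"
proof -
  let ?v = "reversepath v" and ?w = "reversepath w"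
  note v' = path_from_to_rev[OF v] and w' = path_from_to_rev[OF w]
  note J = path_from_to_join and R = homotopic_paths_refl_from_to and A = homotopic_paths_assoc_from_to
  note vqw = J[OF v J[OF q w']]
  have 1: "homotopic_paths X ((u +++ p +++ ?v) +++ (v +++ q +++ ?w)) (u +++ (p +++ ?v) +++ (v +++ q +++ ?w))"
    by (rule A[OF u J[OF p v'] vqw])
  have 2: "homotopic_paths X ((p +++ ?v) +++ (v +++ q +++ ?w)) (p +++ ?v +++ (v +++ q +++ ?w))"
    by (rule A[OF p v' vqw])
  have 3: "homotopic_paths X (?v +++ (v +++ q +++ ?w)) ((?v +++ v) +++ (q +++ ?w))"
    by (rule homotopic_paths_sym[OF A[OF v' v J[OF q w']]])
  have 4: "homotopic_paths X ((?v +++ v) +++ (q +++ ?w)) ((\<lambda>_. b) +++ (q +++ ?w))"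
    by (rule homotopic_paths_join_from_to[OF homotopic_paths_linv_const[OF v] R[OF J[OF q w']] J[OF v' v] J[OF q w']])
  have 5: "homotopic_paths X ((\<lambda>_. b) +++ (q +++ ?w)) (q +++ ?w)"
    by (rule homotopic_paths_lid_const[OF J[OF q w']])
  have 6: "homotopic_paths X (?v +++ (v +++ q +++ ?w)) (q +++ ?w)"
    using 3 4 5 homotopic_paths_trans by blast
  have 7: "homotopic_paths X (p +++ (?v +++ (v +++ q +++ ?w))) (p +++ (q +++ ?w))"
    by (rule homotopic_paths_join_from_to[OF R[OF p] 6 p J[OF v' vqw]])
  have 8: "homotopic_paths X (p +++ q +++ ?w) ((p +++ q) +++ ?w)"
    by (rule homotopic_paths_sym[OF A[OF p q w']])
  have 9: "homotopic_paths X ((p +++ ?v) +++ (v +++ q +++ ?w)) ((p +++ q) +++ ?w)"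
    using 2 7 8 homotopic_paths_trans by blast
  have "homotopic_paths X (u +++ (p +++ ?v) +++ (v +++ q +++ ?w)) (u +++ (p +++ q) +++ ?w)"
    by (rule homotopic_paths_join_from_to[OF R[OF u] 9 u J[OF J[OF p v'] vqw]])
  with 1 have "homotopic_paths X ((u +++ p +++ ?v) +++ (v +++ q +++ ?w)) (u +++ (p +++ q) +++ ?w)"
    using homotopic_paths_trans by blast
  then show ?thesis
    unfolding tailed_def
    by (simp add: path_class_mult[OF tailed_loop[OF u p v] tailed_loop[OF v q w]] path_class_eqI)
qed

lemma tailed_inv:
  assumes u: "path_from_to X x u a" and p: "path_from_to X a p b" and v: "path_from_to X x v b"
  shows "inv\<^bsub>fundamental_group X x\<^esub> (tailed X u p v) = tailed X v (reversepath p) u"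
proof -
  have "x \<in> X" using path_from_to_in[OF u] by simp
  then interpret group "fundamental_group X x" by (rule group_fundamental_group)
  note p' = path_from_to_rev[OF p]
  have "tailed X v (reversepath p) u \<otimes>\<^bsub>fundamental_group X x\<^esub> tailed X u p v = tailed X v (reversepath p +++ p) v"
    by (rule tailed_mult[OF v p' u p v])
  also have "\<dots> = tailed X v (\<lambda>_. b) v"
    by (rule tailed_cong[OF v path_from_to_join[OF p' p] v homotopic_paths_linv_const[OF p]])
  also have "\<dots> = \<one>\<^bsub>fundamental_group X x\<^esub>" by (rule tailed_const[OF v])
  finally show ?thesis
    by (intro inv_equality) (auto intro: tailed_carrier[OF u p v] tailed_carrier[OF v p' u])
qed

text \<open>The two ways around the unit square from (0,0) to (1,1) are homotopic along straight
  lines, the square being convex; \<open>K\<close> transports this homotopy.\<close>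

lemma homotopic_paths_square:
  assumes K: "continuous_on ({0..1} \<times> {0..1}) K" "K ` ({0..1} \<times> {0..1}) \<subseteq> X"
  shows "homotopic_paths X ((\<lambda>t. K (t, 0)) +++ (\<lambda>t. K (1, t))) ((\<lambda>t. K (0, t)) +++ (\<lambda>t. K (t, 1)))"
proof -
  let ?I = "{0..1::real} \<times> {0..1::real}"
  let ?l = "\<lambda>a b. linepath a b :: real \<Rightarrow> real \<times> real"
  have conv: "convex ?I" by (intro convex_Times) auto
  have im: "path_image (linepath a b +++ linepath b c) \<subseteq> ?I" if "a \<in> ?I" "b \<in> ?I" "c \<in> ?I" for a b c
    using that conv by (simp add: subset_path_image_join closed_segment_subset)
  have "homotopic_paths ?I (?l (0,0) (1,0) +++ ?l (1,0) (1,1)) (?l (0,0) (0,1) +++ ?l (0,1) (1,1))"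
  proof (rule homotopic_paths_linear)
    fix t :: real assume t: "t \<in> {0..1}"
    have "(?l (0,0) (1,0) +++ ?l (1,0) (1,1)) t \<in> ?I" "(?l (0,0) (0,1) +++ ?l (0,1) (1,1)) t \<in> ?I"
      using im[of "(0,0)" "(1,0)" "(1,1)"] im[of "(0,0)" "(0,1)" "(1,1)"] t 
      by (auto simp: path_image_def simp del: mem_Times_iff)
    then show "closed_segment ((?l (0,0) (1,0) +++ ?l (1,0) (1,1)) t) ((?l (0,0) (0,1) +++ ?l (0,1) (1,1)) t) \<subseteq> ?I"
      using conv by (meson closed_segment_subset)
  qed auto
  then have "homotopic_paths X (K \<circ> (?l (0,0) (1,0) +++ ?l (1,0) (1,1))) (K \<circ> (?l (0,0) (0,1) +++ ?l (0,1) (1,1)))"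
    by (rule homotopic_paths_continuous_image) (use K in auto)
  moreover have "K \<circ> (?l (0,0) (1,0) +++ ?l (1,0) (1,1)) = (\<lambda>t. K (t, 0)) +++ (\<lambda>t. K (1, t))"
    "K \<circ> (?l (0,0) (0,1) +++ ?l (0,1) (1,1)) = (\<lambda>t. K (0, t)) +++ (\<lambda>t. K (t, 1))"
    unfolding path_compose_join by (simp_all add: linepath_def o_def)
  ultimately show ?thesis by simp
qed

text \<open>The homotopy from the identity to \<open>r\<close> drags the base point around a loop \<open>\<gamma>\<close>, so that \<open>r\<close>
  conjugates by \<open>\<gamma>\<close>; applied to \<open>\<gamma> c \<gamma>\<^sup>-\<^sup>1\<close> this shows that \<open>c\<close> is homotopic to a loop in \<open>A\<close>,
  which \<open>r\<close> fixes.\<close>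

lemma deformation_retraction_loop:
  assumes dr: "deformation_retraction X A r" and aA: "a \<in> A" and c: "path_from_to X a c a"
  shows "homotopic_paths X c (r \<circ> c)" "path_from_to A a (r \<circ> c) a"
proof -
  have r: "retraction X A r" and "homotopic_with_canon (\<lambda>_. True) X X id r"
    using dr by (auto simp: deformation_retraction_def)
  then obtain H where "continuous_on ({0..1::real} \<times> X) H" "H ` ({0..1} \<times> X) \<subseteq> X"
    "\<forall>x. H (0, x) = id x" "\<forall>x. H (1, x) = r x"
    unfolding homotopic_with_def by (auto simp: image_subset_iff_funcset)
  then have H: "continuous_on ({0..1} \<times> X) H" "H ` ({0..1} \<times> X) \<subseteq> X"
    "\<And>x. x \<in> X \<Longrightarrow> H (0, x) = x" "\<And>x. x \<in> X \<Longrightarrow> H (1, x) = r x"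
    by auto
  have rA: "continuous_on X r" "r ` X \<subseteq> A" "\<And>x. x \<in> A \<Longrightarrow> r x = x" "A \<subseteq> X"
    using r by (auto simp: retraction_def)
  have aX: "a \<in> X" using aA rA by auto
  interpret group "fundamental_group X a" by (rule group_fundamental_group[OF aX])
  let ?G = "fundamental_group X a"
  have rl: "path_from_to A a (r \<circ> d) a" if "path_from_to X a d a" for d
    using path_from_to_image[OF that rA(1,2)] rA(3) aA by simp
  then show "path_from_to A a (r \<circ> c) a" using c by simp
  define \<gamma> where "\<gamma> = (\<lambda>t. H (t, a))"
  have \<gamma>: "path_from_to X a \<gamma> a"
    unfolding path_from_to_def \<gamma>_def path_def path_image_def pathstart_def pathfinish_def
    using H aX aA rA by (auto intro!: continuous_on_compose2[OF H(1)] continuous_intros)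
  \<comment> \<open>The square is \<open>H (s, d t)\<close>: its sides are the track \<gamma> of the
    base point, \<open>r\<close> applied to \<open>d\<close>, \<open>d\<close> itself, and \<gamma>
    again.\<close>
  have sq: "homotopic_paths X (\<gamma> +++ (r \<circ> d)) (d +++ \<gamma>)" if d: "path_from_to X a d a" for d
  proof -
    have d': "continuous_on {0..1} d" "\<And>t. t \<in> {0..1} \<Longrightarrow> d t \<in> X" "d 0 = a" "d 1 = a"
      using d by (auto simp: path_from_to_def path_def path_image_def pathstart_def pathfinish_def)
    have "homotopic_paths X ((\<lambda>t. H (t, d 0)) +++ (\<lambda>t. H (1, d t))) ((\<lambda>t. H (0, d t)) +++ (\<lambda>t. H (t, d 1)))"
    proof -
      have "continuous_on ({0..1} \<times> {0..1}) (\<lambda>y. H (fst y, d (snd y)))"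
        using d' by (auto intro!: continuous_on_compose2[OF H(1)] continuous_on_compose2[OF d'(1)] continuous_intros)
      moreover have "(\<lambda>y. H (fst y, d (snd y))) ` ({0..1} \<times> {0..1}) \<subseteq> X"
        using d' H(2) by auto
      ultimately show ?thesis using homotopic_paths_square[of "\<lambda>y. H (fst y, d (snd y))" X] by simp
    qed
    moreover have "path_from_to X a (\<gamma> +++ (r \<circ> d)) a" "path_from_to X a (d +++ \<gamma>) a"
      using path_from_to_join[OF \<gamma> path_from_to_mono[OF rl[OF d] rA(4)]] path_from_to_join[OF d \<gamma>] by simp_all
    then have "homotopic_paths X (\<gamma> +++ (r \<circ> d)) ((\<lambda>t. H (t, d 0)) +++ (\<lambda>t. H (1, d t)))"
      "homotopic_paths X (d +++ \<gamma>) ((\<lambda>t. H (0, d t)) +++ (\<lambda>t. H (t, d 1)))"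
      using d' H by (auto simp: joinpaths_def \<gamma>_def path_from_to_def intro!: homotopic_paths_eq)
    ultimately show ?thesis using homotopic_paths_sym homotopic_paths_trans by blast
  qed
  note J = path_from_to_join and c' = path_from_to_mono[OF rl rA(4)]
  define d where "d = \<gamma> +++ c +++ reversepath \<gamma>"
  have d: "path_from_to X a d a"
    unfolding d_def by (rule J[OF \<gamma> J[OF c path_from_to_rev[OF \<gamma>]]])
  have "path_class X \<gamma> \<otimes>\<^bsub>?G\<^esub> path_class X (r \<circ> d) = path_class X d \<otimes>\<^bsub>?G\<^esub> path_class X \<gamma>"
    using path_class_eqI[OF sq[OF d]] by (simp add: path_class_mult \<gamma> c' d)
  also have "path_class X d = path_class X \<gamma> \<otimes>\<^bsub>?G\<^esub> (path_class X c \<otimes>\<^bsub>?G\<^esub> inv\<^bsub>?G\<^esub> path_class X \<gamma>)"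
    unfolding d_def
    by (simp add: path_class_inv[OF \<gamma>] path_class_mult \<gamma> c path_from_to_rev J[OF c path_from_to_rev[OF \<gamma>]])
  finally have "path_class X (r \<circ> d) = path_class X c"
    using path_class_in_carrier[OF \<gamma>] path_class_in_carrier[OF c] path_class_in_carrier[OF c'[OF d]]
    by (metis (no_types, lifting) inv_closed l_inv l_one m_assoc m_closed r_one)
  then have cd: "homotopic_paths X (r \<circ> d) c" using path_class_eq_iff[OF c'[OF d]] by simp
  \<comment> \<open>\<open>r \<circ> d\<close> runs in \<open>A\<close> already, where
    \<open>r\<close> is the identity; so \<open>c\<close>, \<open>r \<circ> d\<close>,
    \<open>r \<circ> (r \<circ> d)\<close> and \<open>r \<circ> c\<close> are homotopic in
    turn.\<close>
  have "homotopic_paths X (r \<circ> (r \<circ> d)) (r \<circ> c)"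
    by (rule homotopic_paths_continuous_image[OF cd]) (use rA in auto)
  moreover have "homotopic_paths X (r \<circ> d) (r \<circ> (r \<circ> d))"
    using c'[OF d] rl[OF d] rA(3) by (intro homotopic_paths_eq) (auto simp: path_from_to_def path_image_def image_subset_iff)
  ultimately show "homotopic_paths X c (r \<circ> c)"
    using cd homotopic_paths_sym homotopic_paths_trans by blast
qed

text \<open>With both end points at rest during the deformation, \<open>H\<close> applied to
  \<open>c\<close> at varying times is itself a homotopy of paths, and no conjugation by a track
  appears.\<close>

lemma strong_deformation_path:
  assumes H: "continuous_on ({0..1::real} \<times> X) H" "H ` ({0..1} \<times> X) \<subseteq> Y"
    "\<And>x. x \<in> X \<Longrightarrow> H (0, x) = x" "\<And>t. t \<in> {0..1} \<Longrightarrow> H (t, a) = a" "\<And>t. t \<in> {0..1} \<Longrightarrow> H (t, b) = b"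
    and c: "path_from_to X a c b"
  shows "homotopic_paths Y c (\<lambda>t. H (1, c t))"
proof -
  have c': "continuous_on {0..1} c" "\<And>t. t \<in> {0..1} \<Longrightarrow> c t \<in> X" "c 0 = a" "c 1 = b"
    using c by (auto simp: path_from_to_def path_def path_image_def pathstart_def pathfinish_def)
  let ?K = "\<lambda>y. H (fst y, c (snd y))"
  have "continuous_on ({0..1} \<times> {0..1}) ?K"
    using c' by (auto intro!: continuous_on_compose2[OF H(1)] continuous_on_compose2[OF c'(1)] continuous_intros)
  moreover have "?K \<in> {0..1} \<times> {0..1} \<rightarrow> Y" using H(2) c' by auto
  moreover have "?K (0, t) = c t" if "t \<in> {0..1}" for t using H(3) c' that by simp
  moreover have "pathstart (?K \<circ> Pair t) = pathstart c \<and> pathfinish (?K \<circ> Pair t) = pathfinish c"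
    if "t \<in> {0..1}" for t using that c' H by (auto simp: pathstart_def pathfinish_def)
  ultimately show ?thesis
    unfolding homotopic_paths by - (rule exI[of _ ?K], simp)
qed

section \<open>Words in generators\<close>

lemma words_simps [simp]:
  "[] \<in> words X" "(x, b) # w \<in> words X \<longleftrightarrow> x \<in> X \<and> w \<in> words X"
  "u @ v \<in> words X \<longleftrightarrow> u \<in> words X \<and> v \<in> words X"
  by (auto simp: words_def)

lemma eval_word_Nil [simp]: "eval_word H f [] = \<one>\<^bsub>H\<^esub>"
  by (simp add: eval_word_def)

lemma eval_word_Cons [simp]:
  "eval_word H f ((x, b) # w) = (if b then f x else inv\<^bsub>H\<^esub> (f x)) \<otimes>\<^bsub>H\<^esub> eval_word H f w"
  by (simp add: eval_word_def)

lemma eval_word_closed: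
  assumes "group H" "f ` X \<subseteq> carrier H" "w \<in> words X"
  shows "eval_word H f w \<in> carrier H"
proof -
  interpret group H by fact
  show ?thesis using assms(2,3) by (induction w) (auto simp: words_def)
qed

lemma eval_word_append:
  assumes "group H" "f ` X \<subseteq> carrier H" "u \<in> words X" "v \<in> words X"
  shows "eval_word H f (u @ v) = eval_word H f u \<otimes>\<^bsub>H\<^esub> eval_word H f v"
  using assms(3)
proof (induction u)
  interpret group H by fact
  case Nil
  show ?case using eval_word_closed[OF assms(1,2,4)] by simp
next
  interpret group H by fact
  case (Cons g u)
  obtain x b where g: "g = (x, b)" by (cases g)
  have "f x \<in> carrier H" using Cons(2) assms(2) g by auto
  moreover have "eval_word H f u \<in> carrier H" "eval_word H f v \<in> carrier H"
    using eval_word_closed[OF assms(1,2)] Cons(2) assms(4) g by auto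
  ultimately show ?case using Cons g by (simp add: m_assoc)
qed

lemma pres_eq_words: "pres_eq X R u v \<Longrightarrow> u \<in> words X \<and> v \<in> words X"
  by (induction rule: pres_eq.induct) auto

text \<open>\<open>pres_eq\<close> is the least congruence containing the relations and free
  cancellation, so induction over its rules leaves only the relations to check, and these are the
  hypothesis \<open>R\<close>.\<close>

lemma eval_word_pres_eq:
  assumes H: "group H" "f ` X \<subseteq> carrier H"
    and R: "\<And>u v. (u, v) \<in> R \<Longrightarrow> u \<in> words X \<Longrightarrow> v \<in> words X \<Longrightarrow> eval_word H f u = eval_word H f v"
    and "pres_eq X R u v"
  shows "eval_word H f u = eval_word H f v"
  using assms(4)
proof (induction rule: pres_eq.induct)
  case (append u u' v v')
  then show ?case using eval_word_append[OF H] pres_eq_words by metis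
next
  case (cancel x b)
  then have "f x \<in> carrier H" using H by auto
  then show ?case using H(1) by (auto simp: group.r_inv group.l_inv monoid.r_one group.is_monoid)
qed (use R in auto)

context
  fixes X :: "'x set" and R :: "('x word \<times> 'x word) set" and H :: "('g, 'm) monoid_scheme" and f
  assumes H: "group H" and f: "f ` X \<subseteq> carrier H"
    and R: "\<And>u v. (u, v) \<in> R \<Longrightarrow> u \<in> words X \<Longrightarrow> v \<in> words X \<Longrightarrow> eval_word H f u = eval_word H f v"
begin

text \<open>Evaluation is constant on a class, so the image in \<open>eval_class\<close> is a
  singleton and \<open>the_elem\<close> returns its element.\<close>

lemma eval_class_pres_class:
  assumes "w \<in> words X" shows "eval_class H f (pres_class X R w) = eval_word H f w"
proof -
  have "eval_word H f ` pres_class X R w = {eval_word H f w}"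
    using eval_word_pres_eq[OF H f R] pres_eq.refl[OF assms] unfolding pres_class_def by fastforce
  then show ?thesis by (simp add: eval_class_def)
qed

text \<open>Von Dyck's theorem: values of the generators that satisfy the relations extend to a
  homomorphism.\<close>

lemma eval_class_hom: "eval_class H f \<in> hom (presented_group X R) H"
proof (rule homI)
  fix A assume "A \<in> carrier (presented_group X R)"
  then show "eval_class H f A \<in> carrier H"
    by (auto simp: presented_group_def eval_class_pres_class eval_word_closed[OF H f])
next
  fix A B assume "A \<in> carrier (presented_group X R)" "B \<in> carrier (presented_group X R)"
  then obtain u v where uv: "u \<in> words X" "v \<in> words X" "A = pres_class X R u" "B = pres_class X R v"
    by (auto simp: presented_group_def)
  have "A \<otimes>\<^bsub>presented_group X R\<^esub> B = pres_class X R (u @ v)"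
    unfolding presented_group_def pres_class_def uv
    using uv(1,2) by (auto intro: pres_eq.refl pres_eq.append pres_eq.trans)
  then show "eval_class H f (A \<otimes>\<^bsub>presented_group X R\<^esub> B) = eval_class H f A \<otimes>\<^bsub>H\<^esub> eval_class H f B"
    using uv by (simp add: eval_class_pres_class eval_word_append[OF H f])
qed

end

lemma edge_path_word_gens:
  assumes "edge_path_word G v w u" "ini G ` edges G \<subseteq> verts G" "ter G ` edges G \<subseteq> verts G"
  shows "w \<in> words (fg_gens G)"
  using assms by (induction rule: edge_path_word.induct) (auto simp: fg_gens_def)

text \<open>The last vertex \<open>u\<close> varies because a loop is followed through intermediate
  cells; only the words with \<open>u = v\<close> represent elements of
  \<open>pi1_cog G v\<close>.\<close>

definition edge_path_values ::
    "('h, 'm) monoid_scheme \<Rightarrow> (('v, 'e, 'g) fg_gen \<Rightarrow> 'h) \<Rightarrow> ('v, 'e, 'g) complex_of_groups \<Rightarrow> 'v \<Rightarrow> 'v \<Rightarrow> 'h set" where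
  "edge_path_values H f G v u = {eval_word H f w | w. edge_path_word G v w u}"

lemma edge_path_valuesI:
  "edge_path_word G v w u \<Longrightarrow> eval_word H f w = g \<Longrightarrow> g \<in> edge_path_values H f G v u"
  by (auto simp: edge_path_values_def)

context
  fixes G :: "('v, 'e, 'g) complex_of_groups" and H :: "('h, 'm) monoid_scheme"
    and f :: "('v, 'e, 'g) fg_gen \<Rightarrow> 'h"
  assumes H: "group H" and f: "f ` fg_gens G \<subseteq> carrier H"
    and ini: "ini G ` edges G \<subseteq> verts G" and ter: "ter G ` edges G \<subseteq> verts G"
    and grp: "\<And>v. v \<in> verts G \<Longrightarrow> group (grp G v)"
    and vhom: "\<And>v. v \<in> verts G \<Longrightarrow> (\<lambda>g. f (Elt v g)) \<in> hom (grp G v) H"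
    and fneg: "\<And>a. a \<in> edges G \<Longrightarrow> f (Neg a) = inv\<^bsub>H\<^esub> (f (Pos a))"
begin

interpretation group H by (rule H)

lemma gen_closed:
  "v \<in> verts G \<Longrightarrow> g \<in> carrier (grp G v) \<Longrightarrow> f (Elt v g) \<in> carrier H"
  "a \<in> edges G \<Longrightarrow> f (Pos a) \<in> carrier H"
  using f by (auto simp: fg_gens_def)

text \<open>An edge path word always ends with a local group element, and a further one may not be
  appended. It is multiplied into the last letter instead, which is why the proof splits on the last
  step of the word.\<close>

lemma edge_path_values_local:
  assumes "g \<in> edge_path_values H f G v u" "x \<in> carrier (grp G u)"
  shows "g \<otimes>\<^bsub>H\<^esub> f (Elt u x) \<in> edge_path_values H f G v u"
proof -
  obtain w where w: "edge_path_word G v w u" "g = eval_word H f w"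
    using assms by (auto simp: edge_path_values_def)
  have mult: "f (Elt u' y) \<otimes>\<^bsub>H\<^esub> f (Elt u' x) = f (Elt u' (y \<otimes>\<^bsub>grp G u'\<^esub> x))"
      "y \<otimes>\<^bsub>grp G u'\<^esub> x \<in> carrier (grp G u')"
      if "u' \<in> verts G" "y \<in> carrier (grp G u')" "x \<in> carrier (grp G u')" for u' y
    using hom_mult[OF vhom[OF that(1)] that(2,3)] grp[OF that(1)] that
    by (simp_all add: monoid.m_closed group.is_monoid)
  from w(1) assms(2) w(2) show ?thesis
  proof cases
    case (start y)
    have "edge_path_word G v [(Elt v (y \<otimes>\<^bsub>grp G v\<^esub> x), True)] u"
      using mult[of v y] start assms(2) edge_path_word.start[of v G "y \<otimes>\<^bsub>grp G v\<^esub> x"] by simp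
    then show ?thesis
      by (rule edge_path_valuesI) (use mult[of v y] start assms(2) w(2) gen_closed(1) in \<open>simp add: m_assoc\<close>)
  next
    case (pos w' a y)
    let ?w = "w' @ [(Pos a, True), (Elt (ini G a) (y \<otimes>\<^bsub>grp G u\<^esub> x), True)]"
    have u: "u \<in> verts G" using pos ini by auto
    note m = mult[OF u _ assms(2), of y]
    have "edge_path_word G v ?w u" using edge_path_word.pos[OF pos(3,4), of "y \<otimes>\<^bsub>grp G u\<^esub> x"] m pos by simp
    moreover have w': "w' \<in> words (fg_gens G)" using edge_path_word_gens[OF pos(3) ini ter] .
    have "eval_word H f ?w = g \<otimes>\<^bsub>H\<^esub> f (Elt u x)"
    proof -
      have "[(Pos a, True), (Elt u (y \<otimes>\<^bsub>grp G u\<^esub> x), True)] \<in> words (fg_gens G)"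
        "[(Pos a, True), (Elt u y, True)] \<in> words (fg_gens G)"
        using pos m u by (auto simp: fg_gens_def)
      then show ?thesis
        using pos m w(2) w' gen_closed u assms(2) eval_word_closed[OF H f w']
        by (simp add: eval_word_append[OF H f w'] m_assoc)
    qed
    ultimately show ?thesis by (rule edge_path_valuesI)
  next
    case (neg w' a y)
    let ?w = "w' @ [(Neg a, True), (Elt (ter G a) (y \<otimes>\<^bsub>grp G u\<^esub> x), True)]"
    have u: "u \<in> verts G" using neg ter by auto
    note m = mult[OF u _ assms(2), of y]
    have "edge_path_word G v ?w u" using edge_path_word.neg[OF neg(3,4), of "y \<otimes>\<^bsub>grp G u\<^esub> x"] m neg by simp
    moreover have w': "w' \<in> words (fg_gens G)" using edge_path_word_gens[OF neg(3) ini ter] .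
    have "eval_word H f ?w = g \<otimes>\<^bsub>H\<^esub> f (Elt u x)"
    proof -
      have "[(Neg a, True), (Elt u (y \<otimes>\<^bsub>grp G u\<^esub> x), True)] \<in> words (fg_gens G)"
        "[(Neg a, True), (Elt u y, True)] \<in> words (fg_gens G)"
        using neg m u by (auto simp: fg_gens_def)
      then show ?thesis
        using neg m w(2) w' gen_closed u assms(2) eval_word_closed[OF H f w'] fneg[of a]
        by (simp add: eval_word_append[OF H f w'] m_assoc)
    qed
    ultimately show ?thesis by (rule edge_path_valuesI)
  qed
qed

lemma gen_one: "v \<in> verts G \<Longrightarrow> f (Elt v \<one>\<^bsub>grp G v\<^esub>) = \<one>\<^bsub>H\<^esub>"
  using hom_one[OF vhom grp H] by simp

lemma edge_path_values_one:
  assumes "v \<in> verts G" shows "\<one>\<^bsub>H\<^esub> \<in> edge_path_values H f G v v"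
proof -
  have "edge_path_word G v [(Elt v \<one>\<^bsub>grp G v\<^esub>, True)] v"
    using assms grp by (intro edge_path_word.start) (auto simp: group.is_monoid monoid.one_closed)
  moreover have "eval_word H f [(Elt v \<one>\<^bsub>grp G v\<^esub>, True)] = \<one>\<^bsub>H\<^esub>" using gen_one[OF assms] by simp
  ultimately show ?thesis unfolding edge_path_values_def by force
qed

text \<open>Each edge symbol has to be followed by an element of the local group it leads to; the
  neutral element is taken, which evaluates to one.\<close>

lemma edge_path_values_cross:
  assumes "a \<in> edges G"
  shows "g \<in> edge_path_values H f G v (ter G a) \<Longrightarrow> g \<otimes>\<^bsub>H\<^esub> f (Pos a) \<in> edge_path_values H f G v (ini G a)"
    and "g \<in> edge_path_values H f G v (ini G a) \<Longrightarrow> g \<otimes>\<^bsub>H\<^esub> inv\<^bsub>H\<^esub> (f (Pos a)) \<in> edge_path_values H f G v (ter G a)"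
proof -
  have v: "ini G a \<in> verts G" "ter G a \<in> verts G" using assms ini ter by auto
  have one: "\<one>\<^bsub>grp G (ini G a)\<^esub> \<in> carrier (grp G (ini G a))" "\<one>\<^bsub>grp G (ter G a)\<^esub> \<in> carrier (grp G (ter G a))"
    using grp v by (simp_all add: group.is_monoid monoid.one_closed)
  note fa = gen_closed(2)[OF assms]
  have gens: "Pos a \<in> fg_gens G" "Neg a \<in> fg_gens G" "Elt (ini G a) \<one>\<^bsub>grp G (ini G a)\<^esub> \<in> fg_gens G"
    "Elt (ter G a) \<one>\<^bsub>grp G (ter G a)\<^esub> \<in> fg_gens G"
    using assms v one by (auto simp: fg_gens_def)
  { assume "g \<in> edge_path_values H f G v (ter G a)"
    then obtain w where w: "edge_path_word G v w (ter G a)" "g = eval_word H f w"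
      by (auto simp: edge_path_values_def)
    have "eval_word H f (w @ [(Pos a, True), (Elt (ini G a) \<one>\<^bsub>grp G (ini G a)\<^esub>, True)]) = g \<otimes>\<^bsub>H\<^esub> f (Pos a)"
      using w(2) gens fa gen_one[OF v(1)]
      by (subst eval_word_append[OF H f edge_path_word_gens[OF w(1) ini ter]]) auto
    then show "g \<otimes>\<^bsub>H\<^esub> f (Pos a) \<in> edge_path_values H f G v (ini G a)"
      by (rule edge_path_valuesI[OF edge_path_word.pos[OF w(1) assms one(1)]]) }
  { assume "g \<in> edge_path_values H f G v (ini G a)"
    then obtain w where w: "edge_path_word G v w (ini G a)" "g = eval_word H f w"
      by (auto simp: edge_path_values_def)
    have "eval_word H f (w @ [(Neg a, True), (Elt (ter G a) \<one>\<^bsub>grp G (ter G a)\<^esub>, True)]) = g \<otimes>\<^bsub>H\<^esub> inv\<^bsub>H\<^esub> (f (Pos a))"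
      using w(2) gens fa gen_one[OF v(2)] fneg[OF assms]
      by (subst eval_word_append[OF H f edge_path_word_gens[OF w(1) ini ter]]) auto
    then show "g \<otimes>\<^bsub>H\<^esub> inv\<^bsub>H\<^esub> (f (Pos a)) \<in> edge_path_values H f G v (ter G a)"
      by (rule edge_path_valuesI[OF edge_path_word.neg[OF w(1) assms one(2)]]) }
qed

text \<open>\<open>pi1_cog\<close> keeps the multiplication of \<open>FG\<close>, so the
  homomorphism is obtained on all of \<open>FG\<close> and then restricted; surjectivity amounts to
  edge path words from \<open>v\<close> to \<open>v\<close> taking all values.\<close>

lemma pi1_cog_epi:
  assumes R: "\<And>u w. (u, w) \<in> fg_rels G \<Longrightarrow> u \<in> words (fg_gens G) \<Longrightarrow> w \<in> words (fg_gens G) \<Longrightarrow>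
      eval_word H f u = eval_word H f w"
    and surj: "carrier H \<subseteq> edge_path_values H f G v v"
  shows "eval_class H f \<in> epi (pi1_cog G v) H"
proof -
  let ?P = "pi1_cog G v"
  have hom: "eval_class H f \<in> hom (FG G) H"
    unfolding FG_def by (rule eval_class_hom[OF H f]) (rule R)
  have carr: "carrier ?P \<subseteq> carrier (FG G)"
    unfolding pi1_cog_def FG_def presented_group_def using edge_path_word_gens[OF _ ini ter] by auto
  have "eval_class H f \<in> hom ?P H"
  proof (rule homI)
    fix A assume "A \<in> carrier ?P"
    then show "eval_class H f A \<in> carrier H" using hom carr by (auto simp: hom_def)
  next
    fix A B assume "A \<in> carrier ?P" "B \<in> carrier ?P"
    then have "A \<in> carrier (FG G)" "B \<in> carrier (FG G)" using carr by auto
    then show "eval_class H f (A \<otimes>\<^bsub>?P\<^esub> B) = eval_class H f A \<otimes>\<^bsub>H\<^esub> eval_class H f B"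
      using hom by (auto simp: hom_def pi1_cog_def)
  qed
  moreover have "carrier H \<subseteq> eval_class H f ` carrier ?P"
  proof
    fix g assume "g \<in> carrier H"
    then obtain w where w: "edge_path_word G v w v" "g = eval_word H f w"
      using surj by (auto simp: edge_path_values_def)
    then have "eval_class H f (pres_class (fg_gens G) (fg_rels G) w) = g"
      using eval_class_pres_class[OF H f _ edge_path_word_gens[OF w(1) ini ter], of "fg_rels G"] R by simp
    moreover have "pres_class (fg_gens G) (fg_rels G) w \<in> carrier ?P"
      using w(1) by (auto simp: pi1_cog_def)
    ultimately show "g \<in> eval_class H f ` carrier ?P" by blast
  qed
  ultimately show ?thesis by (simp add: epi_iff_subset)
qed

end

section \<open>The branch set\<close>

definition circle_arc :: "nat \<Rightarrow> complex set" where
  "circle_arc k = sector k \<inter> sphere 0 1"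

definition angle :: "nat \<Rightarrow> real" where
  "angle k = 2 * pi * real k / 3"

lemma angle_less: "angle j < angle k \<longleftrightarrow> j < k" and angle_le: "angle j \<le> angle k \<longleftrightarrow> j \<le> k"
  by (simp_all add: angle_def divide_simps)

lemma angle_simps: "angle 0 = 0" "angle (Suc 0) = 2 * pi / 3" "angle 2 = 4 * pi / 3" "angle 3 = 2 * pi"
  by (simp_all add: angle_def)

lemma angle_nonneg [simp]: "0 \<le> angle k"
  using angle_le[of 0 k] by (simp add: angle_simps)

lemma ray_angle: "ray k = cis (angle k)"
  by (simp add: ray_def angle_def)

lemma sector_angle: "sector k = {of_real r * cis \<theta> | r \<theta>. 0 \<le> r \<and> angle k \<le> \<theta> \<and> \<theta> \<le> angle (Suc k)}"
  by (simp add: sector_def angle_def)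

lemma ray_0: "ray 0 = 1" and ray_3: "ray 3 = ray 0"
  by (simp_all add: ray_def)

lemma norm_ray [simp]: "norm (ray k) = 1"
  by (simp add: ray_def)

lemma ray_1: "ray 1 = cis (2 * pi / 3)"
  by (simp add: ray_def)

text \<open>\<open>Y_graph\<close> names its third ray by the angle \<open>- 2 * pi / 3\<close>,
  whereas \<open>ray\<close> counts upwards to \<open>4 * pi / 3\<close>.\<close>

lemma ray_2: "ray 2 = cis (- 2 * pi / 3)"
proof -
  have "cis (- 2 * pi / 3) = cis (- 2 * pi / 3 + 2 * pi)" 
    unfolding cis_mult[symmetric] by simp
  also have "- 2 * pi / 3 + 2 * pi = 2 * pi * real 2 / 3" by (simp add: field_simps)
  finally show ?thesis by (simp add: ray_def)
qed

lemma less_3_cases: "(k::nat) < 3 \<longleftrightarrow> k = 0 \<or> k = 1 \<or> k = 2"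
  by auto

lemma Y_graph_alt: "Y_graph = {of_real r * ray k | r k. 0 \<le> r \<and> k < 3}"
proof -
  have "(\<exists>\<theta>. \<theta> \<in> {0, 2 * pi / 3, - 2 * pi / 3} \<and> z = of_real r * cis \<theta>) \<longleftrightarrow> (\<exists>k<3. z = of_real r * ray k)" for z r
    unfolding less_3_cases using ray_0 ray_1 ray_2 by (metis cis_zero insertCI insertE singletonD)
  then show ?thesis unfolding Y_graph_def by blast
qed

lemma Y_graph_scale: "z \<in> Y_graph \<Longrightarrow> 0 \<le> r \<Longrightarrow> of_real r * z \<in> Y_graph"
  unfolding Y_graph_alt by clarsimp (metis mult.assoc mult_nonneg_nonneg of_real_mult)

lemma ray_in_Y_graph: "k < 3 \<Longrightarrow> ray k \<in> Y_graph"
  unfolding Y_graph_alt by (rule CollectI, rule exI[of _ 1]) auto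

lemma Y_graph_sphere: "z \<in> Y_graph \<Longrightarrow> norm z = 1 \<Longrightarrow> \<exists>k<3. z = ray k"
  unfolding Y_graph_alt by (auto simp: norm_mult)

lemma Re_Im_rays: "Re (ray 1) = -1/2" "Re (ray 2) = -1/2" "Im (ray 1) = sqrt 3 / 2" "Im (ray 2) = - sqrt 3 / 2"
  unfolding ray_1 ray_2 cis.sel using cos_120 sin_120 cos_minus[of "2 * pi / 3"] sin_minus[of "2 * pi / 3"]
  by simp_all

text \<open>For \<open>k = 2\<close> the successor \<open>ray 3\<close> is \<open>ray 0\<close>
  again, so this separates the two ends of each of the three arcs.\<close>

lemma ray_Suc_neq: "k < 3 \<Longrightarrow> ray k \<noteq> ray (Suc k)"
proof -
  assume "k < 3"
  moreover have "ray 0 \<noteq> ray 1" "ray 1 \<noteq> ray 2" "ray 2 \<noteq> ray 3"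
    using Re_Im_rays by (auto simp: ray_3 ray_0 complex_eq_iff)
  ultimately show ?thesis unfolding less_3_cases
    by (metis One_nat_def Suc_1 eval_nat_numeral(3))
qed

lemma arc_alt: "circle_arc k = cis ` {angle k .. angle (Suc k)}"
proof (intro equalityI subsetI)
  fix z assume "z \<in> circle_arc k"
  then obtain r t where "z = of_real r * cis t" "0 \<le> r" "angle k \<le> t" "t \<le> angle (Suc k)" "norm z = 1"
    unfolding circle_arc_def sector_angle by auto
  then show "z \<in> cis ` {angle k .. angle (Suc k)}" by (auto simp: norm_mult)
next
  fix z assume "z \<in> cis ` {angle k .. angle (Suc k)}"
  then obtain t where "z = of_real 1 * cis t" "angle k \<le> t" "t \<le> angle (Suc k)" by auto
  then show "z \<in> circle_arc k" unfolding circle_arc_def sector_angle by (fastforce simp: norm_mult)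
qed

lemma ray_in_arc: "ray k \<in> circle_arc k" "ray (Suc k) \<in> circle_arc k"
  unfolding arc_alt ray_angle by (auto simp: angle_le)

lemma connected_arc: "connected (circle_arc k)"
  unfolding arc_alt by (intro connected_continuous_image) (auto intro!: continuous_intros simp: cis_conv_exp)

lemma Arg2pi_cis: "0 \<le> t \<Longrightarrow> t < 2 * pi \<Longrightarrow> Arg2pi (cis t) = t"
  by (rule Arg2pi_unique[of 1]) (auto simp: cis_conv_exp mult.commute)

lemma cis_Arg2pi: "norm z = 1 \<Longrightarrow> cis (Arg2pi z) = z"
  using Arg2pi_eq[of z] by (simp add: cis_conv_exp mult.commute)

lemma sphere_arc: "norm (z :: complex) = 1 \<Longrightarrow> \<exists>k<3. z \<in> circle_arc k"
proof -
  assume z: "norm z = 1"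
  let ?t = "Arg2pi z"
  have t: "0 \<le> ?t" "?t < 2 * pi" using Arg2pi[of z] by auto
  consider "angle 0 \<le> ?t" "?t \<le> angle 1" | "angle 1 \<le> ?t" "?t \<le> angle 2" | "angle 2 \<le> ?t" "?t \<le> angle 3"
    using t by (simp add: angle_simps) linarith
  then have "\<exists>k<3. ?t \<in> {angle k .. angle (Suc k)}"
  proof cases
    case 1 then show ?thesis by (intro exI[of _ 0]) simp
  next
    case 2 then show ?thesis by (intro exI[of _ 1]) (simp add: numeral_2_eq_2)
  next
    case 3 then show ?thesis by (intro exI[of _ 2]) (simp add: numeral_3_eq_3 numeral_2_eq_2)
  qed
  then show ?thesis using cis_Arg2pi[OF z] unfolding arc_alt by (metis image_eqI)
qed

text \<open>\<open>Y_graph\<close> meets the arc only in its end points: angles strictly between 0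
  and 2 pi are recovered by \<open>Arg2pi\<close>, so an inner point on a ray would put some
  \<open>angle j\<close> strictly between two successive ones.\<close>

lemma arc_minus_Y_graph:
  assumes "k < 3"
  shows "circle_arc k - Y_graph = cis ` {angle k <..< angle (Suc k)}" (is "?L = cis ` ?I")
    and "z \<in> circle_arc k - Y_graph \<Longrightarrow> Arg2pi z \<in> {angle k <..< angle (Suc k)}"
proof -
  have I: "?I \<subseteq> {0<..<2 * pi}"
    using assms angle_nonneg[of k] angle_le[of "Suc k" 3] by (auto simp: angle_simps simp del: angle_nonneg)
  have ends: "cis (angle k) \<in> Y_graph" "cis (angle (Suc k)) \<in> Y_graph"
  proof -
    show "cis (angle k) \<in> Y_graph" using ray_in_Y_graph[OF assms] by (simp add: ray_angle)
    have "ray (Suc k) \<in> Y_graph"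
      using assms ray_in_Y_graph[of "Suc k"] ray_in_Y_graph[of 0] ray_3 by (cases "Suc k = 3") auto
    then show "cis (angle (Suc k)) \<in> Y_graph" by (simp add: ray_angle)
  qed
  have "?L \<subseteq> cis ` ?I"
  proof
    fix z assume z: "z \<in> ?L"
    then obtain t where t: "z = cis t" "angle k \<le> t" "t \<le> angle (Suc k)"
      unfolding arc_alt by auto
    then have "t \<noteq> angle k" "t \<noteq> angle (Suc k)" using z ends by auto
    then show "z \<in> cis ` ?I" using t by auto
  qed
  moreover have "cis t \<notin> Y_graph" if t: "t \<in> ?I" for t
  proof
    assume "cis t \<in> Y_graph"
    then obtain j where j: "j < 3" "cis t = cis (angle j)"
      using Y_graph_sphere[of "cis t"] by (auto simp: ray_angle)
    have "Arg2pi (cis t) = t" using t I by (intro Arg2pi_cis) auto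
    moreover have "Arg2pi (cis (angle j)) = angle j"
      using j(1) angle_less[of j 3] by (intro Arg2pi_cis) (simp_all add: angle_simps)
    ultimately have "t = angle j" using j(2) by metis
    then have "angle k < angle j" "angle j < angle (Suc k)" using t by simp_all
    then show False unfolding angle_less by linarith
  qed
  then have "cis ` ?I \<subseteq> ?L" unfolding arc_alt by (auto intro!: imageI)
  ultimately show L: "?L = cis ` ?I" by (rule equalityI)
  show "Arg2pi z \<in> ?I" if z: "z \<in> ?L"
  proof -
    obtain t where "t \<in> ?I" "z = cis t" using z unfolding L by blast
    then show ?thesis using I Arg2pi_cis[of t] by auto
  qed
qed

lemma connected_open_arc: "k < 3 \<Longrightarrow> connected (circle_arc k - Y_graph)"
  unfolding arc_minus_Y_graph
  by (intro connected_continuous_image) (auto intro!: continuous_intros simp: cis_conv_exp)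

lemma arc_unique:
  assumes "z \<notin> Y_graph" "z \<in> circle_arc j" "z \<in> circle_arc k" "j < 3" "k < 3"
  shows "j = k"
proof -
  have "Arg2pi z \<in> {angle k <..< angle (Suc k)}" 
    "Arg2pi z \<in> {angle j <..< angle (Suc j)}"
    using arc_minus_Y_graph(2) assms by blast+
  then have "angle j < angle (Suc k)" "angle k < angle (Suc j)"
    by auto
  then show ?thesis by (simp add: angle_less)
qed

text \<open>\<open>Arg2pi\<close> jumps only on the nonnegative reals, which form a ray of
  \<open>Y_graph\<close>; it is therefore continuous on \<open>Z\<close>, and its image is an
  interval avoiding the angles of the rays, hence confined between two successive ones.\<close>

lemma connected_in_arc:
  assumes "connected Z" "Z \<subseteq> sphere 0 1 - Y_graph"
  shows "\<exists>k<3. Z \<subseteq> circle_arc k"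
proof (cases "Z = {}")
  case False
  then obtain z where z: "z \<in> Z" by auto
  then have "norm z = 1" using assms by auto
  then obtain k where k: "k < 3" "z \<in> circle_arc k" using sphere_arc by blast
  have "connected (Arg2pi ` Z)"
  proof (rule connected_continuous_image[OF _ assms(1)])
    have "w \<notin> \<real>\<^sub>\<ge>\<^sub>0" if "w \<in> Z" for w
    proof
      assume "w \<in> \<real>\<^sub>\<ge>\<^sub>0"
      then obtain r where "0 \<le> r" "w = of_real r * ray 0" by (auto simp: ray_0 elim!: nonneg_Reals_cases)
      then have "w \<in> Y_graph" using Y_graph_scale ray_in_Y_graph[of 0] by simp
      then show False using that assms(2) by blast
    qed
    then show "continuous_on Z Arg2pi"
      by (meson continuous_at_Arg2pi continuous_at_imp_continuous_on)
  qed
  then have int: "is_interval (Arg2pi ` Z)" by (simp add: is_interval_connected_1)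
  have "Arg2pi ` Z \<inter> {angle k, angle (Suc k)} = {}"
  proof -
    have "Arg2pi w \<noteq> angle j" if "w \<in> Z" "j \<le> 3" for w j
    proof
      assume "Arg2pi w = angle j"
      then have "w = ray j" using cis_Arg2pi[of w] that assms by (auto simp: ray_angle)
      then have "w \<in> Y_graph" using ray_in_Y_graph[of j] ray_in_Y_graph[of 0] ray_3 that by (cases "j = 3") auto
      then show False using that assms by auto
    qed
    moreover have "k \<le> 3" "Suc k \<le> 3" using k(1) by auto
    ultimately show ?thesis by (metis (no_types, lifting) disjoint_iff imageE insertE singletonD)
  qed
  moreover have "Arg2pi z \<in> {angle k <..< angle (Suc k)}"
    using arc_minus_Y_graph(2)[OF k(1), of z] k z assms by auto
  ultimately have "Arg2pi ` Z \<subseteq> {angle k <..< angle (Suc k)}"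
    using int z unfolding is_interval_1
      by (smt (verit, del_insts) disjoint_iff greaterThanLessThan_iff image_eqI image_subset_iff insertCI)
  then have "w \<in> circle_arc k" if "w \<in> Z" for w
    using that cis_Arg2pi[of w] assms unfolding arc_alt by (force intro!: image_eqI[of _ _ "Arg2pi w"])
  then show ?thesis using k by auto
qed (auto intro: exI[of _ 0])

section \<open>Closedness of the branch set\<close>

lemma branch_set_subset: "branch_set M \<Sigma> \<subseteq> \<Sigma>"
  by (auto simp: branch_set_def)

text \<open>Near a point of \<open>\<Sigma>\<close> off the branch set \<open>\<Sigma>\<close> embeds in the plane.  At a branch point two of the
  pages already fill a neighbourhood in the plane, by invariance of domain, which leaves no room for the third.\<close>

lemma closedin_branch_set:
  fixes M :: "'a::t2_space set"
  assumes charts: "\<forall>x\<in>M. \<exists>U f. x \<in> U \<and> tribranched_chart M \<Sigma> U f" and "\<Sigma> \<subseteq> M"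
  shows "closedin (top_of_set \<Sigma>) (branch_set M \<Sigma>)"
proof -
  let ?B = "branch_set M \<Sigma>"
  have "\<exists>T. openin (top_of_set \<Sigma>) T \<and> x \<in> T \<and> T \<subseteq> \<Sigma> - ?B" if x: "x \<in> \<Sigma> - ?B" for x
  proof -
    have "x \<in> M" using x \<open>\<Sigma> \<subseteq> M\<close> by auto
    then obtain U f where xU: "x \<in> U" and c: "tribranched_chart M \<Sigma> U f" using charts by auto
    from c obtain V g where U: "openin (top_of_set M) U" and V: "openin (top_of_set half_space) V"
      and fg: "homeomorphism U V f g" and f\<Sigma>: "f ` (U \<inter> \<Sigma>) = V \<inter> (Y_graph \<times> {0..})"
      unfolding tribranched_chart_def pair_chart_def by auto
    from c have nb: "f x \<notin> {0} \<times> {0..}" using x xU unfolding branch_set_def by auto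
    have fx: "f x \<in> Y_graph \<times> {0..}" using f\<Sigma> xU x by blast
    then have "fst (f x) \<in> Y_graph" "fst (f x) \<noteq> 0" using nb by (auto simp: mem_Times_iff)
    then obtain r k where rk: "fst (f x) = of_real r * ray k" "0 < r" "k < 3"
      unfolding Y_graph_alt by (force simp: less_le)
    \<comment> \<open>Distinct rays have inner product -1/2, so this open half space about
      \<open>ray k\<close> contains no point of the other two pages.\<close>
    define D where "D = {p :: complex \<times> real. 0 < Re (fst p * cnj (ray k))}"
    have "open D" unfolding D_def by (intro open_Collect_less continuous_intros)
    have DY: "w = of_real (norm w) * ray k" if "(w, u) \<in> D" "w \<in> Y_graph" for w u
    proof -
      obtain r' j where w: "w = of_real r' * ray j" "0 \<le> r'" "j < 3" using \<open>w \<in> Y_graph\<close> unfolding Y_graph_alt by auto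
      have "0 < r' * Re (ray j * cnj (ray k))" using that(1) unfolding D_def w(1) by (simp add: algebra_simps)
      then have *: "0 < Re (ray j * cnj (ray k))" using w(2) by (simp add: zero_less_mult_iff)
      have "j = k"
      proof (rule ccontr)
        assume "j \<noteq> k"
        have "Re (ray j * cnj (ray k)) = Re (ray j) * Re (ray k) + Im (ray j) * Im (ray k)" by simp
        moreover have r0: "Re (ray 0) = 1" "Im (ray 0) = 0" by (simp_all add: ray_0)
        have "Re (ray j) * Re (ray k) + Im (ray j) * Im (ray k) \<le> 0"
          using w(3) rk(3) \<open>j \<noteq> k\<close> unfolding less_3_cases
          by (elim disjE) (simp_all only: r0 Re_Im_rays, simp_all)
        ultimately show False using * by simp
      qed
      then show ?thesis using w by (simp add: norm_mult)
    qed
    define W where "W = U \<inter> f -` D"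
    have W: "openin (top_of_set M) W"
      unfolding W_def using continuous_openin_preimage_gen[OF homeomorphism_cont1[OF fg] \<open>open D\<close>] U
      by (rule openin_trans)
    have "x \<in> W"
    proof -
      have "ray k * cnj (ray k) = 1" using complex_norm_square[of "ray k"] by simp
      then have "fst (f x) * cnj (ray k) = of_real r" unfolding rk(1) by (simp add: mult.assoc)
      then have "Re (fst (f x) * cnj (ray k)) = r" by (metis Re_complex_of_real)
      then show ?thesis using rk(2) xU by (simp only: W_def D_def) simp
    qed
    \<comment> \<open>On the single page, distance from the branch line and height serve as planar
      coordinates.\<close>
    define \<phi> where "\<phi> y = Complex (norm (fst (f y))) (snd (f y))" for y
    have cont\<phi>: "continuous_on (W \<inter> \<Sigma>) \<phi>"
      unfolding \<phi>_def Complex_eq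
      by (intro continuous_intros continuous_on_subset[OF homeomorphism_cont1[OF fg]]) (auto simp: W_def)
    have inj\<phi>: "inj_on \<phi> (W \<inter> \<Sigma>)"
    proof (rule inj_onI)
      fix y y' assume y: "y \<in> W \<inter> \<Sigma>" "y' \<in> W \<inter> \<Sigma>" "\<phi> y = \<phi> y'"
      have *: "fst (f y) = of_real (norm (fst (f y))) * ray k" if "y \<in> W \<inter> \<Sigma>" for y
      proof (rule DY)
        show "(fst (f y), snd (f y)) \<in> D" using that by (simp add: W_def)
        have "f y \<in> Y_graph \<times> {0..}" using that f\<Sigma> by (auto simp: W_def)
        then show "fst (f y) \<in> Y_graph" by auto
      qed
      have "f y = f y'" using *[OF y(1)] *[OF y(2)] y(3) unfolding \<phi>_def by (metis complex.inject prod.expand)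
      then show "y = y'" using fg y unfolding W_def by (metis IntE homeomorphism_apply1)
    qed
    have "W \<inter> ?B = {}"
    proof (rule ccontr)
      assume "W \<inter> ?B \<noteq> {}"
      then obtain y where y: "y \<in> W" "y \<in> ?B" by blast
      then obtain U2 f2 where yU2: "y \<in> U2" and c2: "tribranched_chart M \<Sigma> U2 f2" and f2y: "f2 y \<in> {0} \<times> {0..}"
        unfolding branch_set_def by auto
      from c2 obtain V2 g2 where U2: "openin (top_of_set M) U2" and V2: "openin (top_of_set half_space) V2"
        and fg2: "homeomorphism U2 V2 f2 g2" and f2\<Sigma>: "f2 ` (U2 \<inter> \<Sigma>) = V2 \<inter> (Y_graph \<times> {0..})"
        unfolding tribranched_chart_def pair_chart_def by auto
      obtain s0 where s0: "f2 y = (0, s0)" "0 \<le> s0" using f2y by auto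
      have "openin (top_of_set U2) (U2 \<inter> W)"
        using W U2 by (metis openin_Int openin_imp_subset openin_subset_trans inf_le1)
      then have "openin (top_of_set V2) (f2 ` (U2 \<inter> W))"
        using homeomorphism_imp_open_map[OF fg2] by blast
      then have "openin (top_of_set half_space) (f2 ` (U2 \<inter> W))" using V2 openin_trans by blast
      then obtain O' where "open O'" and O': "f2 ` (U2 \<inter> W) = half_space \<inter> O'" by (auto simp: openin_open)
      have "(0, s0) \<in> O'" using O' s0 yU2 y(1) by (metis IntI IntE imageI)
      then obtain d where d: "d > 0" "ball (0, s0) d \<subseteq> O'" using \<open>open O'\<close> openE by blast
      \<comment> \<open>\<open>s0\<close> may be 0, on the boundary of the half space. At height
        \<open>s0 + d / 2\<close> with radius \<open>d / 4\<close> the piece \<open>Q\<close> stays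
        at positive height and inside the ball of radius \<open>d\<close>, since
        \<open>d / 4 + (d / 2 + d / 4) = d\<close>.\<close>
      define s1 where "s1 = s0 + d / 2"
      define e where "e = d / 4"
      have e: "e > 0" using d by (simp add: e_def)
      define Q where "Q = {(w, u). w \<in> Y_graph \<and> norm w < e \<and> \<bar>u - s1\<bar> < e}"
      have QW: "g2 p \<in> W \<inter> \<Sigma> \<and> p \<in> V2" if "p \<in> Q" for p
      proof -
        obtain w u where p: "p = (w, u)" "w \<in> Y_graph" "norm w < e" "\<bar>u - s1\<bar> < e" using \<open>p \<in> Q\<close> unfolding Q_def by auto
        have u: "0 \<le> u" using p s0 unfolding s1_def e_def by linarith
        have "dist (0, s0) p \<le> norm w + \<bar>u - s0\<bar>"
          unfolding p(1) dist_Pair_Pair by (rule order_trans[OF sqrt_sum_squares_le_sum_abs]) (auto simp: dist_norm)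
        also have "\<dots> < d" using p unfolding s1_def e_def by linarith
        finally have "p \<in> O'" using d by auto
        moreover have "p \<in> half_space" using u p by (simp add: half_space_def)
        ultimately obtain y' where y': "y' \<in> U2 \<inter> W" "p = f2 y'" using O' by blast
        have "p \<in> V2" using y' fg2 by (auto simp: homeomorphism_def)
        then have "p \<in> V2 \<inter> (Y_graph \<times> {0..})" using p u by auto
        then obtain y'' where y'': "y'' \<in> U2 \<inter> \<Sigma>" "p = f2 y''" using f2\<Sigma> by blast
        have "g2 p = y'" using y' homeomorphism_apply1[OF fg2, of y'] by simp
        moreover have "g2 p = y''" using y'' homeomorphism_apply1[OF fg2, of y''] by simp
        ultimately have "g2 p = y'" "g2 p = y''" by simp_all
        then show ?thesis using y' y'' \<open>p \<in> V2\<close> by auto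
      qed
      define \<psi> where "\<psi> = \<phi> \<circ> g2"
      have cont\<psi>: "continuous_on Q \<psi>"
        unfolding \<psi>_def using QW
        by (intro continuous_on_compose continuous_on_subset[OF homeomorphism_cont2[OF fg2]] continuous_on_subset[OF cont\<phi>]) auto
      have inj\<psi>: "inj_on \<psi> Q"
      proof (rule inj_onI)
        fix p q assume p: "p \<in> Q" "q \<in> Q" "\<psi> p = \<psi> q"
        then have "g2 p = g2 q" using QW inj\<phi> unfolding \<psi>_def by (metis comp_apply inj_onD)
        then show "p = q" using QW p fg2 by (metis homeomorphism_apply2)
      qed
      \<comment> \<open>Unfolds a disc onto the pages 0 and 1: the sign of \<open>Re c\<close>
        selects the page, its modulus is the distance from the branch line, and \<open>Im c\<close>
        is the height relative to \<open>s1\<close>.\<close>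
      define \<kappa> where "\<kappa> c = (of_real (max (Re c) 0) + of_real (max (- Re c) 0) * ray 1, s1 + Im c)" for c
      have \<kappa>Q: "\<kappa> c \<in> Q" if "c \<in> ball 0 e" for c
      proof -
        have c: "\<bar>Re c\<bar> < e" "\<bar>Im c\<bar> < e" using that abs_Re_le_cmod[of c] abs_Im_le_cmod[of c] by auto
        show ?thesis
        proof (cases "0 \<le> Re c")
          case True
          have "of_real (Re c) * ray 0 \<in> Y_graph" using True by (intro Y_graph_scale ray_in_Y_graph) auto
          then show ?thesis using c True by (simp add: \<kappa>_def Q_def ray_0)
        next
          case False
          have "of_real (- Re c) * ray 1 \<in> Y_graph" using False by (intro Y_graph_scale ray_in_Y_graph) auto
          then show ?thesis using c False by (simp add: \<kappa>_def Q_def norm_mult)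
        qed
      qed
      have cont\<kappa>: "continuous_on (ball 0 e) \<kappa>"
        unfolding \<kappa>_def by (intro continuous_intros)
      have inj\<kappa>: "inj \<kappa>"
      proof (rule injI)
        fix c c' assume "\<kappa> c = \<kappa> c'"
        then have 1: "of_real (max (Re c) 0) + of_real (max (- Re c) 0) * ray 1 =
            of_real (max (Re c') 0) + of_real (max (- Re c') 0) * ray 1"
          and 2: "Im c = Im c'" by (auto simp: \<kappa>_def)
        have "Im (of_real a + of_real b * ray 1) = b * Im (ray 1)" for a b by simp
        then have "max (- Re c) 0 * Im (ray 1) = max (- Re c') 0 * Im (ray 1)" using 1 by metis
        then have 3: "max (- Re c) 0 = max (- Re c') 0" unfolding Re_Im_rays by simp
        with 1 have "max (Re c) 0 = max (Re c') 0" by simp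
        with 3 have "Re c = Re c'" by (auto simp: max_def split: if_splits)
        with 2 show "c = c'" by (simp add: complex_eq_iff)
      qed
      have "open ((\<psi> \<circ> \<kappa>) ` ball 0 e)"
      proof (rule invariance_of_domain)
        show "continuous_on (ball 0 e) (\<psi> \<circ> \<kappa>)"
          using \<kappa>Q by (intro continuous_on_compose cont\<kappa> continuous_on_subset[OF cont\<psi>]) auto
        show "inj_on (\<psi> \<circ> \<kappa>) (ball 0 e)"
          by (intro comp_inj_on inj_on_subset[OF inj\<kappa>] inj_on_subset[OF inj\<psi>] image_subsetI \<kappa>Q subset_UNIV)
      qed auto
      \<comment> \<open>Moves from the branch line into page 2. It starts at
        \<open>\<kappa> 0\<close>, so for small \<open>t\<close> its image under \<psi> lies in the
        open image of the disc; by injectivity \<open>\<theta> t\<close> would equal some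
        \<open>\<kappa> c\<close>. But \<open>ray 2\<close> has negative imaginary part, while on
        the pages 0 and 1 imaginary parts are nonnegative.\<close>
      define \<theta> where "\<theta> t = (of_real t * ray 2, s1)" for t :: real
      have \<theta>Q: "\<theta> t \<in> Q" if "t \<in> {0..<e}" for t
        using that e Y_graph_scale[OF ray_in_Y_graph[of 2], of t] by (simp add: \<theta>_def Q_def norm_mult)
      have "continuous_on {0..<e} (\<psi> \<circ> \<theta>)"
        using \<theta>Q by (intro continuous_on_compose continuous_on_subset[OF cont\<psi>]) (auto simp: \<theta>_def intro!: continuous_intros)
      then have "openin (top_of_set {0..<e}) ({0..<e} \<inter> (\<psi> \<circ> \<theta>) -` ((\<psi> \<circ> \<kappa>) ` ball 0 e))"
        by (rule continuous_openin_preimage_gen) fact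
      then obtain T where "open T" and T: "{0..<e} \<inter> (\<psi> \<circ> \<theta>) -` ((\<psi> \<circ> \<kappa>) ` ball 0 e) = {0..<e} \<inter> T"
        unfolding openin_open by auto
      have "\<kappa> 0 = \<theta> 0" by (simp add: \<kappa>_def \<theta>_def)
      then have "(\<psi> \<circ> \<theta>) 0 \<in> (\<psi> \<circ> \<kappa>) ` ball 0 e" using e by (intro image_eqI[of _ _ 0]) simp_all
      then have "0 \<in> {0..<e} \<inter> T" using e unfolding T[symmetric] by simp
      then have "0 \<in> T" by simp
      then obtain n where n: "n > 0" "ball 0 n \<subseteq> T" using \<open>open T\<close> openE by blast
      define t where "t = min n e / 2"
      have t: "0 < t" "t < n" "t < e" using n e by (auto simp: t_def)
      then have "t \<in> T" using n(2) by (intro subsetD[OF n(2)]) (simp add: dist_real_def)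
      then have "t \<in> {0..<e} \<inter> T" using t by simp
      then have "(\<psi> \<circ> \<theta>) t \<in> (\<psi> \<circ> \<kappa>) ` ball 0 e" unfolding T[symmetric] by simp
      then obtain c where "c \<in> ball 0 e" "\<psi> (\<theta> t) = \<psi> (\<kappa> c)" by auto
      then have "\<theta> t = \<kappa> c" using inj\<psi> \<theta>Q[of t] \<kappa>Q[of c] t by (auto dest: inj_onD)
      then have "Im (of_real t * ray 2) = Im (of_real (max (Re c) 0) + of_real (max (- Re c) 0) * ray 1)"
        by (simp add: \<theta>_def \<kappa>_def)
      then have "t * Im (ray 2) = max (- Re c) 0 * Im (ray 1)" by simp
      moreover have "t * Im (ray 2) < 0" using t unfolding Re_Im_rays by (simp add: mult_pos_neg)
      moreover have "0 \<le> max (- Re c) 0 * Im (ray 1)" unfolding Re_Im_rays by simp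
      ultimately show False by linarith
    qed
    then show ?thesis
      using W \<open>x \<in> W\<close> x \<open>\<Sigma> \<subseteq> M\<close> by (intro exI[of _ "W \<inter> \<Sigma>"]) (auto simp: openin_open)
  qed
  then have "openin (top_of_set \<Sigma>) (\<Sigma> - ?B)" by (subst openin_subopen) blast
  then show ?thesis using branch_set_subset[of M \<Sigma>] by (simp add: closedin_def)
qed

section \<open>Pushes along collars\<close>

text \<open>In the applications the pieces \<open>K i\<close> are the closed tubes or bicollars
  without their cores, because the motions \<open>H i\<close> are singular on the cores.\<close>

definition push :: "'i set \<Rightarrow> ('i \<Rightarrow> 'a set) \<Rightarrow> ('i \<Rightarrow> real \<times> 'a \<Rightarrow> 'a) \<Rightarrow> real \<times> 'a \<Rightarrow> 'a" where
  "push I K H p = (if \<exists>i\<in>I. snd p \<in> K i then H (THE i. i \<in> I \<and> snd p \<in> K i) p else snd p)"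

lemma push_in:
  assumes "disjoint_family_on K I" "i \<in> I" "y \<in> K i"
  shows "push I K H (t, y) = H i (t, y)"
proof -
  have "(THE i. i \<in> I \<and> y \<in> K i) = i"
    using assms by (intro the_equality) (auto simp: disjoint_family_on_def)
  then show ?thesis using assms by (auto simp: push_def)
qed

lemma push_out: "(\<And>i. i \<in> I \<Longrightarrow> y \<notin> K i) \<Longrightarrow> push I K H (t, y) = y"
  by (auto simp: push_def)

text \<open>Pasting along a finite closed cover. The index \<open>None\<close> stands for the
  resting part \<open>A\<close> and \<open>Some i\<close> for \<open>K i\<close>; on overlaps with
  \<open>A\<close> all motions are the identity.\<close>

lemma continuous_on_push:
  fixes X :: "'a::topological_space set"
  assumes fin: "finite I" and disj: "disjoint_family_on K I" and X: "X = A \<union> (\<Union>i\<in>I. K i)"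
    and A: "closedin (top_of_set X) A" and K: "\<And>i. i \<in> I \<Longrightarrow> closedin (top_of_set X) (K i)"
    and cont: "\<And>i. i \<in> I \<Longrightarrow> continuous_on ({0..1::real} \<times> K i) (H i)"
    and fix_A: "\<And>i y t. i \<in> I \<Longrightarrow> y \<in> A \<Longrightarrow> y \<in> K i \<Longrightarrow> t \<in> {0..1} \<Longrightarrow> H i (t, y) = y"
  shows "continuous_on ({0..1::real} \<times> X) (push I K H)"
proof -
  define T where "T j = (case j of None \<Rightarrow> {0..1::real} \<times> A | Some i \<Rightarrow> {0..1} \<times> K i)" for j
  define f where "f j = (case j of None \<Rightarrow> snd | Some i \<Rightarrow> H i)" for j
  have f_push: "f j p = push I K H p" if j: "j \<in> insert None (Some ` I)" and p: "p \<in> T j" for j p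
  proof -
    obtain t y where ty: "p = (t, y)" by (cases p)
    show ?thesis
    proof (cases j)
      case None
      then have y: "t \<in> {0..1}" "y \<in> A" using p ty by (simp_all add: T_def)
      show ?thesis
      proof (cases "\<exists>i\<in>I. y \<in> K i")
        case True
        then obtain i where "i \<in> I" "y \<in> K i" by blast
        then show ?thesis using push_in[OF disj, of i y H t] fix_A[of i y t] y None ty by (simp add: f_def)
      next
        case False
        then have "push I K H (t, y) = y" by (intro push_out) blast
        then show ?thesis using None ty by (simp add: f_def)
      qed
    next
      case (Some i)
      then have "i \<in> I" "y \<in> K i" using j p ty by (auto simp: T_def)
      then show ?thesis using push_in[OF disj, of i y H t] Some ty by (simp add: f_def)
    qed
  qed
  have "continuous_map (top_of_set ({0..1} \<times> X)) euclidean (push I K H)"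
  proof (rule pasting_lemma_closed)
    show "finite (insert None (Some ` I))" using fin by simp
    fix j assume j: "j \<in> insert None (Some ` I)"
    have "closedin (top_of_set ({0..1} \<times> X)) ({0..1::real} \<times> B)" if "closedin (top_of_set X) B" for B
      using that closedin_Times[of "{0..1::real}" "{0..1}" X B] by simp
    then show "closedin (top_of_set ({0..1} \<times> X)) (T j)"
      using j A K by (auto simp: T_def)
    have "T j \<subseteq> {0..1} \<times> X" using j X by (auto simp: T_def)
    moreover have "continuous_on (T j) (f j)"
      using j cont by (auto simp: T_def f_def intro!: continuous_intros)
    ultimately show "continuous_map (subtopology (top_of_set ({0..1} \<times> X)) (T j)) euclidean (f j)"
      by (simp add: subtopology_subtopology inf_absorb2)
  next
    fix j k p assume *: "j \<in> insert None (Some ` I)" "k \<in> insert None (Some ` I)"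
      "p \<in> topspace (top_of_set ({0..1} \<times> X)) \<inter> T j \<inter> T k"
    then show "f j p = f k p" using f_push[of j p] f_push[of k p] by simp
  next
    fix p assume p: "p \<in> topspace (top_of_set ({0..1::real} \<times> X))"
    then obtain t y where ty: "p = (t, y)" "t \<in> {0..1}" "y \<in> X" by auto
    then have "\<exists>j. j \<in> insert None (Some ` I) \<and> p \<in> T j"
    proof (cases "y \<in> A")
      case False
      then obtain i where "i \<in> I" "y \<in> K i" using ty X by blast
      then show ?thesis using ty by (intro exI[of _ "Some i"]) (simp add: T_def)
    qed (auto simp: T_def intro!: exI[of _ None])
    then show "\<exists>j. j \<in> insert None (Some ` I) \<and> p \<in> T j \<and> push I K H p = f j p"
      using f_push by metis
  qed
  then show ?thesis by simp
qed

text \<open>The half space is convex, hence locally path connected; the property passes to its open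
  subsets and along the charts, a homeomorphism being a quotient map.\<close>

lemma three_manifold_locally_path_connected:
  assumes "three_manifold M" shows "locally path_connected M"
  unfolding locally_path_connected
proof (intro allI impI)
  fix W x assume W: "openin (top_of_set M) W \<and> x \<in> W"
  then have "x \<in> M" using openin_imp_subset by blast
  then obtain U V where U: "x \<in> U" "openin (top_of_set M) U" and V: "openin (top_of_set half_space) V"
    and "U homeomorphic V"
    using assms unfolding three_manifold_def by metis
  then obtain f g where fg: "homeomorphism V U g f"
    unfolding homeomorphic_def using homeomorphism_symD by blast
  have "half_space = UNIV \<times> {0..}" by (auto simp: half_space_def)
  then have "convex half_space" by (metis convex_Times convex_UNIV convex_real_interval(1))
  then have "locally path_connected V"
    using V convex_imp_locally_path_connected locally_open_subset by blast
  then have "locally path_connected (g ` V)"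
  proof (rule locally_path_connected_quotient_image)
    fix T assume T: "T \<subseteq> g ` V"
    have gV: "g ` V = U" using fg by (simp add: homeomorphism_def)
    show "openin (top_of_set V) (V \<inter> g -` T) \<longleftrightarrow> openin (top_of_set (g ` V)) T"
    proof
      assume "openin (top_of_set V) (V \<inter> g -` T)"
      then have "openin (top_of_set U) (g ` (V \<inter> g -` T))" using homeomorphism_imp_open_map[OF fg] by blast
      moreover have "g ` (V \<inter> g -` T) = T" using T by auto
      ultimately show "openin (top_of_set (g ` V)) T" using gV by simp
    next
      assume "openin (top_of_set (g ` V)) T"
      then show "openin (top_of_set V) (V \<inter> g -` T)"
        by (intro continuous_openin_preimage[OF homeomorphism_cont1[OF fg]]) auto
    qed
  qed
  then have "locally path_connected U" using fg by (simp add: homeomorphism_def)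
  moreover have "openin (top_of_set U) (U \<inter> W)"
    using U W by (metis inf_le1 openin_Int openin_imp_subset openin_subset_trans)
  ultimately obtain Q where "openin (top_of_set U) Q" "path_connected Q" "x \<in> Q" "Q \<subseteq> U \<inter> W"
    using U W unfolding locally_path_connected by (metis IntI)
  then show "\<exists>U. openin (top_of_set M) U \<and> path_connected U \<and> x \<in> U \<and> U \<subseteq> W"
    using U(2) by (meson inf.boundedE openin_trans)
qed

text \<open>Each member contains a point of \<open>K\<close> that no other member covers, so a
  finite subfamily covering \<open>K\<close> is already the whole family.\<close>

lemma finite_disjoint_open_cover:
  assumes "compact K" "disjoint_family_on U I" "K \<subseteq> (\<Union>i\<in>I. U i)"
    and "\<And>i. i \<in> I \<Longrightarrow> openin (top_of_set X) (U i)" "K \<subseteq> X" "\<And>i. i \<in> I \<Longrightarrow> U i \<inter> K \<noteq> {}"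
  shows "finite I"
proof -
  have "\<forall>i\<in>I. \<exists>O'. open O' \<and> U i = X \<inter> O'" using assms(4) by (auto simp: openin_open)
  then obtain O' where O': "\<And>i. i \<in> I \<Longrightarrow> open (O' i) \<and> U i = X \<inter> O' i" by metis
  then have "K \<subseteq> (\<Union>i\<in>I. O' i)" using assms(3) by blast
  moreover have "open (O' i)" if "i \<in> I" for i using O'[OF that] by simp
  ultimately obtain J where J: "J \<subseteq> I" "finite J" "K \<subseteq> (\<Union>i\<in>J. O' i)"
    using compactE_image[OF assms(1), of I O'] by metis
  have "I \<subseteq> J"
  proof
    fix i assume i: "i \<in> I"
    then obtain y where y: "y \<in> U i" "y \<in> K" using assms(6) by blast
    then obtain j where "j \<in> J" "y \<in> O' j" using J by blast
    then have "j \<in> I" "y \<in> U j" using O'[of j] J y assms(5) by auto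
    then have "i = j" using assms(2) i y unfolding disjoint_family_on_def by auto
    then show "i \<in> J" using \<open>j \<in> J\<close> by simp
  qed
  then show ?thesis using J finite_subset by blast
qed

section \<open>The neighbourhoods of a tribranched surface\<close>

locale tribranched_nbhds =
  fixes M \<Sigma> :: "'a::t2_space set" and h :: "'a tbs_nbhds"
  assumes compact_M: "compact M" and manifold_M: "three_manifold M"
    and surface: "tribranched_surface M \<Sigma> h" and nbhds: "nbhd_system M \<Sigma> h"
begin

abbreviation "BS \<equiv> branch_set M \<Sigma>"
abbreviation "CC \<equiv> components BS"
abbreviation "TT \<equiv> tubes M \<Sigma> h"
abbreviation "SH \<equiv> sheets M \<Sigma> h"
abbreviation "SS \<equiv> components SH"
abbreviation "RG \<equiv> regions M \<Sigma> h"

text \<open>A fixed inverse of the tube chart, whose existence is part of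
  \<open>tubular_nbhd\<close>; it supplies the coordinates in which the radial motions are
  written.\<close>

definition tub_inv :: "'a set \<Rightarrow> 'a \<Rightarrow> 'a \<times> complex" where
  "tub_inv C = (SOME g. homeomorphism (C \<times> cball 0 1) (tub_closed h C) (tub h C) g)"

definition bicol_inv :: "'a set \<Rightarrow> 'a \<Rightarrow> 'a \<times> real" where
  "bicol_inv S = (SOME g. homeomorphism (S \<times> {-1..1}) (bicol_closed h S) (bicol h S) g)"

lemma \<Sigma>_M: "\<Sigma> \<subseteq> M" and compact_\<Sigma>: "compact \<Sigma>"
  using surface by (auto simp: tribranched_surface_def)

lemma BS_\<Sigma>: "BS \<subseteq> \<Sigma>" by (rule branch_set_subset)

lemma compact_BS: "compact BS"
  using closedin_compact[OF compact_\<Sigma> closedin_branch_set[OF _ \<Sigma>_M]] surface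
  by (auto simp: tribranched_surface_def)

lemma tub_nbhd: "C \<in> CC \<Longrightarrow> tubular_nbhd M C (tub h C)"
  and tub_\<Sigma>: "C \<in> CC \<Longrightarrow> tub h C ` (C \<times> (cball 0 1 \<inter> Y_graph)) = tub_closed h C \<inter> \<Sigma>"
  and tub_disjoint: "disjoint_family_on (tub_closed h) CC"
  and bicol_disjoint: "disjoint_family_on (bicol_closed h) SS"
  using nbhds unfolding nbhd_system_def by simp_all

lemma bicol_nbhd:
  assumes "S \<in> SS"
  shows "\<exists>g. homeomorphism (S \<times> {-1..1}) (bicol_closed h S) (bicol h S) g"
    "bicol_closed h S \<subseteq> M - TT" "openin (top_of_set (M - TT)) (bicol_open h S)"
    "x \<in> S \<Longrightarrow> bicol h S (x, 0) = x"
    "x \<in> S \<Longrightarrow> t \<in> {-1..1} \<Longrightarrow> C \<in> CC \<Longrightarrow> bicol h S (x, t) \<in> tub_closed h C \<longleftrightarrow> x \<in> tub_closed h C"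
  using nbhds[unfolded nbhd_system_def, THEN conjunct2, THEN conjunct2, THEN conjunct1, THEN bspec, OF assms]
  by (elim conjE; simp)+

lemma component_C: "C \<in> CC \<Longrightarrow> C \<subseteq> BS \<and> connected C \<and> C \<noteq> {} \<and> compact C \<and> C \<subseteq> \<Sigma> \<and> C \<subseteq> M"
  using in_components_subset in_components_connected in_components_nonempty BS_\<Sigma> \<Sigma>_M
    closedin_compact[OF compact_BS closedin_component]
  by (metis subset_trans)

context
  fixes C assumes C: "C \<in> CC"
begin

lemma tub_homeo: "homeomorphism (C \<times> cball 0 1) (tub_closed h C) (tub h C) (tub_inv C)"
  using someI_ex[of "homeomorphism (C \<times> cball 0 1) (tub_closed h C) (tub h C)"] tub_nbhd[OF C]
  unfolding tub_inv_def tubular_nbhd_def tub_closed_def by simp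

lemma tub_inv: "x \<in> C \<Longrightarrow> norm z \<le> 1 \<Longrightarrow> tub_inv C (tub h C (x, z)) = (x, z)"
  using homeomorphism_apply1[OF tub_homeo, of "(x, z)"] by simp

lemma tub_cont: "continuous_on (C \<times> cball 0 1) (tub h C)" "continuous_on (tub_closed h C) (tub_inv C)"
  using tub_homeo by (simp_all add: homeomorphism_def)

lemma tub_closedE:
  assumes "y \<in> tub_closed h C" obtains x z where "x \<in> C" "norm z \<le> 1" "y = tub h C (x, z)"
  using assms unfolding tub_closed_def by force

lemma tub_closedI: "x \<in> C \<Longrightarrow> norm z \<le> 1 \<Longrightarrow> tub h C (x, z) \<in> tub_closed h C"
  unfolding tub_closed_def by force

lemma tub_inj: "x \<in> C \<Longrightarrow> norm z \<le> 1 \<Longrightarrow> x' \<in> C \<Longrightarrow> norm z' \<le> 1 \<Longrightarrow>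
    tub h C (x, z) = tub h C (x', z') \<longleftrightarrow> x = x' \<and> z = z'"
  using tub_inv by (metis Pair_inject)

lemma tub_closed_M: "tub_closed h C \<subseteq> M"
  using tub_nbhd[OF C] by (auto simp: tubular_nbhd_def tub_closed_def)

lemma tub_base: "x \<in> C \<Longrightarrow> tub h C (x, 0) = x"
  using tub_nbhd[OF C] by (simp add: tubular_nbhd_def)

lemma C_tub_open: "C \<subseteq> tub_open h C"
proof
  fix x assume "x \<in> C"
  then have "x = tub h C (x, 0)" "(x, 0) \<in> C \<times> ball 0 1" using tub_base by auto
  then show "x \<in> tub_open h C" unfolding tub_open_def by (rule image_eqI)
qed

lemma tub_open_openin: "openin (top_of_set M) (tub_open h C)"
  using tub_nbhd[OF C] by (simp add: tubular_nbhd_def tub_open_def)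

lemma tub_open_closed: "tub_open h C \<subseteq> tub_closed h C"
  by (force simp: tub_open_def tub_closed_def)

lemma tub_in_open: "x \<in> C \<Longrightarrow> norm z \<le> 1 \<Longrightarrow> tub h C (x, z) \<in> tub_open h C \<longleftrightarrow> norm z < 1"
proof
  assume *: "x \<in> C" "norm z \<le> 1" "tub h C (x, z) \<in> tub_open h C"
  then obtain x' z' where "x' \<in> C" "norm z' < 1" "tub h C (x, z) = tub h C (x', z')"
    unfolding tub_open_def by force
  then show "norm z < 1" using tub_inj[of x z x' z'] * by simp
qed (auto simp: tub_open_def)

lemma tub_in_\<Sigma>: 
  assumes "x \<in> C" "norm z \<le> 1" shows "tub h C (x, z) \<in> \<Sigma> \<longleftrightarrow> z \<in> Y_graph"
proof
  assume "tub h C (x, z) \<in> \<Sigma>"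
  then have "tub h C (x, z) \<in> tub h C ` (C \<times> (cball 0 1 \<inter> Y_graph))"
    using tub_\<Sigma>[OF C] tub_closedI assms by blast
  then obtain x' z' where "x' \<in> C" "norm z' \<le> 1" "z' \<in> Y_graph" "tub h C (x, z) = tub h C (x', z')"
    by auto
  then show "z \<in> Y_graph" using tub_inj assms by simp
next
  assume "z \<in> Y_graph"
  then have "tub h C (x, z) \<in> tub h C ` (C \<times> (cball 0 1 \<inter> Y_graph))" using assms by auto
  then show "tub h C (x, z) \<in> \<Sigma>" using tub_\<Sigma>[OF C] by blast
qed

lemma tub_closed_compact: "compact (tub_closed h C)"
  unfolding tub_closed_def using component_C[OF C] tub_cont(1)
  by (intro compact_continuous_image compact_Times) auto

end

lemma tub_closed_unique: "C \<in> CC \<Longrightarrow> C' \<in> CC \<Longrightarrow> y \<in> tub_closed h C \<Longrightarrow> y \<in> tub_closed h C' \<Longrightarrow> C' = C"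
  using tub_disjoint by (auto simp: disjoint_family_on_def)

text \<open>Closed tubes of different components are disjoint, so a branch point in the tube of
  \<open>C\<close> can only belong to \<open>C\<close>.\<close>

lemma BS_tub: "C \<in> CC \<Longrightarrow> BS \<inter> tub_closed h C = C"
proof (intro equalityI subsetI)
  fix y assume C: "C \<in> CC" and y: "y \<in> BS \<inter> tub_closed h C"
  then obtain C' where "C' \<in> CC" "y \<in> C'" by (metis IntD1 UnionE Union_components)
  then show "y \<in> C" using tub_closed_unique[OF C, of C' y] y C_tub_open[of C'] tub_open_closed[of C'] by auto
qed (use C_tub_open tub_open_closed component_C in blast)

lemma tub_in_BS: "C \<in> CC \<Longrightarrow> x \<in> C \<Longrightarrow> norm z \<le> 1 \<Longrightarrow> tub h C (x, z) \<in> BS \<longleftrightarrow> z = 0"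
proof
  assume *: "C \<in> CC" "x \<in> C" "norm z \<le> 1" "tub h C (x, z) \<in> BS"
  then have "tub h C (x, z) \<in> C" using BS_tub tub_closedI by blast
  then have "tub h C (tub h C (x, z), 0) = tub h C (x, z)" using tub_base * by simp
  then show "z = 0" using * \<open>tub h C (x, z) \<in> C\<close> tub_inj[of C _ 0 x z] by simp
next
  assume "C \<in> CC" "x \<in> C" "z = 0"
  then show "tub h C (x, z) \<in> BS" using tub_base component_C[of C] by auto
qed

lemma tub_in_TT: "C \<in> CC \<Longrightarrow> x \<in> C \<Longrightarrow> norm z \<le> 1 \<Longrightarrow> tub h C (x, z) \<in> TT \<longleftrightarrow> norm z < 1"
proof
  assume *: "C \<in> CC" "x \<in> C" "norm z \<le> 1" "tub h C (x, z) \<in> TT"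
  then obtain C' where C': "C' \<in> CC" "tub h C (x, z) \<in> tub_open h C'" by (auto simp: tubes_def)
  then have "C' = C" using tub_closed_unique * tub_closedI tub_open_closed by (metis subsetD)
  then show "norm z < 1" using C' * tub_in_open by blast
next
  assume "C \<in> CC" "x \<in> C" "norm z \<le> 1" "norm z < 1"
  then have "tub h C (x, z) \<in> tub_open h C" by (simp add: tub_in_open)
  then show "tub h C (x, z) \<in> TT" unfolding tubes_def using \<open>C \<in> CC\<close> by blast
qed

lemma BS_TT: "BS \<subseteq> TT"
  using C_tub_open Union_components[of BS] unfolding tubes_def by blast

lemma TT_open: "openin (top_of_set M) TT"
  unfolding tubes_def using tub_open_openin by (intro openin_Union) auto

lemma M_TT_closed: "closedin (top_of_set M) (M - TT)"
  using closedin_diff[OF closedin_topspace[of "top_of_set M"] TT_open] by simp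

lemma compact_SH: "compact SH"
proof -
  have "SH = \<Sigma> \<inter> (M - TT)" using \<Sigma>_M by (auto simp: sheets_def)
  moreover have "compact (M - TT)" using closedin_compact[OF compact_M M_TT_closed] .
  ultimately show ?thesis using compact_\<Sigma> compact_imp_closed compact_Int_closed by metis
qed

lemma SH_M: "SH \<subseteq> M - TT" using \<Sigma>_M by (auto simp: sheets_def)

lemma finite_CC: "finite CC"
proof (rule finite_disjoint_open_cover[OF compact_BS])
  show "disjoint_family_on (tub_open h) CC"
    using tub_disjoint tub_open_closed by (fastforce simp: disjoint_family_on_def)
  show "BS \<subseteq> (\<Union>C\<in>CC. tub_open h C)" using BS_TT by (simp add: tubes_def)
  show "tub_open h C \<inter> BS \<noteq> {}" if "C \<in> CC" for C
    using C_tub_open[OF that] component_C[OF that] by blast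
  show "BS \<subseteq> M" using BS_\<Sigma> \<Sigma>_M by blast
qed (rule tub_open_openin)

lemma component_S: "S \<in> SS \<Longrightarrow> S \<subseteq> SH \<and> connected S \<and> S \<noteq> {} \<and> compact S \<and> S \<subseteq> M - TT"
  using in_components_subset in_components_connected in_components_nonempty SH_M
    closedin_compact[OF compact_SH closedin_component]
  by (metis subset_trans)

context
  fixes S assumes S: "S \<in> SS"
begin

lemma bicol_homeo: "homeomorphism (S \<times> {-1..1}) (bicol_closed h S) (bicol h S) (bicol_inv S)"
  using someI_ex[OF bicol_nbhd(1)[OF S]] unfolding bicol_inv_def .

lemma bicol_inv: "x \<in> S \<Longrightarrow> t \<in> {-1..1} \<Longrightarrow> bicol_inv S (bicol h S (x, t)) = (x, t)"
  using homeomorphism_apply1[OF bicol_homeo, of "(x, t)"] by simp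

lemma bicol_cont: "continuous_on (S \<times> {-1..1}) (bicol h S)" "continuous_on (bicol_closed h S) (bicol_inv S)"
  using bicol_homeo by (simp_all add: homeomorphism_def)

lemma bicol_closedE:
  assumes "y \<in> bicol_closed h S" obtains x t where "x \<in> S" "t \<in> {-1..1}" "y = bicol h S (x, t)"
  using assms unfolding bicol_closed_def by force

lemma bicol_closedI: "x \<in> S \<Longrightarrow> t \<in> {-1..1} \<Longrightarrow> bicol h S (x, t) \<in> bicol_closed h S"
  unfolding bicol_closed_def by force

lemma bicol_inj: "x \<in> S \<Longrightarrow> t \<in> {-1..1} \<Longrightarrow> x' \<in> S \<Longrightarrow> t' \<in> {-1..1} \<Longrightarrow>
    bicol h S (x, t) = bicol h S (x', t') \<longleftrightarrow> x = x' \<and> t = t'"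
  using bicol_inv by (metis Pair_inject)

lemma bicol_base: "x \<in> S \<Longrightarrow> bicol h S (x, 0) = x"
  by (rule bicol_nbhd(4)[OF S])

lemma S_bicol_open: "S \<subseteq> bicol_open h S"
proof
  fix x assume "x \<in> S"
  then have "x = bicol h S (x, 0)" "(x, 0) \<in> S \<times> {-1<..<1::real}" using bicol_base by auto
  then show "x \<in> bicol_open h S" unfolding bicol_open_def by (rule image_eqI)
qed

lemma bicol_open_closed: "bicol_open h S \<subseteq> bicol_closed h S"
  by (force simp: bicol_open_def bicol_closed_def)

lemma bicol_in_open_same: "x \<in> S \<Longrightarrow> t \<in> {-1..1} \<Longrightarrow> bicol h S (x, t) \<in> bicol_open h S \<longleftrightarrow> \<bar>t\<bar> < 1"
proof
  assume *: "x \<in> S" "t \<in> {-1..1}" "bicol h S (x, t) \<in> bicol_open h S"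
  then obtain x' t' where "x' \<in> S" "t' \<in> {-1<..<1}" "bicol h S (x, t) = bicol h S (x', t')"
    unfolding bicol_open_def by force
  then have "t = t'" "t' \<in> {-1<..<1}" using bicol_inj[of x t x' t'] * by simp_all
  then show "\<bar>t\<bar> < 1" by auto
next
  assume "x \<in> S" "t \<in> {-1..1}" "\<bar>t\<bar> < 1"
  then have "(x, t) \<in> S \<times> {-1<..<1}" by auto
  then show "bicol h S (x, t) \<in> bicol_open h S" unfolding bicol_open_def by (rule imageI)
qed

lemma bicol_closed_compact: "compact (bicol_closed h S)"
  unfolding bicol_closed_def using component_S[OF S] bicol_cont(1)
  by (intro compact_continuous_image compact_Times) auto

end

lemma bicol_closed_unique: "S \<in> SS \<Longrightarrow> S' \<in> SS \<Longrightarrow> y \<in> bicol_closed h S \<Longrightarrow> y \<in> bicol_closed h S' \<Longrightarrow> S' = S"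
  using bicol_disjoint by (auto simp: disjoint_family_on_def)

lemma SH_bicol: "S \<in> SS \<Longrightarrow> SH \<inter> bicol_closed h S = S"
proof (intro equalityI subsetI)
  fix y assume S: "S \<in> SS" and y: "y \<in> SH \<inter> bicol_closed h S"
  then obtain S' where "S' \<in> SS" "y \<in> S'" by (metis IntD1 UnionE Union_components)
  then show "y \<in> S" using bicol_closed_unique[OF S, of S' y] y S_bicol_open[of S'] bicol_open_closed[of S'] by auto
qed (use S_bicol_open bicol_open_closed component_S in blast)

lemma bicol_in_SH: "S \<in> SS \<Longrightarrow> x \<in> S \<Longrightarrow> t \<in> {-1..1} \<Longrightarrow> bicol h S (x, t) \<in> SH \<longleftrightarrow> t = 0"
proof
  assume *: "S \<in> SS" "x \<in> S" "t \<in> {-1..1}" "bicol h S (x, t) \<in> SH"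
  then have "bicol h S (x, t) \<in> S" using SH_bicol bicol_closedI by blast
  then have "bicol h S (bicol h S (x, t), 0) = bicol h S (x, t)" using bicol_base * by simp
  then show "t = 0" using * \<open>bicol h S (x, t) \<in> S\<close> bicol_inj[of S _ 0 x t] by simp
next
  assume "S \<in> SS" "x \<in> S" "t = 0"
  then show "bicol h S (x, t) \<in> SH" using bicol_base component_S[of S] by auto
qed

lemma RG_M: "RG \<subseteq> M - TT" by (auto simp: regions_def)

lemma bicol_in_RG: "S \<in> SS \<Longrightarrow> x \<in> S \<Longrightarrow> t \<in> {-1..1} \<Longrightarrow> bicol h S (x, t) \<in> RG \<longleftrightarrow> \<bar>t\<bar> = 1"
proof -
  assume *: "S \<in> SS" "x \<in> S" "t \<in> {-1..1}"
  have c: "bicol h S (x, t) \<in> bicol_closed h S" using bicol_closedI * by blast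
  have "bicol h S (x, t) \<in> (\<Union>S\<in>SS. bicol_open h S) \<longleftrightarrow> bicol h S (x, t) \<in> bicol_open h S"
    using bicol_closed_unique[OF *(1) _ c] bicol_open_closed *(1) by blast
  then have "bicol h S (x, t) \<in> RG \<longleftrightarrow> \<not> \<bar>t\<bar> < 1"
    using bicol_in_open_same * bicol_nbhd(2)[OF *(1)] c by (auto simp: regions_def)
  then show ?thesis using * by auto
qed

lemma SH_subset_bicol: "SH \<subseteq> (\<Union>S\<in>SS. bicol_open h S)"
  using S_bicol_open Union_components[of SH] by blast

lemma RG_SH: "RG \<inter> SH = {}"
  using SH_subset_bicol by (auto simp: regions_def)

lemma M_TT_cases:
  assumes "y \<in> M - TT" "y \<notin> RG" obtains S x t where "S \<in> SS" "x \<in> S" "\<bar>t\<bar> < 1" "y = bicol h S (x, t)"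
  using assms unfolding regions_def bicol_open_def by force

lemma finite_SS: "finite SS"
proof (rule finite_disjoint_open_cover[OF compact_SH])
  show "disjoint_family_on (bicol_open h) SS"
    using bicol_disjoint bicol_open_closed by (fastforce simp: disjoint_family_on_def)
  show "bicol_open h S \<inter> SH \<noteq> {}" if "S \<in> SS" for S
    using S_bicol_open[OF that] component_S[OF that] by blast
qed (use SH_M SH_subset_bicol bicol_nbhd(3) in auto)

lemma RG_closed: "closedin (top_of_set (M - TT)) RG"
proof -
  have "RG = (M - TT) - (\<Union>S\<in>SS. bicol_open h S)" by (auto simp: regions_def)
  moreover have "openin (top_of_set (M - TT)) (\<Union>S\<in>SS. bicol_open h S)"
    using bicol_nbhd(3) by (intro openin_Union) auto
  ultimately show ?thesis
    using closedin_diff[OF closedin_topspace[of "top_of_set (M - TT)"]] by simp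
qed

subsection \<open>Radial push out of the tubes\<close>

text \<open>The factor turns the modulus n of \<open>z\<close> into (1 - t) n + t: a straight motion
  along the radius that ends on the unit circle and is singular at the core n = 0.\<close>

definition radial :: "'a set \<Rightarrow> real \<times> 'a \<Rightarrow> 'a" where
  "radial C p = (let (x, z) = tub_inv C (snd p)
     in tub h C (x, of_real ((1 - fst p) + fst p / norm z) * z))"

definition rad :: "real \<times> 'a \<Rightarrow> 'a" where
  "rad = push CC (\<lambda>C. tub_closed h C - C) radial"

definition rho :: "'a \<Rightarrow> 'a" where "rho y = rad (1, y)"

lemma disjoint_rad: "disjoint_family_on (\<lambda>C. tub_closed h C - C) CC"
  using tub_disjoint by (auto simp: disjoint_family_on_def)

lemma rad_tub:
  assumes "C \<in> CC" "x \<in> C" "norm z \<le> 1" "z \<noteq> 0"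
  shows "rad (t, tub h C (x, z)) = tub h C (x, of_real ((1 - t) + t / norm z) * z)"
proof -
  have "tub h C (x, z) \<in> tub_closed h C - C"
    using assms tub_closedI tub_in_BS component_C by blast
  then show ?thesis
    unfolding rad_def using push_in[OF disjoint_rad assms(1)] tub_inv assms by (simp add: radial_def)
qed

lemma rad_M_TT: "y \<in> M - TT \<Longrightarrow> rad (t, y) = y"
proof (cases "\<exists>C\<in>CC. y \<in> tub_closed h C")
  case True
  assume y: "y \<in> M - TT"
  from True obtain C x z where C: "C \<in> CC" "x \<in> C" "norm z \<le> 1" "y = tub h C (x, z)"
    by (metis tub_closedE)
  then have "norm z = 1" "z \<noteq> 0" using y tub_in_TT[OF C(1-3)] by auto
  then show ?thesis using C rad_tub[OF C(1-3), of t] by auto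
next
  case False
  then show ?thesis unfolding rad_def by (intro push_out) auto
qed

lemma M_BS_cases:
  assumes "y \<in> M - BS"
  obtains "y \<in> M - TT" | C x z where "C \<in> CC" "x \<in> C" "0 < norm z" "norm z < 1" "y = tub h C (x, z)"
proof (cases "y \<in> TT")
  case True
  then obtain C where "C \<in> CC" "y \<in> tub_open h C" unfolding tubes_def by blast
  then obtain x z where C: "C \<in> CC" "x \<in> C" "norm z < 1" "y = tub h C (x, z)"
    unfolding tub_open_def by auto
  then have "z \<noteq> 0" using tub_in_BS[of C x z] assms by auto
  then show ?thesis using C that(2) by auto
qed (use assms that(1) in auto)

lemma rad_norm: "(0::real) < n \<Longrightarrow> n \<le> 1 \<Longrightarrow> t \<in> {0..1} \<Longrightarrow> 0 < ((1 - t) + t / n) * n \<and> ((1 - t) + t / n) * n \<le> 1"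
proof -
  assume *: "0 < n" "n \<le> 1" "t \<in> {0..1}"
  have "((1 - t) + t / n) * n = (1 - t) * n + t" using * by (simp add: field_simps)
  moreover have "0 < (1 - t) * n + t" using * by (cases "t = 0") (auto intro: add_nonneg_pos)
  moreover have "(1 - t) * n + t \<le> (1 - t) * 1 + t" using * by (intro add_right_mono mult_left_mono) auto
  ultimately show ?thesis by simp
qed

lemma norm_rad: "norm (of_real ((1 - t) + t / norm z) * z) = ((1 - t) + t / norm z) * norm z"
  if "t \<in> {0..1}" for z :: complex and t
proof -
  have "0 \<le> (1 - t) + t / norm z" using that by simp
  then show ?thesis unfolding norm_mult norm_of_real by simp
qed

lemma rad_in: "y \<in> M - BS \<Longrightarrow> t \<in> {0..1} \<Longrightarrow> rad (t, y) \<in> M - BS"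
proof (erule M_BS_cases)
  assume "y \<in> M - TT" then show ?thesis using rad_M_TT BS_TT by auto
next
  fix C x z assume t: "t \<in> {0..1}" and C: "C \<in> CC" "x \<in> C" "0 < norm z" "norm z < 1" "y = tub h C (x, z)"
  let ?z = "of_real ((1 - t) + t / norm z) * z"
  have n: "0 < norm ?z" "norm ?z \<le> 1" unfolding norm_rad[OF t] using rad_norm[of "norm z" t] C t by auto
  have "rad (t, y) = tub h C (x, ?z)" using rad_tub[of C x z t] C by auto
  moreover have "tub h C (x, ?z) \<notin> BS" using tub_in_BS[of C x ?z] C n by auto
  moreover have "tub h C (x, ?z) \<in> M" using tub_closed_M tub_closedI C n by blast
  ultimately show "rad (t, y) \<in> M - BS" by simp
qed

lemma rho_tub:
  assumes "C \<in> CC" "x \<in> C" "norm z = 1" "0 < r" "r \<le> 1"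
  shows "rho (tub h C (x, of_real r * z)) = tub h C (x, z)"
proof -
  have "z \<noteq> 0" using assms by auto
  then show ?thesis using rad_tub[of C x "of_real r * z" 1] assms by (simp add: rho_def norm_mult)
qed

lemma rho_M_TT: "y \<in> M - TT \<Longrightarrow> rho y = y"
  by (simp add: rho_def rad_M_TT)

lemma polar:
  fixes z :: complex
  assumes "0 < norm z" "norm z \<le> 1"
  obtains r u where "0 < r" "r \<le> 1" "norm u = 1" "z = of_real r * u" "r = norm z"
proof -
  have "norm (z / of_real (norm z)) = 1" using assms(1) by (simp add: norm_divide)
  moreover have "z = of_real (norm z) * (z / of_real (norm z))" using assms(1) by simp
  ultimately show thesis using that[OF assms] by blast
qed

lemma rho_in: "y \<in> M - BS \<Longrightarrow> rho y \<in> M - TT"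
proof (erule M_BS_cases)
  fix C x z assume C: "C \<in> CC" "x \<in> C" "0 < norm z" "norm z < 1" "y = tub h C (x, z)"
  obtain r u where ru: "0 < r" "r \<le> 1" "norm u = 1" "z = of_real r * u"
    using polar[of z] C(3,4) by (metis less_imp_le)
  then have "rho y = tub h C (x, u)" using rho_tub C by simp
  then show "rho y \<in> M - TT" using tub_in_TT[of C x u] tub_closed_M[of C] tub_closedI[of C x u] C ru by auto
qed (simp add: rho_M_TT)

text \<open>The motion runs along radii, and \<open>rho\<close> depends only on the radius. Sets
  described through \<open>rho\<close> are therefore preserved at all times, which is what
  \<open>rad_hood\<close> uses.\<close>

lemma rho_rad: "y \<in> M - BS \<Longrightarrow> t \<in> {0..1} \<Longrightarrow> rho (rad (t, y)) = rho y"
proof (erule M_BS_cases)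
  fix C x z assume t: "t \<in> {0..1}" and C: "C \<in> CC" "x \<in> C" "0 < norm z" "norm z < 1" "y = tub h C (x, z)"
  obtain r u where ru: "0 < r" "r \<le> 1" "norm u = 1" "z = of_real r * u"
    using polar[of z] C(3,4) by (metis less_imp_le)
  have nz: "norm z = r" using ru by (simp add: norm_mult)
  have z0: "z \<noteq> 0" using C(3) by auto
  have "rad (t, y) = tub h C (x, of_real ((1 - t) + t / norm z) * z)"
    unfolding C(5) by (rule rad_tub[OF C(1,2) less_imp_le[OF C(4)] z0])
  also have "of_real ((1 - t) + t / norm z) * z = of_real (((1 - t) + t / r) * r) * u"
    unfolding nz by (subst ru(4)) simp
  finally have "rho (rad (t, y)) = tub h C (x, u)"
    using rho_tub[OF C(1,2) ru(3)] rad_norm[OF ru(1,2) t] by metis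
  also have "\<dots> = rho y"
    unfolding C(5) ru(4) by (rule rho_tub[OF C(1,2) ru(3,1,2), symmetric])
  finally show "rho (rad (t, y)) = rho y" .
qed (simp add: rho_M_TT rad_M_TT)

text \<open>The pieces are closed in \<open>M - BS\<close> because closed tubes are compact, and on
  the tube boundary, where they meet the resting part \<open>M - TT\<close>, the factor in
  \<open>radial\<close> is 1.\<close>

lemma rad_cont: "continuous_on ({0..1::real} \<times> (M - BS)) rad"
  unfolding rad_def
proof (rule continuous_on_push[OF finite_CC disjoint_rad])
  show "M - BS = (M - TT) \<union> (\<Union>C\<in>CC. tub_closed h C - C)"
  proof (intro equalityI subsetI)
    fix y assume "y \<in> M - BS"
    then show "y \<in> (M - TT) \<union> (\<Union>C\<in>CC. tub_closed h C - C)"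
    proof (cases rule: M_BS_cases)
      case (2 C x z)
      then have "y \<in> tub_closed h C - C" using tub_closedI[of C x z] component_C[of C] \<open>y \<in> M - BS\<close> by auto
      then show ?thesis using 2 by blast
    qed auto
  next
    fix y assume y: "y \<in> (M - TT) \<union> (\<Union>C\<in>CC. tub_closed h C - C)"
    show "y \<in> M - BS"
    proof (cases "y \<in> M - TT")
      case False
      then obtain C where "C \<in> CC" "y \<in> tub_closed h C" "y \<notin> C" using y by blast
      then show ?thesis using BS_tub[of C] tub_closed_M[of C] by blast
    qed (use BS_TT in auto)
  qed
  have MB: "M - BS \<subseteq> M" by auto
  show "closedin (top_of_set (M - BS)) (M - TT)"
    using M_TT_closed BS_TT by (intro closedin_subset_trans[OF _ _ MB]) auto
  show "closedin (top_of_set (M - BS)) (tub_closed h C - C)" if C: "C \<in> CC" for C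
  proof -
    have "tub_closed h C - C = (M - BS) \<inter> tub_closed h C" using BS_tub[OF C] tub_closed_M[OF C] by blast
    then show ?thesis using compact_imp_closed[OF tub_closed_compact[OF C]] by (metis closedin_closed_Int)
  qed
  show "continuous_on ({0..1::real} \<times> (tub_closed h C - C)) (radial C)" if C: "C \<in> CC" for C
  proof -
    have inv: "tub_inv C y \<in> C \<times> (cball 0 1 - {0})" if y: "y \<in> tub_closed h C - C" for y
    proof -
      obtain x z where xz: "x \<in> C" "norm z \<le> 1" "y = tub h C (x, z)"
        using y by (blast elim: tub_closedE[OF C])
      then have "z \<noteq> 0" using y tub_base[OF C] by auto
      then show ?thesis using xz tub_inv[OF C] by simp
    qed
    have ci: "continuous_on ({0..1::real} \<times> (tub_closed h C - C)) (\<lambda>p. tub_inv C (snd p))"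
      by (intro continuous_on_compose2[OF tub_cont(2)[OF C]] continuous_intros) auto
    have "continuous_on ({0..1::real} \<times> (tub_closed h C - C))
        (\<lambda>p. (fst (tub_inv C (snd p)), of_real ((1 - fst p) + fst p / norm (snd (tub_inv C (snd p)))) * snd (tub_inv C (snd p))))"
      using inv by (intro continuous_intros ci) force
    then show ?thesis
      unfolding radial_def case_prod_unfold Let_def
    proof (rule continuous_on_compose2[OF tub_cont(1)[OF C]], intro image_subsetI)
      fix p assume p: "p \<in> {0..1::real} \<times> (tub_closed h C - C)"
      let ?z = "snd (tub_inv C (snd p))"
      have i: "fst (tub_inv C (snd p)) \<in> C" "0 < norm ?z" "norm ?z \<le> 1" "fst p \<in> {0..1}"
        using inv[of "snd p"] p by (auto simp: mem_Times_iff)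
      have "norm (of_real ((1 - fst p) + fst p / norm ?z) * ?z) \<le> 1"
        unfolding norm_rad[OF i(4)] using rad_norm[OF i(2-4)] by blast
      then show "(fst (tub_inv C (snd p)), of_real ((1 - fst p) + fst p / norm ?z) * ?z) \<in> C \<times> cball 0 1"
        using i(1) by (simp only: mem_Times_iff mem_cball_0 fst_conv snd_conv)
    qed
  qed
  show "radial C (t, y) = y" if "C \<in> CC" "y \<in> M - TT" "y \<in> tub_closed h C - C" "t \<in> {0..1}" for C y t
    using rad_M_TT[OF that(2), of t] push_in[OF disjoint_rad that(1,3), of radial t] unfolding rad_def by simp
qed

lemma rad_0: "y \<in> M - BS \<Longrightarrow> rad (0, y) = y"
  by (erule M_BS_cases) (auto simp: rad_M_TT rad_tub)

lemma rho_cont: "continuous_on (M - BS) rho"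
  unfolding rho_def by (intro continuous_on_compose2[OF rad_cont] continuous_intros) auto

subsection \<open>Push out of the bicollars\<close>

text \<open>The analogous motion in a bicollar: the modulus of \<open>u\<close> becomes (1 - t) |u|
  + t and the sign is kept, so that each half collar moves to its outer end. The sheet
  \<open>u = 0\<close> is the singular set.\<close>

definition spread :: "'a set \<Rightarrow> real \<times> 'a \<Rightarrow> 'a" where
  "spread S p = (let (s, u) = bicol_inv S (snd p)
     in bicol h S (s, (1 - fst p) * u + fst p * sgn u))"

definition spr :: "real \<times> 'a \<Rightarrow> 'a" where
  "spr = push SS (\<lambda>S. bicol_closed h S - S) spread"

definition retr_RG :: "'a \<Rightarrow> 'a" where "retr_RG y = spr (1, y)"

lemma disjoint_spr: "disjoint_family_on (\<lambda>S. bicol_closed h S - S) SS"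
  using bicol_disjoint by (auto simp: disjoint_family_on_def)

lemma spr_bicol:
  assumes "S \<in> SS" "s \<in> S" "u \<in> {-1..1}" "u \<noteq> 0"
  shows "spr (t, bicol h S (s, u)) = bicol h S (s, (1 - t) * u + t * sgn u)"
proof -
  have "bicol h S (s, u) \<in> bicol_closed h S - S"
    using assms bicol_closedI bicol_in_SH component_S by blast
  then show ?thesis
    unfolding spr_def using push_in[OF disjoint_spr assms(1)] bicol_inv assms by (simp add: spread_def)
qed

lemma spr_bound: 
  fixes u t :: real
  assumes "u \<in> {-1..1}" "u \<noteq> 0" "t \<in> {0..1}"
  shows "(1 - t) * u + t * sgn u \<in> {-1..1}" "sgn ((1 - t) * u + t * sgn u) = sgn u"
proof -
  define n where "n = (1 - t) * \<bar>u\<bar> + t"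
  have n: "0 < n" "n \<le> 1"
  proof -
    show "0 < n" using assms unfolding n_def by (cases "t = 0") (auto intro: add_nonneg_pos)
    have "n \<le> (1 - t) * 1 + t" unfolding n_def using assms by (intro add_right_mono mult_left_mono) auto
    then show "n \<le> 1" by simp
  qed
  have "(1 - t) * u + t * sgn u = n * sgn u"
    unfolding n_def by (metis (no_types, opaque_lifting) abs_mult_sgn distrib_right mult.assoc)
  then show "(1 - t) * u + t * sgn u \<in> {-1..1}" "sgn ((1 - t) * u + t * sgn u) = sgn u"
    using n assms by (auto simp: sgn_if sgn_mult)
qed

lemma spr_RG: "y \<in> RG \<Longrightarrow> spr (t, y) = y"
proof (cases "\<exists>S\<in>SS. y \<in> bicol_closed h S")
  case True
  assume y: "y \<in> RG"
  from True obtain S s u where S: "S \<in> SS" "s \<in> S" "u \<in> {-1..1}" "y = bicol h S (s, u)"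
    by (metis bicol_closedE)
  then have "\<bar>u\<bar> = 1" using y bicol_in_RG[OF S(1-3)] by auto
  then have "u \<noteq> 0" "sgn u = u" by (auto simp: sgn_if)
  then show ?thesis using S spr_bicol[OF S(1-3), of t] by (simp add: algebra_simps)
next
  case False
  then show ?thesis unfolding spr_def by (intro push_out) auto
qed

abbreviation "OFF \<equiv> (M - TT) - SH"

lemma OFF_cases:
  assumes "y \<in> OFF"
  obtains "y \<in> RG" | S s u where "S \<in> SS" "s \<in> S" "u \<in> {-1..1}" "u \<noteq> 0" "\<bar>u\<bar> < 1" "y = bicol h S (s, u)"
proof (cases "y \<in> RG")
  case False
  then obtain S s u where S: "S \<in> SS" "s \<in> S" "\<bar>u\<bar> < 1" "y = bicol h S (s, u)"
    using assms M_TT_cases by (metis DiffD1)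
  then have "u \<noteq> 0" using bicol_in_SH[of S s u] assms by auto
  moreover have "u \<in> {-1..1}" using S(3) by auto
  ultimately show ?thesis using S that(2)[of S s u] by blast
qed (use that(1) in auto)

lemma bicol_in_OFF: "S \<in> SS \<Longrightarrow> s \<in> S \<Longrightarrow> u \<in> {-1..1} \<Longrightarrow> u \<noteq> 0 \<Longrightarrow> bicol h S (s, u) \<in> OFF"
  using bicol_in_SH[of S s u] bicol_nbhd(2)[of S] bicol_closedI[of S s u] by auto

lemma spr_in: "y \<in> OFF \<Longrightarrow> t \<in> {0..1} \<Longrightarrow> spr (t, y) \<in> OFF"
proof (erule OFF_cases)
  fix S s u assume t: "t \<in> {0..1}" and S: "S \<in> SS" "s \<in> S" "u \<in> {-1..1}" "u \<noteq> 0" "y = bicol h S (s, u)"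
  note b = spr_bound[OF S(3,4) t]
  have "(1 - t) * u + t * sgn u \<noteq> 0" using b(2) S(4) by (metis sgn_0_0)
  then show "spr (t, y) \<in> OFF" unfolding S(5) spr_bicol[OF S(1-4)] using bicol_in_OFF S b by blast
qed (use RG_SH RG_M spr_RG in auto)

lemma retr_RG_bicol:
  "S \<in> SS \<Longrightarrow> s \<in> S \<Longrightarrow> u \<in> {-1..1} \<Longrightarrow> u \<noteq> 0 \<Longrightarrow> retr_RG (bicol h S (s, u)) = bicol h S (s, sgn u)"
  by (simp add: retr_RG_def spr_bicol)

lemma retr_RG_id: "y \<in> RG \<Longrightarrow> retr_RG y = y"
  by (simp add: retr_RG_def spr_RG)

lemma retr_RG_in: "y \<in> OFF \<Longrightarrow> retr_RG y \<in> RG"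
proof (erule OFF_cases)
  fix S s u assume S: "S \<in> SS" "s \<in> S" "u \<in> {-1..1}" "u \<noteq> 0" "y = bicol h S (s, u)"
  then show "retr_RG y \<in> RG" using retr_RG_bicol[OF S(1-4)] bicol_in_RG[of S s "sgn u"] by (auto simp: sgn_if)
qed (simp add: retr_RG_id)

lemma retr_RG_spr: "y \<in> OFF \<Longrightarrow> t \<in> {0..1} \<Longrightarrow> retr_RG (spr (t, y)) = retr_RG y"
proof (erule OFF_cases)
  fix S s u assume t: "t \<in> {0..1}" and S: "S \<in> SS" "s \<in> S" "u \<in> {-1..1}" "u \<noteq> 0" "y = bicol h S (s, u)"
  note b = spr_bound[OF S(3,4) t]
  have "(1 - t) * u + t * sgn u \<noteq> 0" using b(2) S(4) by (metis sgn_0_0)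
  then show "retr_RG (spr (t, y)) = retr_RG y"
    unfolding S(5) spr_bicol[OF S(1-4)] using retr_RG_bicol S b by simp
qed (simp add: retr_RG_id spr_RG)

lemma spr_0: "y \<in> OFF \<Longrightarrow> spr (0, y) = y"
  by (erule OFF_cases) (auto simp: spr_RG spr_bicol)

lemma spr_cont: "continuous_on ({0..1::real} \<times> OFF) spr"
  unfolding spr_def
proof (rule continuous_on_push[OF finite_SS disjoint_spr])
  show "OFF = RG \<union> (\<Union>S\<in>SS. bicol_closed h S - S)"
  proof (intro equalityI subsetI)
    fix y assume "y \<in> OFF"
    then show "y \<in> RG \<union> (\<Union>S\<in>SS. bicol_closed h S - S)"
    proof (cases rule: OFF_cases)
      case (2 S s u)
      then have "y \<in> bicol_closed h S - S" using bicol_closedI[of S s u] component_S[of S] \<open>y \<in> OFF\<close> by auto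
      then show ?thesis using 2 by blast
    qed auto
  next
    fix y assume y: "y \<in> RG \<union> (\<Union>S\<in>SS. bicol_closed h S - S)"
    show "y \<in> OFF"
    proof (cases "y \<in> RG")
      case False
      then obtain S where "S \<in> SS" "y \<in> bicol_closed h S" "y \<notin> S" using y by blast
      then show ?thesis using SH_bicol[of S] bicol_nbhd(2)[of S] by blast
    qed (use RG_M RG_SH in auto)
  qed
  have O: "OFF \<subseteq> M - TT" by auto
  show "closedin (top_of_set OFF) RG"
    using RG_closed RG_M RG_SH by (intro closedin_subset_trans[OF _ _ O]) auto
  show "closedin (top_of_set OFF) (bicol_closed h S - S)" if S: "S \<in> SS" for S
  proof -
    have "bicol_closed h S - S = OFF \<inter> bicol_closed h S" using SH_bicol[OF S] bicol_nbhd(2)[OF S] by blast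
    then show ?thesis using compact_imp_closed[OF bicol_closed_compact[OF S]] by (metis closedin_closed_Int)
  qed
  show "continuous_on ({0..1::real} \<times> (bicol_closed h S - S)) (spread S)" if S: "S \<in> SS" for S
  proof -
    have inv: "bicol_inv S y \<in> S \<times> ({-1..1} - {0})" if y: "y \<in> bicol_closed h S - S" for y
    proof -
      obtain x z where xz: "x \<in> S" "z \<in> {-1..1}" "y = bicol h S (x, z)"
        using y by (blast elim: bicol_closedE[OF S])
      then have "z \<noteq> 0" using y bicol_base[OF S] by auto
      then show ?thesis using xz bicol_inv[OF S] by simp
    qed
    have ci: "continuous_on ({0..1::real} \<times> (bicol_closed h S - S)) (\<lambda>p. bicol_inv S (snd p))"
      by (intro continuous_on_compose2[OF bicol_cont(2)[OF S]] continuous_intros) auto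
    have "continuous_on ({0..1::real} \<times> (bicol_closed h S - S))
        (\<lambda>p. (fst (bicol_inv S (snd p)), (1 - fst p) * snd (bicol_inv S (snd p)) + fst p * sgn (snd (bicol_inv S (snd p)))))"
      using inv by (intro continuous_intros ci) force
    then show ?thesis
      unfolding spread_def case_prod_unfold Let_def
    proof (rule continuous_on_compose2[OF bicol_cont(1)[OF S]], intro image_subsetI)
      fix p assume p: "p \<in> {0..1::real} \<times> (bicol_closed h S - S)"
      let ?z = "snd (bicol_inv S (snd p))"
      have i: "fst (bicol_inv S (snd p)) \<in> S" "?z \<in> {-1..1}" "?z \<noteq> 0"
        using inv[of "snd p"] p by (auto simp: mem_Times_iff)
      then show "(fst (bicol_inv S (snd p)), (1 - fst p) * ?z + fst p * sgn ?z) \<in> S \<times> {-1..1}"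
        using spr_bound(1)[OF i(2,3), of "fst p"] p by (auto simp: mem_Times_iff)
    qed
  qed
  show "spread S (t, y) = y" if "S \<in> SS" "y \<in> RG" "y \<in> bicol_closed h S - S" "t \<in> {0..1}" for S y t
    using spr_RG[OF that(2), of t] push_in[OF disjoint_spr that(1,3), of spread t] unfolding spr_def by simp
qed

lemma retr_RG_cont: "continuous_on OFF retr_RG"
  unfolding retr_RG_def by (intro continuous_on_compose2[OF spr_cont] continuous_intros) auto

end

section \<open>Open neighbourhoods of the cells\<close>

text \<open>Two stages are later chained: the first moves into a set \<open>A\<close> that the
  second moves again, and only the cell \<open>A'\<close> rests in both. Hence the resting set is
  kept apart from the target.\<close>

definition deforms ::
    "'a::topological_space set \<Rightarrow> 'a set \<Rightarrow> 'a set \<Rightarrow> 'a set \<Rightarrow> (real \<times> 'a \<Rightarrow> 'a) \<Rightarrow> bool" where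
  "deforms X Y A A' H \<longleftrightarrow>
     continuous_on ({0..1} \<times> X) H \<and> (\<forall>t\<in>{0..1}. \<forall>x\<in>X. H (t, x) \<in> Y) \<and>
     (\<forall>x\<in>X. H (0, x) = x \<and> H (1, x) \<in> A) \<and> (\<forall>t\<in>{0..1}. \<forall>a\<in>A'. H (t, a) = a)"

lemma deformsI:
  assumes "continuous_on ({0..1::real} \<times> X) H" "\<And>t x. t \<in> {0..1} \<Longrightarrow> x \<in> X \<Longrightarrow> H (t, x) \<in> Y"
    "\<And>x. x \<in> X \<Longrightarrow> H (0, x) = x" "\<And>x. x \<in> X \<Longrightarrow> H (1, x) \<in> A"
    "\<And>t a. t \<in> {0..1} \<Longrightarrow> a \<in> A' \<Longrightarrow> H (t, a) = a"
  shows "deforms X Y A A' H"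
  using assms by (simp add: deforms_def)

lemma deforms_path:
  assumes "deforms X Y A A' H"
  shows "path_from_to X a p b \<Longrightarrow> a \<in> A' \<Longrightarrow> b \<in> A' \<Longrightarrow> \<exists>q. path_from_to A a q b \<and> homotopic_paths Y p q"
    and "x \<in> X \<Longrightarrow> \<exists>b\<in>A. path_component Y x b"
proof -
  have H: "continuous_on ({0..1::real} \<times> X) H" "\<And>t x. t \<in> {0..1} \<Longrightarrow> x \<in> X \<Longrightarrow> H (t, x) \<in> Y"
    "\<And>x. x \<in> X \<Longrightarrow> H (0, x) = x" "\<And>x. x \<in> X \<Longrightarrow> H (1, x) \<in> A"
    "\<And>t a. t \<in> {0..1} \<Longrightarrow> a \<in> A' \<Longrightarrow> H (t, a) = a"
    using assms by (simp_all add: deforms_def)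
  have "\<exists>q. path_from_to A a q b \<and> homotopic_paths Y p q" if p: "path_from_to X a p b" and ab: "a \<in> A'" "b \<in> A'"
  proof -
    have "homotopic_paths Y p (\<lambda>t. H (1, p t))"
      by (rule strong_deformation_path[OF H(1) _ _ _ _ p]) (use H ab in auto)
    moreover from this have "path_from_to Y a p b"
      using p homotopic_paths_imp_subset unfolding path_from_to_def by blast
    with calculation have "path_from_to Y a (\<lambda>t. H (1, p t)) b" by (rule homotopic_paths_path_from_to)
    then have "path_from_to A a (\<lambda>t. H (1, p t)) b"
      using p H(4) unfolding path_from_to_def path_image_def by auto
    ultimately show ?thesis by blast
  qed
  then show "path_from_to X a p b \<Longrightarrow> a \<in> A' \<Longrightarrow> b \<in> A' \<Longrightarrow> \<exists>q. path_from_to A a q b \<and> homotopic_paths Y p q" .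
  show "\<exists>b\<in>A. path_component Y x b" if x: "x \<in> X"
  proof -
    have "path (\<lambda>t. H (t, x))"
      unfolding path_def using x by (intro continuous_on_compose2[OF H(1)] continuous_intros) auto
    then have "path_component Y (H (0, x)) (H (1, x))"
      unfolding path_component_def using x H(2)
      by (intro exI[of _ "\<lambda>t. H (t, x)"]) (auto simp: path_image_def pathstart_def pathfinish_def)
    then show "\<exists>b\<in>A. path_component Y x b" using H(3,4) x by auto
  qed
qed

lemma path_component_segment:
  fixes a b :: "'b::real_normed_vector"
  assumes "continuous_on (X \<times> K) f" "x \<in> X" "closed_segment a b \<subseteq> K"
    and "\<And>u. u \<in> closed_segment a b \<Longrightarrow> f (x, u) \<in> Z"
  shows "path_component Z (f (x, a)) (f (x, b))"
proof -
  have "path (\<lambda>t. f (x, linepath a b t))"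
    unfolding path_def using assms(2,3)
    by (intro continuous_on_compose2[OF assms(1)] continuous_intros) 
       (auto simp: linepath_in_path)
  then show ?thesis
    unfolding path_component_def using assms(4)
    by (intro exI[of _ "\<lambda>t. f (x, linepath a b t)"])
       (auto simp: path_image_def pathstart_def pathfinish_def linepath_in_path linepath_0' linepath_1')
qed

lemma connected_imp_path_connected:
  assumes "locally path_connected S" "connected S" shows "path_connected S"
  unfolding path_connected_component
proof (intro ballI)
  fix x y assume "x \<in> S" "y \<in> S"
  then have "connected_component S x y"
    using assms(2) unfolding connected_component_def by blast
  then show "path_component S x y" using path_component_eq_connected_component[OF assms(1)] by metis
qed

context tribranched_nbhds
begin

abbreviation "cells \<equiv> tbs_cells M \<Sigma> h"

text \<open>The neighbourhoods of sheets and regions reach into the tubes along the radii, which makes them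
  open in \<open>M\<close> and not only in the complement of the tubes.\<close>

definition hood :: "'a cell \<Rightarrow> 'a set" where
  "hood v = (case v of Branch C \<Rightarrow> tub_open h C
     | Sheet S \<Rightarrow> {y \<in> M - BS. rho y \<in> bicol_open h S}
     | Region N \<Rightarrow> {y \<in> M - BS. rho y \<in> OFF \<and> retr_RG (rho y) \<in> N})"

lemma hood_simps [simp]:
  "hood (Branch C) = tub_open h C"
  "hood (Sheet S) = {y \<in> M - BS. rho y \<in> bicol_open h S}"
  "hood (Region N) = {y \<in> M - BS. rho y \<in> OFF \<and> retr_RG (rho y) \<in> N}"
  by (simp_all add: hood_def)

lemma cells_cases:
  assumes "v \<in> cells"
  obtains C where "v = Branch C" "C \<in> CC" | S where "v = Sheet S" "S \<in> SS"
    | N where "v = Region N" "N \<in> components RG"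
  using assms by (auto simp: tbs_cells_def)

lemma cellsI: "C \<in> CC \<Longrightarrow> Branch C \<in> cells" "S \<in> SS \<Longrightarrow> Sheet S \<in> cells"
  "N \<in> components RG \<Longrightarrow> Region N \<in> cells"
  by (auto simp: tbs_cells_def)

lemma M_BS_openin: "openin (top_of_set M) (M - BS)"
  using openin_diff[OF openin_topspace[of "top_of_set M"], of BS] compact_imp_closed[OF compact_BS]
    closed_subset[of BS M] BS_\<Sigma> \<Sigma>_M by auto

lemma OFF_openin: "openin (top_of_set (M - TT)) OFF"
  using openin_diff[OF openin_topspace[of "top_of_set (M - TT)"], of SH] compact_imp_closed[OF compact_SH]
    closed_subset[of SH "M - TT"] SH_M by auto

lemma M_BS_preimage_openin:
  assumes "openin (top_of_set (M - TT)) U" shows "openin (top_of_set M) {y \<in> M - BS. rho y \<in> U}"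
proof -
  have "{y \<in> M - BS. rho y \<in> U} = (M - BS) \<inter> rho -` U" by auto
  moreover have "openin (top_of_set (M - BS)) ((M - BS) \<inter> rho -` U)"
    using rho_in by (intro continuous_openin_preimage[OF rho_cont _ assms]) auto
  ultimately show ?thesis using openin_trans M_BS_openin by metis
qed

lemma open_locally_path_connected: "openin (top_of_set M) U \<Longrightarrow> locally path_connected U"
  using three_manifold_locally_path_connected[OF manifold_M] locally_open_subset by blast

lemma RG_in_M_BS: "RG \<subseteq> M - BS" using RG_M BS_TT by blast

lemma RG_OFF: "RG \<subseteq> OFF" using RG_M RG_SH by blast

lemma retr_rho_cont: "continuous_on {y \<in> M - BS. rho y \<in> OFF} (\<lambda>y. retr_RG (rho y))"
  by (intro continuous_on_compose2[OF retr_RG_cont] continuous_on_subset[OF rho_cont]) auto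

text \<open>\<open>RG\<close> need not be open in \<open>M\<close>, but
  \<open>retr_RG \<circ> rho\<close> retracts an open subset of \<open>M\<close> onto it, and
  retracts inherit local path connectedness. This makes the regions open in \<open>RG\<close> and
  path connected.\<close>

lemma locally_path_connected_RG: "locally path_connected RG"
proof (rule retract_of_locally_path_connected)
  show "locally path_connected {y \<in> M - BS. rho y \<in> OFF}"
    by (rule open_locally_path_connected[OF M_BS_preimage_openin[OF OFF_openin]])
  have "retraction {y \<in> M - BS. rho y \<in> OFF} RG (\<lambda>y. retr_RG (rho y))"
    unfolding retraction_def
  proof (intro conjI ballI retr_rho_cont)
    show "RG \<subseteq> {y \<in> M - BS. rho y \<in> OFF}"
    proof
      fix y assume y: "y \<in> RG"
      then have "rho y = y" using rho_M_TT RG_M by blast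
      then show "y \<in> {y \<in> M - BS. rho y \<in> OFF}" using y RG_in_M_BS RG_OFF by auto
    qed
    show "(\<lambda>y. retr_RG (rho y)) \<in> {y \<in> M - BS. rho y \<in> OFF} \<rightarrow> RG" using retr_RG_in by blast
    show "retr_RG (rho y) = y" if "y \<in> RG" for y
    proof -
      have "rho y = y" using rho_M_TT RG_M that by blast
      then show ?thesis using retr_RG_id that by simp
    qed
  qed
  then show "RG retract_of {y \<in> M - BS. rho y \<in> OFF}" by (auto simp: retract_of_def)
qed

text \<open>The hood of a sheet or region is the preimage of a relatively open set under a push with
  open domain; for a region that set is a component of \<open>RG\<close>, open by local
  connectedness.\<close>

lemma hood_openin: "v \<in> cells \<Longrightarrow> openin (top_of_set M) (hood v)"
proof (erule cells_cases)
  fix N assume N: "v = Region N" "N \<in> components RG"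
  let ?E = "{y \<in> M - BS. rho y \<in> OFF}"
  have "openin (top_of_set RG) N"
    using openin_components_locally_connected N(2) locally_path_connected_RG
      locally_path_connected_imp_locally_connected by blast
  then have "openin (top_of_set ?E) (?E \<inter> (\<lambda>y. retr_RG (rho y)) -` N)"
    using retr_RG_in by (intro continuous_openin_preimage[OF retr_rho_cont]) auto
  moreover have "?E \<inter> (\<lambda>y. retr_RG (rho y)) -` N = hood v" using N by auto
  ultimately show "openin (top_of_set M) (hood v)"
    using openin_trans M_BS_preimage_openin[OF OFF_openin] by metis
next
  fix S assume "v = Sheet S" "S \<in> SS"
  then show "openin (top_of_set M) (hood v)" using M_BS_preimage_openin[OF bicol_nbhd(3)] by simp
next
  fix C assume "v = Branch C" "C \<in> CC"
  then show "openin (top_of_set M) (hood v)" using tub_open_openin by simp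
qed

lemma hood_M: "v \<in> cells \<Longrightarrow> hood v \<subseteq> M"
  using hood_openin openin_imp_subset by blast

lemma component_N: "N \<in> components RG \<Longrightarrow> N \<subseteq> RG \<and> connected N \<and> N \<noteq> {}"
  using in_components_subset in_components_connected in_components_nonempty by blast

text \<open>Off the branch set \<open>rho y\<close> lies outside the tubes, hence in a region or in
  an open bicollar.\<close>

lemma hood_cover:
  assumes "y \<in> M" shows "\<exists>v\<in>cells. y \<in> hood v"
proof (cases "y \<in> BS")
  case True
  then obtain C where "C \<in> CC" "y \<in> C" by (metis UnionE Union_components)
  then show ?thesis using C_tub_open[of C] cellsI(1)[of C] by (intro bexI[of _ "Branch C"]) auto
next
  case False
  then have y: "y \<in> M - BS" using assms by auto
  show ?thesis
  proof (cases "rho y \<in> RG")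
    case True
    then obtain N where N: "N \<in> components RG" "rho y \<in> N" by (metis UnionE Union_components)
    have "retr_RG (rho y) = rho y" using True by (rule retr_RG_id)
    then show ?thesis using N y True RG_OFF cellsI(3)[OF N(1)] by (intro bexI[of _ "Region N"]) auto
  next
    case False
    then obtain S where "S \<in> SS" "rho y \<in> bicol_open h S" using rho_in[OF y] by (auto simp: regions_def)
    then show ?thesis using y cellsI(2)[of S] by (intro bexI[of _ "Sheet S"]) auto
  qed
qed

lemma bicol_open_hood: "S \<in> SS \<Longrightarrow> bicol_open h S \<subseteq> hood (Sheet S)"
proof
  fix y assume S: "S \<in> SS" and y: "y \<in> bicol_open h S"
  then have "y \<in> M - TT" using bicol_nbhd(2)[OF S] bicol_open_closed[OF S] by blast
  then show "y \<in> hood (Sheet S)" using y rho_M_TT[of y] BS_TT by auto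
qed

lemma OFF_hood: "y \<in> OFF \<Longrightarrow> retr_RG y \<in> N \<Longrightarrow> y \<in> hood (Region N)"
  using rho_M_TT[of y] BS_TT by auto

lemma cell_hood: "v \<in> cells \<Longrightarrow> cell_set v \<subseteq> hood v"
proof (erule cells_cases)
  fix N assume N: "v = Region N" "N \<in> components RG"
  show "cell_set v \<subseteq> hood v"
  proof
    fix y assume "y \<in> cell_set v"
    then have "y \<in> N" "y \<in> RG" using N component_N[OF N(2)] by auto
    then show "y \<in> hood v" unfolding N(1) using OFF_hood[of y N] RG_OFF retr_RG_id[of y] by auto
  qed
next
  fix S assume "v = Sheet S" "S \<in> SS"
  then show "cell_set v \<subseteq> hood v" using bicol_open_hood[of S] S_bicol_open[of S] by (metis cell_set.simps(2) subset_trans)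
next
  fix C assume "v = Branch C" "C \<in> CC"
  then show "cell_set v \<subseteq> hood v" using C_tub_open by simp
qed

lemma cell_M: "v \<in> cells \<Longrightarrow> cell_set v \<subseteq> M"
  using cell_hood hood_M by blast

subsection \<open>Contraction onto the cells\<close>

text \<open>The first component is a scale factor rather than a time: 1 gives the identity, 0 the
  projection to the core. A fixed factor \<open>r\<close> copies the tube boundary to radius
  \<open>r\<close>, as \<open>shrink_path\<close> requires; the contraction lets the factor run from
  1 to 0.\<close>

definition tub_shrink :: "'a set \<Rightarrow> real \<times> 'a \<Rightarrow> 'a" where
  "tub_shrink C p = tub h C (fst (tub_inv C (snd p)), of_real (fst p) * snd (tub_inv C (snd p)))"

lemma tub_shrink: "C \<in> CC \<Longrightarrow> x \<in> C \<Longrightarrow> norm z \<le> 1 \<Longrightarrow> tub_shrink C (r, tub h C (x, z)) = tub h C (x, of_real r * z)"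
  by (simp add: tub_shrink_def tub_inv)

lemma norm_scale: "r \<in> {0..1} \<Longrightarrow> norm (z :: complex) \<le> 1 \<Longrightarrow> norm (of_real r * z) \<le> 1"
  by (simp add: norm_mult mult_le_one)

lemma tub_shrink_cont:
  assumes C: "C \<in> CC" shows "continuous_on ({0..1::real} \<times> tub_closed h C) (tub_shrink C)"
proof -
  have inv: "tub_inv C y \<in> C \<times> cball 0 1" if "y \<in> tub_closed h C" for y
    using homeomorphism_image2[OF tub_homeo[OF C]] that by blast
  have ci: "continuous_on ({0..1} \<times> tub_closed h C) (\<lambda>p. tub_inv C (snd p))"
    by (intro continuous_on_compose2[OF tub_cont(2)[OF C]] continuous_intros) auto
  have "continuous_on ({0..1} \<times> tub_closed h C)
      (\<lambda>p. (fst (tub_inv C (snd p)), of_real (fst p) * snd (tub_inv C (snd p))))"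
    by (intro continuous_intros ci)
  then show ?thesis
    unfolding tub_shrink_def
  proof (rule continuous_on_compose2[OF tub_cont(1)[OF C]], intro image_subsetI)
    fix p assume p: "p \<in> {0..1::real} \<times> tub_closed h C"
    then have "fst (tub_inv C (snd p)) \<in> C" "norm (snd (tub_inv C (snd p))) \<le> 1" "fst p \<in> {0..1}"
      using inv[of "snd p"] by (auto simp: mem_Times_iff)
    then show "(fst (tub_inv C (snd p)), of_real (fst p) * snd (tub_inv C (snd p))) \<in> C \<times> cball 0 1"
      using norm_scale by (simp only: mem_Times_iff mem_cball_0 fst_conv snd_conv)
  qed
qed

definition bicol_shrink :: "'a set \<Rightarrow> real \<times> 'a \<Rightarrow> 'a" where
  "bicol_shrink S p = bicol h S (fst (bicol_inv S (snd p)), fst p * snd (bicol_inv S (snd p)))"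

lemma bicol_shrink: "S \<in> SS \<Longrightarrow> s \<in> S \<Longrightarrow> u \<in> {-1..1} \<Longrightarrow> bicol_shrink S (r, bicol h S (s, u)) = bicol h S (s, r * u)"
  by (simp add: bicol_shrink_def bicol_inv)

lemma scale_interval: "r \<in> {0..1} \<Longrightarrow> (u::real) \<in> {-1..1} \<Longrightarrow> r * u \<in> {-1..1}"
proof -
  assume *: "r \<in> {0..1}" "u \<in> {-1..1}"
  then have "\<bar>r * u\<bar> \<le> 1 * 1" unfolding abs_mult by (intro mult_mono) auto
  then show ?thesis by auto
qed

lemma bicol_shrink_cont:
  assumes S: "S \<in> SS" shows "continuous_on ({0..1::real} \<times> bicol_closed h S) (bicol_shrink S)"
proof -
  have inv: "bicol_inv S y \<in> S \<times> {-1..1}" if "y \<in> bicol_closed h S" for y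
    using homeomorphism_image2[OF bicol_homeo[OF S]] that by blast
  have ci: "continuous_on ({0..1} \<times> bicol_closed h S) (\<lambda>p. bicol_inv S (snd p))"
    by (intro continuous_on_compose2[OF bicol_cont(2)[OF S]] continuous_intros) auto
  have "continuous_on ({0..1} \<times> bicol_closed h S)
      (\<lambda>p. (fst (bicol_inv S (snd p)), fst p * snd (bicol_inv S (snd p))))"
    by (intro continuous_intros ci)
  then show ?thesis
    unfolding bicol_shrink_def
  proof (rule continuous_on_compose2[OF bicol_cont(1)[OF S]], intro image_subsetI)
    fix p assume p: "p \<in> {0..1::real} \<times> bicol_closed h S"
    then have "fst (bicol_inv S (snd p)) \<in> S" "snd (bicol_inv S (snd p)) \<in> {-1..1}" "fst p \<in> {0..1}"
      using inv[of "snd p"] by (auto simp: mem_Times_iff)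
    then show "(fst (bicol_inv S (snd p)), fst p * snd (bicol_inv S (snd p))) \<in> S \<times> {-1..1}"
      using scale_interval by (simp only: mem_Times_iff fst_conv snd_conv)
  qed
qed

lemma reverse_time_cont:
  assumes "continuous_on ({0..1::real} \<times> X) f" "Y \<subseteq> X" shows "continuous_on ({0..1} \<times> Y) (\<lambda>p. f (1 - fst p, snd p))"
  using assms(2) by (intro continuous_on_compose2[OF assms(1)] continuous_intros) auto

lemma Branch_deformation:
  assumes C: "C \<in> CC"
  shows "deforms (tub_open h C) (tub_open h C) C C (\<lambda>p. tub_shrink C (1 - fst p, snd p))" (is "deforms _ _ _ _ ?H")
proof (rule deformsI)
  show "continuous_on ({0..1} \<times> tub_open h C) ?H"
    by (rule reverse_time_cont[OF tub_shrink_cont[OF C] tub_open_closed[OF C]])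
  show "?H (t, y) = y" if "t \<in> {0..1}" "y \<in> C" for t y
    using tub_shrink[OF C that(2), of 0] tub_base[OF C that(2)] by simp
  fix y assume "y \<in> tub_open h C"
  then obtain x z where xz: "x \<in> C" "norm z < 1" "y = tub h C (x, z)" unfolding tub_open_def by auto
  note H = tub_shrink[OF C xz(1) less_imp_le[OF xz(2)], folded xz(3)]
  show "?H (0, y) = y" "?H (1, y) \<in> C" using H xz tub_base[OF C xz(1)] by simp_all
  fix t :: real assume t: "t \<in> {0..1}"
  have "norm (of_real (1 - t) * z) \<le> 1 * norm z"
    unfolding norm_mult norm_of_real using t by (intro mult_right_mono) auto
  then have "norm (of_real (1 - t) * z) < 1" using xz(2) by simp
  moreover have "?H (t, y) = tub h C (x, of_real (1 - t) * z)" using H by simp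
  ultimately show "?H (t, y) \<in> tub_open h C" using tub_in_open[OF C xz(1)] by simp
qed

lemma Sheet_deformation:
  assumes S: "S \<in> SS"
  shows "deforms (bicol_open h S) (bicol_open h S) S S (\<lambda>p. bicol_shrink S (1 - fst p, snd p))" (is "deforms _ _ _ _ ?H")
proof (rule deformsI)
  show "continuous_on ({0..1} \<times> bicol_open h S) ?H"
    by (rule reverse_time_cont[OF bicol_shrink_cont[OF S] bicol_open_closed[OF S]])
  show "?H (t, y) = y" if "t \<in> {0..1}" "y \<in> S" for t y
    using bicol_shrink[OF S that(2), of 0] bicol_base[OF S that(2)] by simp
  fix y assume "y \<in> bicol_open h S"
  then obtain s u where su: "s \<in> S" "u \<in> {-1<..<1}" "y = bicol h S (s, u)" unfolding bicol_open_def by auto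
  have u: "u \<in> {-1..1}" using su by auto
  note H = bicol_shrink[OF S su(1) u, folded su(3)]
  show "?H (0, y) = y" "?H (1, y) \<in> S" using H su bicol_base[OF S su(1)] by simp_all
  fix t :: real assume t: "t \<in> {0..1}"
  have "\<bar>(1 - t) * u\<bar> \<le> 1 * \<bar>u\<bar>"
    unfolding abs_mult using t by (intro mult_right_mono) auto
  then have "\<bar>(1 - t) * u\<bar> < 1" using su(2) by auto
  moreover have "(1 - t) * u \<in> {-1..1}" using scale_interval[of "1 - t" u] t u by simp
  moreover have "?H (t, y) = bicol h S (s, (1 - t) * u)" using H by simp
  ultimately show "?H (t, y) \<in> bicol_open h S" using bicol_in_open_same[OF S su(1)] by simp
qed

lemma rad_hood:
  "t \<in> {0..1} \<Longrightarrow> y \<in> hood (Sheet S) \<Longrightarrow> rad (t, y) \<in> hood (Sheet S)"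
  "t \<in> {0..1} \<Longrightarrow> y \<in> hood (Region N) \<Longrightarrow> rad (t, y) \<in> hood (Region N)"
  using rad_in rho_rad by auto

text \<open>An open tube contracts in one stage. The hood of a sheet or region takes two:
  \<open>rad\<close> moves it out of the tubes, then the bicollar is shrunk onto the sheet or spread
  into the region. In the two-stage cases the cell lies outside the tubes and rests
  throughout.\<close>

lemma hood_deform:
  assumes v: "v \<in> cells"
  shows "path_from_to (hood v) a p b \<Longrightarrow> a \<in> cell_set v \<Longrightarrow> b \<in> cell_set v \<Longrightarrow>
      \<exists>q. path_from_to (cell_set v) a q b \<and> homotopic_paths (hood v) p q"
    and "y \<in> hood v \<Longrightarrow> \<exists>b\<in>cell_set v. path_component (hood v) y b"
proof -
  have "(path_from_to (hood v) a p b \<longrightarrow> a \<in> cell_set v \<longrightarrow> b \<in> cell_set v \<longrightarrow>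
      (\<exists>q. path_from_to (cell_set v) a q b \<and> homotopic_paths (hood v) p q)) \<and>
      (y \<in> hood v \<longrightarrow> (\<exists>b\<in>cell_set v. path_component (hood v) y b))"
    using v
  proof (cases rule: cells_cases)
    case (1 C)
    note D = deforms_path[OF Branch_deformation[OF 1(2)]]
    have "\<exists>q. path_from_to C a q b \<and> homotopic_paths (tub_open h C) p q"
      if "path_from_to (tub_open h C) a p b" "a \<in> C" "b \<in> C" by (rule D(1)[OF that])
    moreover have "\<exists>b\<in>C. path_component (tub_open h C) y b" if "y \<in> tub_open h C" by (rule D(2)[OF that])
    ultimately show ?thesis using 1 by simp
  next
    case (2 S)
    let ?U = "hood (Sheet S)"
    have 3: "S \<subseteq> M - TT" using component_S[OF 2(2)] by blast
    have D1: "deforms ?U ?U (bicol_open h S) S rad"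
    proof (rule deformsI)
      show "continuous_on ({0..1} \<times> ?U) rad" by (rule continuous_on_subset[OF rad_cont]) auto
      show "rad (1, x) \<in> bicol_open h S" if "x \<in> ?U" for x using that unfolding rho_def[symmetric] by simp
    qed (use rad_hood(1) rad_0 rad_M_TT 3 in auto)
    note D2 = Sheet_deformation[OF 2(2)]
    note D = deforms_path[OF D1] deforms_path[OF D2]
    have sub: "bicol_open h S \<subseteq> ?U" by (rule bicol_open_hood[OF 2(2)])
    have "\<exists>q. path_from_to S a q b \<and> homotopic_paths ?U p q"
      if p: "path_from_to ?U a p b" "a \<in> S" "b \<in> S"
    proof -
      obtain q where q: "path_from_to (bicol_open h S) a q b" "homotopic_paths ?U p q" using D(1)[OF p] by blast
      obtain q' where q': "path_from_to S a q' b" "homotopic_paths (bicol_open h S) q q'" using D(3)[OF q(1) p(2,3)] by blast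
      have "homotopic_paths ?U p q'"
        by (rule homotopic_paths_trans[OF q(2) homotopic_paths_subset[OF q'(2) sub]])
      then show ?thesis using q'(1) by blast
    qed
    moreover have "\<exists>b\<in>S. path_component ?U y b" if y: "y \<in> ?U"
    proof -
      obtain x where x: "x \<in> bicol_open h S" "path_component ?U y x" using D(2)[OF y] by blast
      obtain b where b: "b \<in> S" "path_component (bicol_open h S) x b" using D(4)[OF x(1)] by blast
      have "path_component ?U y b"
        by (rule path_component_trans[OF x(2) path_component_of_subset[OF sub b(2)]])
      then show ?thesis using b(1) by blast
    qed
    ultimately show ?thesis using 2 by simp
  next
    case (3 N)
    let ?U = "hood (Region N)" and ?V = "{y \<in> OFF. retr_RG y \<in> N}"
    have N: "N \<subseteq> RG" using component_N[OF 3(2)] by blast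
    have N': "N \<subseteq> M - TT" using N RG_M by blast
    have D1: "deforms ?U ?U ?V N rad"
    proof (rule deformsI)
      show "continuous_on ({0..1} \<times> ?U) rad" by (rule continuous_on_subset[OF rad_cont]) auto
      show "rad (1, x) \<in> ?V" if "x \<in> ?U" for x using that unfolding rho_def[symmetric] by simp
    qed (use rad_hood(2) rad_0 rad_M_TT N' in auto)
    have D2: "deforms ?V ?V N N spr"
    proof (rule deformsI)
      show "continuous_on ({0..1} \<times> ?V) spr" by (rule continuous_on_subset[OF spr_cont]) auto
      show "spr (t, x) \<in> ?V" if "t \<in> {0..1}" "x \<in> ?V" for t x using that spr_in[of x t] retr_RG_spr[of x t] by simp
      show "spr (1, x) \<in> N" if "x \<in> ?V" for x using that by (simp add: retr_RG_def)
      show "spr (0, x) = x" if "x \<in> ?V" for x using that spr_0 by simp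
      show "spr (t, x) = x" if "x \<in> N" for t x using that spr_RG N by blast
    qed
    note D = deforms_path[OF D1] deforms_path[OF D2]
    have sub: "?V \<subseteq> ?U" using OFF_hood[of _ N] by blast
    have "\<exists>q. path_from_to N a q b \<and> homotopic_paths ?U p q"
      if p: "path_from_to ?U a p b" "a \<in> N" "b \<in> N"
    proof -
      obtain q where q: "path_from_to (?V) a q b" "homotopic_paths ?U p q" using D(1)[OF p] by blast
      obtain q' where q': "path_from_to N a q' b" "homotopic_paths (?V) q q'" using D(3)[OF q(1) p(2,3)] by blast
      have "homotopic_paths ?U p q'"
        by (rule homotopic_paths_trans[OF q(2) homotopic_paths_subset[OF q'(2) sub]])
      then show ?thesis using q'(1) by blast
    qed
    moreover have "\<exists>b\<in>N. path_component ?U y b" if y: "y \<in> ?U"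
    proof -
      obtain x where x: "x \<in> ?V" "path_component ?U y x" using D(2)[OF y] by blast
      obtain b where b: "b \<in> N" "path_component (?V) x b" using D(4)[OF x(1)] by blast
      have "path_component ?U y b"
        by (rule path_component_trans[OF x(2) path_component_of_subset[OF sub b(2)]])
      then show ?thesis using b(1) by blast
    qed
    ultimately show ?thesis using 3 by simp
  qed
  then show "path_from_to (hood v) a p b \<Longrightarrow> a \<in> cell_set v \<Longrightarrow> b \<in> cell_set v \<Longrightarrow>
      \<exists>q. path_from_to (cell_set v) a q b \<and> homotopic_paths (hood v) p q"
    and "y \<in> hood v \<Longrightarrow> \<exists>b\<in>cell_set v. path_component (hood v) y b" by blast+
qed

text \<open>Branch curves and sheets are retracts of their open hoods and so locally path connected;
  regions are components of the locally path connected \<open>RG\<close>. Connectedness then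
  provides paths.\<close>

lemma cell_path_connected: "v \<in> cells \<Longrightarrow> path_connected (cell_set v)"
proof -
  assume v: "v \<in> cells"
  have "locally path_connected (cell_set v) \<and> connected (cell_set v)"
    using v
  proof (cases rule: cells_cases)
    case (1 C)
    have "retraction (tub_open h C) C (\<lambda>y. tub_shrink C (0, y))"
    proof -
      note D = Branch_deformation[OF 1(2)]
      have "continuous_on (tub_open h C) (\<lambda>y. tub_shrink C (0, y))"
        using tub_open_closed[OF 1(2)]
        by (intro continuous_on_compose2[OF tub_shrink_cont[OF 1(2)]] continuous_intros) auto
      moreover have "tub_shrink C (0, y) \<in> C" if "y \<in> tub_open h C" for y
        using D that by (simp add: deforms_def)
      moreover have "tub_shrink C (0, y) = y" if "y \<in> C" for y
        using D that unfolding deforms_def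
          by (metis atLeastAtMost_iff cancel_comm_monoid_add_class.diff_cancel fst_conv order_refl snd_conv zero_le_one)
      ultimately show ?thesis unfolding retraction_def using C_tub_open[OF 1(2)] by simp
    qed
    then have "C retract_of tub_open h C" by (auto simp: retract_of_def)
    then show ?thesis
      using 1 retract_of_locally_path_connected open_locally_path_connected hood_openin[OF v] component_C[OF 1(2)]
      by (metis cell_set.simps(1) hood_simps(1))
  next
    case (2 S)
    have "retraction (hood (Sheet S)) S (\<lambda>y. bicol_shrink S (0, rho y))"
    proof -
      note D = Sheet_deformation[OF 2(2)]
      have "continuous_on (hood (Sheet S)) (\<lambda>y. bicol_shrink S (0, rho y))"
        using bicol_open_closed[OF 2(2)]
        by (intro continuous_on_compose2[OF bicol_shrink_cont[OF 2(2)]] continuous_intros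
            continuous_on_subset[OF rho_cont]) auto
      moreover have "bicol_shrink S (0, y) \<in> S" if "y \<in> bicol_open h S" for y
        using D that by (simp add: deforms_def)
      moreover have "bicol_shrink S (0, rho y) = y" if "y \<in> S" for y
      proof -
        have "rho y = y" using rho_M_TT component_S[OF 2(2)] that by blast
        then show ?thesis
          using D that unfolding deforms_def
            by (metis atLeastAtMost_iff cancel_comm_monoid_add_class.diff_cancel fst_conv order_refl snd_conv zero_le_one)
      qed
      moreover have "S \<subseteq> hood (Sheet S)" using cell_hood[OF v] 2(1) by simp
      ultimately show ?thesis unfolding retraction_def by auto
    qed
    then have "S retract_of hood (Sheet S)" by (auto simp: retract_of_def)
    then show ?thesis
      using 2 retract_of_locally_path_connected open_locally_path_connected hood_openin[OF v] component_S[OF 2(2)]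
      by (metis cell_set.simps(2))
  next
    case (3 N)
    then show ?thesis
      using locally_path_connected_components[OF locally_path_connected_RG] component_N[OF 3(2)] by simp
  qed
  then show ?thesis using connected_imp_path_connected by blast
qed

lemma path_in_cell: "v \<in> cells \<Longrightarrow> a \<in> cell_set v \<Longrightarrow> b \<in> cell_set v \<Longrightarrow> path_component (cell_set v) a b"
  using cell_path_connected path_connected_component by blast

lemma path_in_hood:
  assumes "v \<in> cells" "y \<in> hood v" "b \<in> cell_set v" shows "path_component (hood v) y b"
  using hood_deform(2)[OF assms(1,2)] path_in_cell[OF assms(1) _ assms(3)]
    path_component_of_subset[OF cell_hood[OF assms(1)]] path_component_trans by metis

end

section \<open>Edges and strands\<close>

text \<open>Evaluates the definite descriptions in \<open>term_cell\<close>: a connected nonempty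
  subset lies in exactly one component.\<close>

lemma the_component:
  assumes "connected A" "A \<subseteq> X" "D \<in> components X" "A \<inter> D \<noteq> {}"
  shows "(THE N. N \<in> components X \<and> A \<subseteq> N) = D" "A \<subseteq> D"
proof -
  show AD: "A \<subseteq> D" using components_maximal[OF assms(3,1,2)] assms(4) by blast
  show "(THE N. N \<in> components X \<and> A \<subseteq> N) = D"
  proof (rule the_equality)
    fix N assume "N \<in> components X \<and> A \<subseteq> N"
    moreover have "A \<noteq> {}" using assms(4) by blast
    ultimately have "N \<in> components X" "N \<inter> D \<noteq> {}" using AD by auto
    then show "N = D" using components_nonoverlap[of N X D] assms(3) by blast
  qed (use AD assms(3) in blast)
qed

lemma component_meeting:
  assumes "A \<subseteq> X" "A \<noteq> {}" shows "\<exists>D\<in>components X. A \<inter> D \<noteq> {}"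
proof -
  obtain x where "x \<in> A" using assms by blast
  then have "x \<in> \<Union>(components X)" using assms by auto
  then show ?thesis using \<open>x \<in> A\<close> by blast
qed

lemma path_component_image:
  assumes "path_component Z a b" "continuous_on Z f" "f ` Z \<subseteq> W"
  shows "path_component W (f a) (f b)"
  using assms path_from_to_image unfolding path_component_iff_path_from_to by blast

context tribranched_nbhds
begin

abbreviation "arcs \<equiv> tbs_edges M \<Sigma> h"
abbreviation "tcell \<equiv> term_cell M \<Sigma> h"

lemma edges_cases:
  assumes "a \<in> arcs"
  obtains C k where "a = Prong C k" "C \<in> CC" "k < 3" | C k where "a = Sector C k" "C \<in> CC" "k < 3"
    | S e where "a = Side S e" "S \<in> SS" "e \<in> {1, -1}"
  using assms unfolding tbs_edges_def by blast

lemma edgesI: "C \<in> CC \<Longrightarrow> k < 3 \<Longrightarrow> Prong C k \<in> arcs" "C \<in> CC \<Longrightarrow> k < 3 \<Longrightarrow> Sector C k \<in> arcs"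
  "S \<in> SS \<Longrightarrow> e \<in> {1, -1} \<Longrightarrow> Side S e \<in> arcs"
  unfolding tbs_edges_def by blast+

lemma connected_tub_image:
  assumes "C \<in> CC" "connected K" "K \<subseteq> cball 0 1"
  shows "connected (tub h C ` (C \<times> K))"
  using assms component_C[OF assms(1)]
  by (intro connected_continuous_image connected_Times continuous_on_subset[OF tub_cont(1)]) auto

lemma ray_in_SH: "C \<in> CC \<Longrightarrow> k < 3 \<Longrightarrow> x \<in> C \<Longrightarrow> tub h C (x, ray k) \<in> SH"
  using tub_in_\<Sigma>[of C x "ray k"] tub_in_TT[of C x "ray k"] ray_in_Y_graph[of k] by (simp add: sheets_def)

text \<open>The parallel copy of \<open>C\<close> at the end of the ray is connected, and it lies on
  the sheets because it is on \<open>Y_graph\<close> at distance 1 from the core.\<close>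

lemma prong_component:
  assumes C: "C \<in> CC" "k < 3" and S: "S \<in> SS" "tub h C ` (C \<times> {ray k}) \<inter> S \<noteq> {}"
  shows "tcell (Prong C k) = Sheet S" "tub h C ` (C \<times> {ray k}) \<subseteq> S"
proof -
  have "connected (tub h C ` (C \<times> {ray k}))" using connected_tub_image[OF C(1), of "{ray k}"] by simp
  moreover have "tub h C ` (C \<times> {ray k}) \<subseteq> SH" using ray_in_SH[OF C] by auto
  ultimately show "tcell (Prong C k) = Sheet S" "tub h C ` (C \<times> {ray k}) \<subseteq> S"
    using the_component[OF _ _ S] by simp_all
qed

lemma prong_ex:
  assumes C: "C \<in> CC" "k < 3"
  obtains S where "S \<in> SS" "tcell (Prong C k) = Sheet S" "tub h C ` (C \<times> {ray k}) \<subseteq> S"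
proof -
  have "tub h C ` (C \<times> {ray k}) \<subseteq> SH" using ray_in_SH[OF C] by auto
  moreover have "tub h C ` (C \<times> {ray k}) \<noteq> {}" using component_C[OF C(1)] by auto
  ultimately obtain S where "S \<in> SS" "tub h C ` (C \<times> {ray k}) \<inter> S \<noteq> {}"
    using component_meeting by metis
  then show thesis using that prong_component[OF C] by blast
qed

lemma side_in_RG: "S \<in> SS \<Longrightarrow> e \<in> {1, -1} \<Longrightarrow> s \<in> S \<Longrightarrow> bicol h S (s, e) \<in> RG"
  using bicol_in_RG[of S s e] by auto

lemma side_component:
  assumes S: "S \<in> SS" "e \<in> {1, -1}" and N: "N \<in> components RG" "bicol h S ` (S \<times> {e}) \<inter> N \<noteq> {}"
  shows "tcell (Side S e) = Region N" "bicol h S ` (S \<times> {e}) \<subseteq> N"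
proof -
  have "connected (bicol h S ` (S \<times> {e}))"
    using component_S[OF S(1)] S(2)
    by (intro connected_continuous_image connected_Times continuous_on_subset[OF bicol_cont(1)[OF S(1)]]) auto
  moreover have "bicol h S ` (S \<times> {e}) \<subseteq> RG" using side_in_RG[OF S] by auto
  ultimately show "tcell (Side S e) = Region N" "bicol h S ` (S \<times> {e}) \<subseteq> N"
    using the_component[OF _ _ N] by simp_all
qed

lemma side_ex:
  assumes S: "S \<in> SS" "e \<in> {1, -1}"
  obtains N where "N \<in> components RG" "tcell (Side S e) = Region N" "bicol h S ` (S \<times> {e}) \<subseteq> N"
proof -
  have "bicol h S ` (S \<times> {e}) \<subseteq> RG" using side_in_RG[OF S] by auto
  moreover have "bicol h S ` (S \<times> {e}) \<noteq> {}" using component_S[OF S(1)] by auto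
  ultimately obtain N where "N \<in> components RG" "bicol h S ` (S \<times> {e}) \<inter> N \<noteq> {}"
    using component_meeting by metis
  then show thesis using that side_component[OF S] by blast
qed

text \<open>The arc is cut down to \<open>RG\<close> because near the rays the tube boundary belongs
  to the bicollars of the adjacent sheets.\<close>

definition sector_part :: "'a set \<Rightarrow> nat \<Rightarrow> 'a set" where
  "sector_part C k = tub h C ` (C \<times> circle_arc k) \<inter> RG"

lemma sector_part_eq: "tub h C ` (C \<times> sector k \<inter> UNIV \<times> sphere 0 1) \<inter> RG = sector_part C k"
proof -
  have "C \<times> sector k \<inter> UNIV \<times> sphere 0 1 = C \<times> circle_arc k" by (auto simp: circle_arc_def)
  then show ?thesis by (simp add: sector_part_def)
qed

lemma circle_arc_norm: "z \<in> circle_arc k \<Longrightarrow> norm z = 1"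
  by (simp add: circle_arc_def)

lemma tub_in_OFF: 
  assumes C: "C \<in> CC" "x \<in> C" "norm z = 1" "z \<notin> Y_graph" shows "tub h C (x, z) \<in> OFF"
  using tub_in_TT[OF C(1,2), of z] tub_in_\<Sigma>[OF C(1,2), of z] tub_closed_M[OF C(1)] tub_closedI[OF C(1,2), of z] C
  by (auto simp: sheets_def)

lemma tub_closed_M_TT:
  assumes C: "C \<in> CC" and y: "y \<in> tub_closed h C" "y \<notin> TT"
  obtains x z where "x \<in> C" "norm z = 1" "y = tub h C (x, z)"
proof -
  obtain x z where xz: "x \<in> C" "norm z \<le> 1" "y = tub h C (x, z)" by (rule tub_closedE[OF C y(1)])
  then show thesis using that[of x z] tub_in_TT[OF C xz(1,2)] y(2) by auto
qed

lemma tub_closed_OFF: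
  assumes C: "C \<in> CC" and y: "y \<in> tub_closed h C" "y \<in> OFF"
  obtains x z where "x \<in> C" "norm z = 1" "z \<notin> Y_graph" "y = tub h C (x, z)"
proof -
  obtain x z where xz: "x \<in> C" "norm z = 1" "y = tub h C (x, z)"
    using tub_closed_M_TT[OF C y(1)] y(2) by (metis DiffD1 DiffD2)
  then show thesis using that[of x z] tub_in_\<Sigma>[OF C xz(1), of z] y(2) by (auto simp: sheets_def)
qed

text \<open>On the tube boundary away from \<Sigma> the angular coordinate is continuous and avoids
  \<open>Y_graph\<close>, so \<open>connected_in_arc\<close> applies to its image.\<close>

lemma connected_in_sector:
  assumes C: "C \<in> CC" and Z: "connected Z" "Z \<subseteq> tub_closed h C \<inter> OFF"
  shows "\<exists>k<3. Z \<subseteq> tub h C ` (C \<times> (circle_arc k - Y_graph))"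
proof -
  let ?f = "\<lambda>y. snd (tub_inv C y)"
  have Zxz: "\<exists>x z. x \<in> C \<and> norm z = 1 \<and> z \<notin> Y_graph \<and> y = tub h C (x, z) \<and> ?f y = z" if y: "y \<in> Z" for y
  proof -
    have "y \<in> tub_closed h C" "y \<in> OFF" using y Z by blast+
    then obtain x z where "x \<in> C" "norm z = 1" "z \<notin> Y_graph" "y = tub h C (x, z)"
      by (rule tub_closed_OFF[OF C])
    then show ?thesis using tub_inv[OF C, of x z] by auto
  qed
  have "continuous_on Z (tub_inv C)" using Z(2) by (intro continuous_on_subset[OF tub_cont(2)[OF C]]) auto
  then have "connected (?f ` Z)"
    by (intro connected_continuous_image Z continuous_intros)
  moreover have "?f ` Z \<subseteq> sphere 0 1 - Y_graph" using Zxz by fastforce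
  ultimately obtain k where k: "k < 3" "?f ` Z \<subseteq> circle_arc k" using connected_in_arc by metis
  have "Z \<subseteq> tub h C ` (C \<times> (circle_arc k - Y_graph))"
  proof
    fix y assume y: "y \<in> Z"
    then obtain x z where "x \<in> C" "z \<notin> Y_graph" "y = tub h C (x, z)" "?f y = z" using Zxz by blast
    moreover have "?f y \<in> circle_arc k" using k y by blast
    ultimately show "y \<in> tub h C ` (C \<times> (circle_arc k - Y_graph))" by auto
  qed
  then show ?thesis using k by blast
qed

text \<open>By the properness condition in \<open>nbhd_system\<close>, whether a point of a collar
  line is in a closed tube depends only on the foot of the line.\<close>

lemma bicol_in_tub:
  "S \<in> SS \<Longrightarrow> s \<in> S \<Longrightarrow> u \<in> {-1..1} \<Longrightarrow> w \<in> {-1..1} \<Longrightarrow> C \<in> CC \<Longrightarrow> bicol h S (s, u) \<in> tub_closed h C \<Longrightarrow>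
    bicol h S (s, w) \<in> tub_closed h C"
  using bicol_nbhd(5)[of S s u C] bicol_nbhd(5)[of S s w C] by simp

lemma segment_sgn:
  fixes u w :: real
  assumes "u \<noteq> 0" "u \<in> {-1..1}" "w \<in> closed_segment u (sgn u)"
  shows "w \<noteq> 0" "w \<in> {-1..1}" "sgn w = sgn u"
  using assms by (auto simp: closed_segment_eq_real_ivl sgn_if split: if_splits)

text \<open>This exhibits \<open>sector_part\<close> as a continuous image of a connected set. Under
  \<open>retr_RG\<close> a point moves along a collar line, which stays on the tube boundary and off
  \<Sigma>; being connected, the line cannot leave the open sector, so the arc index is
  kept.\<close>

lemma sector_part_retr:
  assumes C: "C \<in> CC" "k < 3"
  shows "sector_part C k = retr_RG ` (tub h C ` (C \<times> (circle_arc k - Y_graph)))" (is "_ = retr_RG ` ?X")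
proof (intro equalityI subsetI)
  fix y assume "y \<in> sector_part C k"
  then obtain x z where xz: "x \<in> C" "z \<in> circle_arc k" "y = tub h C (x, z)" "y \<in> RG" by (auto simp: sector_part_def)
  then have "y \<notin> SH" "y \<notin> TT" using RG_SH RG_M by auto
  then have "z \<notin> Y_graph" using tub_in_\<Sigma>[OF C(1) xz(1), of z] circle_arc_norm[OF xz(2)] xz(3) by (auto simp: sheets_def)
  then have "y \<in> ?X" using xz by auto
  then show "y \<in> retr_RG ` ?X" using retr_RG_id[OF xz(4)] by (metis imageI)
next
  fix y' assume "y' \<in> retr_RG ` ?X"
  then obtain x z where xz: "x \<in> C" "z \<in> circle_arc k" "z \<notin> Y_graph" and y': "y' = retr_RG (tub h C (x, z))" by auto
  let ?y = "tub h C (x, z)"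
  have y: "?y \<in> OFF" "?y \<in> tub_closed h C"
    using tub_in_OFF[OF C(1) xz(1) circle_arc_norm[OF xz(2)] xz(3)] tub_closedI[OF C(1) xz(1)] circle_arc_norm[OF xz(2)] by auto
  from y(1) show "y' \<in> sector_part C k"
  proof (cases rule: OFF_cases)
    case 1
    then show ?thesis using y' retr_RG_id xz by (auto simp: sector_part_def)
  next
    case (2 S s u)
    let ?Z = "(\<lambda>w. bicol h S (s, w)) ` closed_segment u (sgn u)"
    note seg = segment_sgn[OF 2(4,3)]
    have "connected ?Z"
      using seg(2) 2(2)
        by (intro connected_continuous_image continuous_on_compose2[OF bicol_cont(1)[OF 2(1)]] continuous_intros) auto
    moreover have "?Z \<subseteq> tub_closed h C \<inter> OFF"
    proof (intro subsetI IntI)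
      fix p assume "p \<in> ?Z"
      then obtain w where w: "w \<in> closed_segment u (sgn u)" "p = bicol h S (s, w)" by blast
      show "p \<in> OFF" unfolding w(2) by (rule bicol_in_OFF[OF 2(1,2) seg(2,1)[OF w(1)]])
      show "p \<in> tub_closed h C"
        unfolding w(2) by (rule bicol_in_tub[OF 2(1-3) seg(2)[OF w(1)] C(1) y(2)[unfolded 2(6)]])
    qed
    ultimately obtain j where j: "j < 3" "?Z \<subseteq> tub h C ` (C \<times> (circle_arc j - Y_graph))"
      using connected_in_sector[OF C(1)] by metis
    have "?y \<in> ?Z" using 2(6) by auto
    then have "?y \<in> tub h C ` (C \<times> (circle_arc j - Y_graph))" using j(2) by blast
    then obtain x1 z1 where x1: "x1 \<in> C" "z1 \<in> circle_arc j" "?y = tub h C (x1, z1)" by auto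
    then have "z = z1" using tub_inj[OF C(1) xz(1) _ x1(1), of z z1] circle_arc_norm xz(2) x1(2) by auto
    then have "j = k" using arc_unique[OF xz(3) _ xz(2) j(1) C(2)] x1(2) by simp
    have "y' = bicol h S (s, sgn u)" using y' 2(6) retr_RG_bicol[OF 2(1-4)] by simp
    then have "y' \<in> ?Z" by auto
    then have "y' \<in> tub h C ` (C \<times> circle_arc k)" using j(2) \<open>j = k\<close> by blast
    moreover have "y' \<in> RG" using y' retr_RG_in[OF y(1)] by simp
    ultimately show ?thesis by (simp add: sector_part_def)
  qed
qed

text \<open>Otherwise a single collar would cover the whole arc, and the surface coordinate along the arc,
  which runs in the three rays, would have to jump from one ray to the next.\<close>

lemma arc_meets_RG:
  assumes C: "C \<in> CC" "k < 3" "x \<in> C"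
  shows "\<exists>z\<in>circle_arc k. tub h C (x, z) \<in> RG"
proof (rule ccontr)
  assume no: "\<not> ?thesis"
  let ?A = "(\<lambda>z. tub h C (x, z)) ` circle_arc k"
  have A_closed: "?A \<subseteq> tub_closed h C" using tub_closedI[OF C(1,3)] circle_arc_norm by auto
  have A_M: "?A \<subseteq> M - TT"
  proof
    fix y assume "y \<in> ?A"
    then obtain z where "z \<in> circle_arc k" "y = tub h C (x, z)" by blast
    then show "y \<in> M - TT" using tub_in_TT[OF C(1,3), of z] circle_arc_norm[of z k] A_closed tub_closed_M[OF C(1)] by auto
  qed
  have conn: "connected ?A"
    using C(3) circle_arc_norm
    by (intro connected_continuous_image connected_arc continuous_on_compose2[OF tub_cont(1)[OF C(1)]] continuous_intros) force+
  have cover: "?A \<subseteq> (\<Union>S\<in>SS. bicol_open h S)" using A_M no by (auto simp: regions_def)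
  let ?y0 = "tub h C (x, ray k)" and ?y1 = "tub h C (x, ray (Suc k))"
  have y01: "?y0 \<in> ?A" "?y1 \<in> ?A" using ray_in_arc by auto
  then obtain S where S: "S \<in> SS" "?y0 \<in> bicol_open h S" using cover by blast
  \<comment> \<open>The arc is connected and covered by disjoint open bicollars, so one of them
    contains it.\<close>
  have "?A \<subseteq> bicol_open h S"
  proof -
    let ?U = "bicol_open h S" and ?V = "\<Union>S'\<in>SS - {S}. bicol_open h S'"
    have "openin (top_of_set (M - TT)) ?U" "openin (top_of_set (M - TT)) ?V"
      using bicol_nbhd(3) S by (auto intro!: openin_Union)
    then obtain U V where UV: "open U" "open V" "?U = (M - TT) \<inter> U" "?V = (M - TT) \<inter> V"
      unfolding openin_open by auto
    have disj: "?U \<inter> ?V = {}" using bicol_closed_unique[OF S(1)] bicol_open_closed S(1) by blast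
    have UA: "y \<in> U \<longleftrightarrow> y \<in> ?U" "y \<in> V \<longleftrightarrow> y \<in> ?V" if "y \<in> ?A" for y
    proof -
      have "y \<in> M - TT" using A_M that by (rule subsetD)
      then show "y \<in> U \<longleftrightarrow> y \<in> ?U" "y \<in> V \<longleftrightarrow> y \<in> ?V" unfolding UV(3,4) by simp_all
    qed
    have AU: "?A \<subseteq> U \<union> V"
    proof
      fix y assume y: "y \<in> ?A"
      then obtain S' where "S' \<in> SS" "y \<in> bicol_open h S'" using subsetD[OF cover] by blast
      then show "y \<in> U \<union> V" using UA[OF y] by (cases "S' = S") auto
    qed
    moreover have "U \<inter> V \<inter> ?A = {}"
    proof (rule equals0I)
      fix y assume "y \<in> U \<inter> V \<inter> ?A"
      then have "y \<in> ?U \<inter> ?V" using UA[of y] by (simp only: Int_iff)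
      then show False using disj by (simp only: empty_iff)
    qed
    ultimately have "U \<inter> ?A = {} \<or> V \<inter> ?A = {}" using connectedD[OF conn UV(1,2)] by blast
    moreover have "?y0 \<in> U \<inter> ?A" using S(2) y01 UA[of ?y0] by (simp only: Int_iff)
    ultimately have "V \<inter> ?A = {}" by (metis empty_iff)
    show ?thesis
    proof
      fix y assume y: "y \<in> ?A"
      then have "y \<in> U" using AU \<open>V \<inter> ?A = {}\<close> by (metis IntI UnE empty_iff subsetD)
      then show "y \<in> ?U" using UA[OF y] by simp
    qed
  qed
  then have A_bicol: "?A \<subseteq> bicol_closed h S" using bicol_open_closed[OF S(1)] by blast
  \<comment> \<open>The angular coordinate of the foot in \<open>S\<close> of the collar line
    through \<open>y\<close>. Feet lie on \<Sigma> and on the tube boundary, so only the three rays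
    occur as values, and \<open>f\<close> is constant on the connected arc.\<close>
  define f where "f y = snd (tub_inv C (fst (bicol_inv S y)))" for y
  have key: "fst (bicol_inv S y) \<in> tub_closed h C \<and> (\<exists>j<3. f y = ray j)" if y: "y \<in> ?A" for y
  proof -
    obtain s u where su: "s \<in> S" "u \<in> {-1..1}" "y = bicol h S (s, u)"
      using A_bicol y bicol_closedE[OF S(1)] by blast
    have s: "fst (bicol_inv S y) = s" using bicol_inv[OF S(1) su(1,2)] su(3) by simp
    have sC: "s \<in> tub_closed h C" using bicol_nbhd(5)[OF S(1) su(1,2) C(1)] su(3) y A_closed by auto
    have "s \<in> SH" using component_S[OF S(1)] su(1) by blast
    then have "s \<notin> TT" "s \<in> \<Sigma>" by (auto simp: sheets_def)
    then obtain x' z where xz: "x' \<in> C" "norm z = 1" "s = tub h C (x', z)"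
      using tub_closed_M_TT[OF C(1) sC] by metis
    have "z \<in> Y_graph" using tub_in_\<Sigma>[OF C(1) xz(1), of z] xz \<open>s \<in> \<Sigma>\<close> by auto
    moreover have "f y = z" using xz tub_inv[OF C(1) xz(1), of z] s by (simp add: f_def)
    ultimately show ?thesis using Y_graph_sphere[of z] xz sC s by auto
  qed
  have "continuous_on ?A f"
    unfolding f_def
    by (intro continuous_intros continuous_on_compose2[OF tub_cont(2)[OF C(1)]]
        continuous_on_subset[OF bicol_cont(2)[OF S(1)] A_bicol]) (use key in blast)
  moreover have "f ` ?A \<subseteq> ray ` {..<3}" using key by fastforce
  then have "finite (f ` ?A)" using finite_surj by blast
  ultimately have "f constant_on ?A" using continuous_finite_range_constant[OF conn] by blast
  then have const: "f ?y0 = f ?y1" using y01 unfolding constant_on_def by metis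
  have "f (tub h C (x, ray j)) = ray j" if j: "j < 3 \<or> j = Suc k" "tub h C (x, ray j) \<in> ?A" for j
  proof -
    have "ray j \<in> Y_graph"
    proof (cases "j < 3")
      case False
      then have "j = 3" using j(1) C(2) by auto
      then show ?thesis using ray_3 ray_in_Y_graph[of 0] by simp
    qed (rule ray_in_Y_graph)
    then have "tub h C (x, ray j) \<in> SH"
      using tub_in_\<Sigma>[OF C(1,3), of "ray j"] tub_in_TT[OF C(1,3), of "ray j"] by (simp add: sheets_def)
    then have "tub h C (x, ray j) \<in> S" using SH_bicol[OF S(1)] A_bicol j(2) by blast
    then have "bicol_inv S (tub h C (x, ray j)) = (tub h C (x, ray j), 0)"
      using bicol_inv[OF S(1), of "tub h C (x, ray j)" 0] bicol_base[OF S(1)] by simp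
    then show ?thesis using tub_inv[OF C(1,3), of "ray j"] by (simp add: f_def)
  qed
  then have "f ?y0 = ray k" "f ?y1 = ray (Suc k)" using y01 C(2) by blast+
  then show False using const ray_Suc_neq[OF C(2)] by simp
qed

lemma sector_component:
  assumes C: "C \<in> CC" "k < 3" and N: "N \<in> components RG" "sector_part C k \<inter> N \<noteq> {}"
  shows "tcell (Sector C k) = Region N" "sector_part C k \<subseteq> N"
proof -
  let ?X = "tub h C ` (C \<times> (circle_arc k - Y_graph))"
  have "connected ?X"
    using circle_arc_norm by (intro connected_tub_image[OF C(1)] connected_open_arc[OF C(2)]) auto
  moreover have "?X \<subseteq> OFF" using tub_in_OFF[OF C(1)] circle_arc_norm by auto
  ultimately have "connected (retr_RG ` ?X)"
    by (metis connected_continuous_image continuous_on_subset retr_RG_cont)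
  then have "connected (sector_part C k)" using sector_part_retr[OF C] by simp
  moreover have "sector_part C k \<subseteq> RG" by (auto simp: sector_part_def)
  ultimately show "tcell (Sector C k) = Region N" "sector_part C k \<subseteq> N"
    using the_component[OF _ _ N] sector_part_eq[of C k] by simp_all
qed

lemma sector_ex:
  assumes C: "C \<in> CC" "k < 3"
  obtains N where "N \<in> components RG" "tcell (Sector C k) = Region N" "sector_part C k \<subseteq> N"
proof -
  obtain x where "x \<in> C" using component_C[OF C(1)] by blast
  then have "sector_part C k \<noteq> {}" using arc_meets_RG[OF C] by (auto simp: sector_part_def)
  moreover have "sector_part C k \<subseteq> RG" by (auto simp: sector_part_def)
  ultimately obtain N where "N \<in> components RG" "sector_part C k \<inter> N \<noteq> {}"
    using component_meeting by metis
  then show thesis using that sector_component[OF C] by blast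
qed

section \<open>Strands and composable pairs\<close>

lemma init_cell_in: "a \<in> arcs \<Longrightarrow> init_cell a \<in> cells"
  by (erule edges_cases) (auto simp: cellsI)

lemma term_cell_in: "a \<in> arcs \<Longrightarrow> tcell a \<in> cells"
proof (erule edges_cases)
  fix C k assume a: "a = Prong C k" "C \<in> CC" "k < 3"
  then show "tcell a \<in> cells" using prong_ex[OF a(2,3)] cellsI(2) by metis
next
  fix C k assume a: "a = Sector C k" "C \<in> CC" "k < 3"
  then show "tcell a \<in> cells" using sector_ex[OF a(2,3)] cellsI(3) by metis
next
  fix S e assume a: "a = Side S e" "S \<in> SS" "e \<in> {1, -1}"
  then show "tcell a \<in> cells" using side_ex[OF a(2,3)] cellsI(3) by metis
qed

lemma cone_at_subset: "C \<in> CC \<Longrightarrow> cone_at h C A \<subseteq> tub_closed h C"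
  unfolding cone_at_def using tub_closedI norm_scale by (auto simp: norm_mult)

lemma cone_atI: "x \<in> C \<Longrightarrow> norm z = 1 \<Longrightarrow> tub h C (x, z) \<in> A \<Longrightarrow> 0 \<le> r \<Longrightarrow> r \<le> 1 \<Longrightarrow> tub h C (x, of_real r * z) \<in> cone_at h C A"
  unfolding cone_at_def by auto

lemma cone_at_base: "C \<in> CC \<Longrightarrow> x \<in> C \<Longrightarrow> norm z = 1 \<Longrightarrow> tub h C (x, z) \<in> A \<Longrightarrow> x \<in> cone_at h C A"
  using cone_atI[of x C z A 0] tub_base[of C x] by simp

abbreviation "strand_of \<equiv> strand M \<Sigma> h"

lemma term_strand: "cell_set (tcell a) \<subseteq> strand_of a"
  by (cases a) auto

lemma strand_sector: "strand_of (Sector C k) = cone_at h C (sector_part C k) \<union> cell_set (tcell (Sector C k))"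
  by (simp only: strand.simps sector_part_eq)

text \<open>In the sector case \<open>arc_meets_RG\<close> provides, for each point of
  \<open>C\<close>, a point of the arc in \<open>RG\<close> over it; the radius between the two lies
  in the cone.\<close>

lemma init_strand: "a \<in> arcs \<Longrightarrow> cell_set (init_cell a) \<subseteq> strand_of a"
proof (erule edges_cases)
  fix C k assume a: "a = Prong C k" "C \<in> CC" "k < 3"
  have "C \<subseteq> cone_at h C (tub h C ` (C \<times> {ray k}))"
    using cone_at_base[OF a(2), of _ "ray k"] by auto
  then show "cell_set (init_cell a) \<subseteq> strand_of a" using a by auto
next
  fix C k assume a: "a = Sector C k" "C \<in> CC" "k < 3"
  have "C \<subseteq> cone_at h C (sector_part C k)"
  proof
    fix x assume x: "x \<in> C"
    then obtain z where z: "z \<in> circle_arc k" "tub h C (x, z) \<in> RG" using arc_meets_RG[OF a(2,3)] by blast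
    then show "x \<in> cone_at h C (sector_part C k)"
      using x by (intro cone_at_base[OF a(2) x circle_arc_norm[OF z(1)]]) (auto simp: sector_part_def)
  qed
  then show "cell_set (init_cell a) \<subseteq> strand_of a" unfolding a(1) strand_sector by auto
next
  fix S e assume a: "a = Side S e" "S \<in> SS" "e \<in> {1, -1}"
  have "S \<subseteq> bicol h S ` (S \<times> closed_segment 0 e)"
  proof
    fix s assume s: "s \<in> S"
    have "bicol h S (s, 0) \<in> bicol h S ` (S \<times> closed_segment 0 e)" using s by (intro imageI) simp
    then show "s \<in> bicol h S ` (S \<times> closed_segment 0 e)" using bicol_base[OF a(2) s] by simp
  qed
  then show "cell_set (init_cell a) \<subseteq> strand_of a" using a by auto
qed

lemma side_segment: "e \<in> {1, -1} \<Longrightarrow> closed_segment 0 e \<subseteq> {-1..1::real}"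
  by (auto simp: closed_segment_eq_real_ivl split: if_splits)

lemma strand_M: "a \<in> arcs \<Longrightarrow> strand_of a \<subseteq> M"
proof -
  assume a: "a \<in> arcs"
  have t: "cell_set (tcell a) \<subseteq> M" using cell_M[OF term_cell_in[OF a]] .
  from a show ?thesis
  proof (cases rule: edges_cases)
    case (1 C k)
    then show ?thesis using t cone_at_subset tub_closed_M by (simp only: strand.simps) blast
  next
    case (2 C k)
    then show ?thesis using t cone_at_subset tub_closed_M by (simp only: strand.simps) blast
  next
    case (3 S e)
    have "bicol h S ` (S \<times> closed_segment 0 e) \<subseteq> bicol_closed h S"
      unfolding bicol_closed_def using side_segment[OF 3(3)] by (intro image_mono Sigma_mono) auto
    then show ?thesis using t bicol_nbhd(2)[OF 3(2)] 3(1) by (simp only: strand.simps) blast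
  qed
qed

text \<open>Pushing the prong to side \<open>e\<close> gives a connected set on the tube boundary
  and off \<Sigma>, hence in a single sector \<open>j\<close>; this is the index chosen in
  \<open>comp_edge\<close>. The pushed set also lies in the region on side \<open>e\<close>, so the
  sector leads to that region, i.e. t(ab) = t(a).\<close>

lemma comp_edge_sector:
  assumes C: "C \<in> CC" "k < 3" and S: "S \<in> SS" "e \<in> {1, -1}" and t: "tcell (Prong C k) = Sheet S"
  shows "\<exists>j<3. comp_edge h (Side S e) (Prong C k) = Sector C j \<and> tcell (Sector C j) = tcell (Side S e)"
proof -
  have ray_S: "tub h C ` (C \<times> {ray k}) \<subseteq> S" using prong_ex[OF C] t by (metis cell.inject(2))
  let ?Z = "bicol h S ` (tub h C ` (C \<times> {ray k}) \<times> {e})"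
  have e: "e \<in> {-1..1}" "e \<noteq> 0" using S(2) by auto
  have "connected (tub h C ` (C \<times> {ray k}))" using connected_tub_image[OF C(1), of "{ray k}"] by simp
  then have "connected (tub h C ` (C \<times> {ray k}) \<times> {e})" by (intro connected_Times) auto
  moreover have "tub h C ` (C \<times> {ray k}) \<times> {e} \<subseteq> S \<times> {-1..1}" using ray_S e by auto
  ultimately have conn: "connected ?Z"
    by (metis connected_continuous_image continuous_on_subset bicol_cont(1)[OF S(1)])
  have ne: "?Z \<noteq> {}" using component_C[OF C(1)] by auto
  have Z_OFF: "?Z \<subseteq> OFF" using bicol_in_OFF[OF S(1) _ e] ray_S by auto
  have "?Z \<subseteq> tub_closed h C"
  proof
    fix y assume "y \<in> ?Z"
    then obtain x where x: "x \<in> C" "y = bicol h S (tub h C (x, ray k), e)" by auto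
    have "tub h C (x, ray k) \<in> S" using ray_S x by auto
    then show "y \<in> tub_closed h C" 
      using bicol_nbhd(5)[OF S(1) _ e(1) C(1)] tub_closedI[OF C(1) x(1), of "ray k"] x(2) by simp
  qed
  then have "?Z \<subseteq> tub_closed h C \<inter> OFF" using Z_OFF by (rule Int_greatest)
  then obtain j where j: "j < 3" "?Z \<subseteq> tub h C ` (C \<times> (circle_arc j - Y_graph))"
    using connected_in_sector[OF C(1) conn] by metis
  have the: "(THE j. j < 3 \<and> ?Z \<subseteq> tub h C ` (C \<times> (sector j \<inter> cball 0 1))) = j"
  proof (rule the_equality)
    have "circle_arc j - Y_graph \<subseteq> sector j \<inter> cball 0 1" by (auto simp: circle_arc_def)
    then have "tub h C ` (C \<times> (circle_arc j - Y_graph)) \<subseteq> tub h C ` (C \<times> (sector j \<inter> cball 0 1))"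
      by (intro image_mono Sigma_mono) auto
    then show "j < 3 \<and> ?Z \<subseteq> tub h C ` (C \<times> (sector j \<inter> cball 0 1))" using j by (meson order_trans)
    fix i assume i: "i < 3 \<and> ?Z \<subseteq> tub h C ` (C \<times> (sector i \<inter> cball 0 1))"
    obtain y where y: "y \<in> ?Z" using ne by (metis all_not_in_conv)
    have "y \<in> tub h C ` (C \<times> (circle_arc j - Y_graph))" by (rule subsetD[OF j(2) y])
    then obtain x z where xz: "x \<in> C" "z \<in> circle_arc j" "z \<notin> Y_graph" "y = tub h C (x, z)" by auto
    have "y \<in> tub h C ` (C \<times> (sector i \<inter> cball 0 1))" by (rule subsetD[OF conjunct2[OF i] y])
    then obtain x' z' where xz': "x' \<in> C" "z' \<in> sector i" "norm z' \<le> 1" "y = tub h C (x', z')" by auto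
    have "z = z'" using tub_inj[OF C(1) xz(1) _ xz'(1,3), of z] circle_arc_norm[OF xz(2)] xz(4) xz'(4) by simp
    then have "z \<in> circle_arc i" using xz' circle_arc_norm[OF xz(2)] by (simp add: circle_arc_def)
    then show "i = j" using arc_unique[OF xz(3) _ xz(2) _ j(1)] i by blast
  qed
  obtain N where N: "N \<in> components RG" "tcell (Side S e) = Region N" "bicol h S ` (S \<times> {e}) \<subseteq> N"
    by (rule side_ex[OF S])
  have "?Z \<subseteq> bicol h S ` (S \<times> {e})" using ray_S by (intro image_mono Sigma_mono) auto
  then have "?Z \<subseteq> N" using N(3) by (rule order_trans)
  moreover have "?Z \<subseteq> sector_part C j"
  proof
    fix y assume y: "y \<in> ?Z"
    have "y \<in> RG" using subsetD[OF \<open>?Z \<subseteq> N\<close> y] component_N[OF N(1)] by (metis subsetD)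
    moreover have "y \<in> tub h C ` (C \<times> circle_arc j)" using subsetD[OF j(2) y] by auto
    ultimately show "y \<in> sector_part C j" by (simp add: sector_part_def)
  qed
  ultimately have "sector_part C j \<inter> N \<noteq> {}" using ne by (metis Int_greatest subset_empty)
  then have "tcell (Sector C j) = Region N" by (rule sector_component[OF C(1) j(1) N(1)])
  then show ?thesis using j(1) N(2) the by (intro exI[of _ j]) simp
qed

text \<open>Edges start at branches or sheets and end at sheets or regions, so the middle cell of a
  composable pair is a sheet.\<close>

lemma composable_cases:
  assumes "composable (tbs_scwol M \<Sigma> h) a b"
  obtains C k S e where "a = Side S e" "b = Prong C k" "C \<in> CC" "k < 3" "S \<in> SS" "e \<in> {1, -1}"
    "tcell (Prong C k) = Sheet S"
proof -
  have ab: "a \<in> arcs" "b \<in> arcs" "init_cell a = tcell b"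
    using assms by (auto simp: composable_def tbs_scwol_def)
  from ab(2) show thesis
  proof (cases rule: edges_cases)
    case (1 C k)
    obtain S where S: "S \<in> SS" "tcell b = Sheet S" using prong_ex[OF 1(2,3)] 1(1) by metis
    from ab(1) show thesis
    proof (cases rule: edges_cases)
      case (3 S' e)
      then show thesis using that[of S' e C k] ab(3) S 1 by auto
    qed (use ab(3) S in auto)
  next
    case (2 C k)
    obtain N where "tcell b = Region N" using sector_ex[OF 2(2,3)] 2(1) by metis
    then show thesis using ab(3) by (cases a) auto
  next
    case (3 S e)
    obtain N where "tcell b = Region N" using side_ex[OF 3(2,3)] 3(1) by metis
    then show thesis using ab(3) by (cases a) auto
  qed
qed

end

section \<open>Where the neighbourhoods meet\<close>

context tribranched_nbhds
begin

text \<open>The point \<open>y\<close> slides to \<open>w\<close> inside both hoods, and from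
  \<open>w\<close> each cell is reached inside its own hood along the strand. The two continuations
  together cross the strand of \<open>a\<close>, while each alone remains in a hood; this is how
  \<open>values_change\<close> compares them.\<close>

definition meets :: "'a edge \<Rightarrow> 'a \<Rightarrow> bool" where
  "meets a y \<longleftrightarrow> (\<exists>w. path_component (hood (init_cell a) \<inter> hood (tcell a)) y w \<and>
     (\<exists>b\<in>cell_set (init_cell a). path_component (hood (init_cell a) \<inter> strand_of a) w b) \<and>
     (\<exists>b\<in>cell_set (tcell a). path_component (hood (tcell a) \<inter> strand_of a) w b))"

lemma bicol_path:
  assumes "S \<in> SS" "s \<in> S" "closed_segment a b \<subseteq> {-1..1}"
    and "\<And>w. w \<in> closed_segment a b \<Longrightarrow> bicol h S (s, w) \<in> Z"
  shows "path_component Z (bicol h S (s, a)) (bicol h S (s, b))"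
  by (rule path_component_segment[OF bicol_cont(1)[OF assms(1)] assms(2,3,4)])

lemma radial_path:
  assumes C: "C \<in> CC" "x \<in> C" "norm z = 1" and ab: "a \<in> {0..1}" "b \<in> {0..1}"
    and Z: "\<And>c. c \<in> closed_segment a b \<Longrightarrow> tub h C (x, of_real c * z) \<in> Z"
  shows "path_component Z (tub h C (x, of_real a * z)) (tub h C (x, of_real b * z))"
proof -
  have "continuous_on (C \<times> {0..1::real}) (\<lambda>p. tub h C (fst p, of_real (snd p) * z))"
    using C(3) by (intro continuous_on_compose2[OF tub_cont(1)[OF C(1)]] continuous_intros) (auto simp: norm_mult)
  moreover have "closed_segment a b \<subseteq> {0..1}" using ab by (simp add: closed_segment_subset)
  ultimately show ?thesis
    using path_component_segment[of C "{0..1}" "\<lambda>p. tub h C (fst p, of_real (snd p) * z)" x a b Z] C(2) Z by simp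
qed

lemma tub_scaled:
  assumes C: "C \<in> CC" "x \<in> C" "norm z = 1" and c: "0 < c" "c \<le> 1"
  shows "tub h C (x, of_real c * z) \<in> M - BS" "rho (tub h C (x, of_real c * z)) = tub h C (x, z)"
proof -
  have n: "norm (of_real c * z) \<le> 1" "of_real c * z \<noteq> 0" using C c by (auto simp: norm_mult)
  show "tub h C (x, of_real c * z) \<in> M - BS"
    using tub_in_BS[OF C(1,2) n(1)] n(2) tub_closed_M[OF C(1)] tub_closedI[OF C(1,2) n(1)] by blast
  show "rho (tub h C (x, of_real c * z)) = tub h C (x, z)" by (rule rho_tub[OF C c])
qed

text \<open>Hoods of sheets and regions are defined through \<open>rho\<close>, hence contain a
  radius without its core point entirely or not at all.\<close>

lemma tub_hood_iff:
  assumes C: "C \<in> CC" "x \<in> C" "norm z = 1" and c: "0 < c" "c \<le> 1"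
  shows "tub h C (x, of_real c * z) \<in> hood (Sheet S) \<longleftrightarrow> tub h C (x, z) \<in> hood (Sheet S)"
    "tub h C (x, of_real c * z) \<in> hood (Region N) \<longleftrightarrow> tub h C (x, z) \<in> hood (Region N)"
  using tub_scaled[OF C c] tub_scaled[OF C, of 1] by simp_all

text \<open>A slide along the tube boundary is copied at radius \<open>r\<close>. The copy is in the
  open tube because \<open>r < 1\<close>, and in the same sheet or region hood because
  \<open>0 < r\<close>.\<close>

lemma shrink_path:
  assumes C: "C \<in> CC" and r: "0 < r" "r < 1" and pq: "path_component Z p q"
    and Z: "Z \<subseteq> tub_closed h C" "Z \<inter> TT = {}" "Z \<subseteq> hood v" and v: "v = Sheet S \<or> v = Region N"
  shows "path_component (hood (Branch C) \<inter> hood v) (tub_shrink C (r, p)) (tub_shrink C (r, q))"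
proof (rule path_component_image[OF pq])
  show "continuous_on Z (\<lambda>y. tub_shrink C (r, y))"
    using Z(1) r by (intro continuous_on_compose2[OF tub_shrink_cont[OF C]] continuous_intros) auto
  show "(\<lambda>y. tub_shrink C (r, y)) ` Z \<subseteq> hood (Branch C) \<inter> hood v"
  proof (intro image_subsetI)
    fix y assume y: "y \<in> Z"
    then have "y \<in> tub_closed h C" "y \<notin> TT" using Z by auto
    then obtain x z where xz: "x \<in> C" "norm z = 1" "y = tub h C (x, z)" using tub_closed_M_TT[OF C] by metis
    have "tub_shrink C (r, y) = tub h C (x, of_real r * z)" using tub_shrink[OF C xz(1), of z r] xz by simp
    moreover have "tub h C (x, of_real r * z) \<in> tub_open h C"
      using tub_in_open[OF C xz(1), of "of_real r * z"] xz(2) r by (simp add: norm_mult)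
    moreover have "tub h C (x, of_real r * z) \<in> hood v"
      using tub_hood_iff[OF C xz(1,2) r(1) less_imp_le[OF r(2)]] Z(3) y v xz(3) by auto
    ultimately show "tub_shrink C (r, y) \<in> hood (Branch C) \<inter> hood v" by simp
  qed
qed

text \<open>With \<open>r\<close> strictly between 0 and 1, the radius inwards to the core stays in
  the open tube, and the radius outwards to the tube boundary avoids the core.\<close>

lemma radial_ends:
  assumes C: "C \<in> CC" "x \<in> C" "norm z = 1" and r: "0 < r" "r < 1"
    and A: "tub h C (x, z) \<in> A" "tub h C (x, z) \<in> hood v" and v: "v = Sheet S \<or> v = Region N"
  shows "path_component (tub_open h C \<inter> cone_at h C A) (tub h C (x, of_real r * z)) x"
    "path_component (hood v \<inter> cone_at h C A) (tub h C (x, of_real r * z)) (tub h C (x, z))"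
proof -
  have cone: "tub h C (x, of_real c * z) \<in> cone_at h C A" if "c \<in> {0..1}" for c
    using that by (intro cone_atI[OF C(2,3) A(1)]) auto
  have "path_component (tub_open h C \<inter> cone_at h C A) (tub h C (x, of_real r * z)) (tub h C (x, of_real 0 * z))"
  proof (rule radial_path[OF C])
    fix c assume "c \<in> closed_segment r 0"
    then have c: "0 \<le> c" "c < 1" using r by (auto simp: closed_segment_eq_real_ivl)
    then have "norm (of_real c * z) < 1" using C(3) by (simp add: norm_mult)
    then have "tub h C (x, of_real c * z) \<in> tub_open h C"
      using tub_in_open[OF C(1,2), of "of_real c * z"] by simp
    then show "tub h C (x, of_real c * z) \<in> tub_open h C \<inter> cone_at h C A" using cone[of c] c by simp
  qed (use r in auto)
  then show "path_component (tub_open h C \<inter> cone_at h C A) (tub h C (x, of_real r * z)) x"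
    using tub_base[OF C(1,2)] by simp
  have "path_component (hood v \<inter> cone_at h C A) (tub h C (x, of_real r * z)) (tub h C (x, of_real 1 * z))"
  proof (rule radial_path[OF C])
    fix c assume "c \<in> closed_segment r 1"
    then have c: "0 < c" "c \<le> 1" using r by (auto simp: closed_segment_eq_real_ivl)
    then have "tub h C (x, of_real c * z) \<in> hood v" using tub_hood_iff[OF C c] A(2) v by auto
    then show "tub h C (x, of_real c * z) \<in> hood v \<inter> cone_at h C A" using cone[of c] c by simp
  qed (use r in auto)
  then show "path_component (hood v \<inter> cone_at h C A) (tub h C (x, of_real r * z)) (tub h C (x, z))"
    by simp
qed

lemma tub_open_polar:
  assumes C: "C \<in> CC" and y: "y \<in> tub_open h C" "y \<in> M - BS"
  obtains x z r where "x \<in> C" "norm z = 1" "0 < r" "r < 1" "y = tub h C (x, of_real r * z)" "rho y = tub h C (x, z)"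
proof -
  obtain x z0 where xz: "x \<in> C" "norm z0 < 1" "y = tub h C (x, z0)" using y(1) unfolding tub_open_def by auto
  then have "z0 \<noteq> 0" using tub_in_BS[OF C xz(1), of z0] y(2) by auto
  then obtain r z where rz: "0 < r" "r \<le> 1" "norm z = 1" "z0 = of_real r * z" "r = norm z0"
    using polar[of z0] xz(2) by (metis less_imp_le zero_less_norm_iff)
  show thesis
  proof (rule that[OF xz(1) rz(3,1)])
    show "r < 1" using rz(5) xz(2) by metis
    show "y = tub h C (x, of_real r * z)" using xz(3) rz(4) by metis
    then show "rho y = tub h C (x, z)" using rho_tub[OF C xz(1) rz(3,1,2)] by metis
  qed
qed

text \<open>The radial projection of \<open>y\<close> lies in the bicollar of \<open>S\<close>;
  sliding down the collar line ends at a point \<open>s\<close> of \<open>S\<close> on the tube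
  boundary, and the ray through \<open>s\<close> is the prong. The slide is repeated at the radius
  of \<open>y\<close> so as to stay in the open tube.\<close>

lemma meets_prong:
  assumes C: "C \<in> CC" and S: "S \<in> SS" and y: "y \<in> hood (Branch C)" "y \<in> hood (Sheet S)"
  shows "\<exists>k<3. tcell (Prong C k) = Sheet S \<and> meets (Prong C k) y"
proof -
  obtain x z r where xz: "x \<in> C" "norm z = 1" and r: "0 < r" "r < 1"
    and yr: "y = tub h C (x, of_real r * z)" "rho y = tub h C (x, z)"
    using tub_open_polar[OF C, of y] y by auto
  let ?q = "tub h C (x, z)"
  have q: "?q \<in> bicol_open h S" "?q \<in> tub_closed h C" using y(2) yr(2) tub_closedI[OF C xz(1)] xz(2) by auto
  then obtain s u where su: "s \<in> S" "u \<in> {-1<..<1}" "?q = bicol h S (s, u)" unfolding bicol_open_def by auto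
  let ?Z = "tub_closed h C \<inter> bicol_open h S"
  have seg: "w \<in> {-1<..<1}" if "w \<in> closed_segment u 0" for w
    using that su(2) by (auto simp: closed_segment_eq_real_ivl split: if_splits)
  have inZ: "bicol h S (s, w) \<in> ?Z" if w: "w \<in> closed_segment u 0" for w
  proof -
    have "w \<in> {-1<..<1}" by (rule seg[OF w])
    then have "w \<in> {-1..1}" "\<bar>w\<bar> < 1" by auto
    then show ?thesis
      using bicol_in_open_same[OF S su(1)] bicol_in_tub[OF S su(1) _ _ C, of u w] su(2,3) q(2) by auto
  qed
  have "path_component ?Z (bicol h S (s, u)) (bicol h S (s, 0))"
  proof (rule bicol_path[OF S su(1) _ inZ])
    show "closed_segment u 0 \<subseteq> {-1..1}" using seg by fastforce
  qed
  then have qs: "path_component ?Z ?q s" using su(3) bicol_base[OF S su(1)] by simp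
  have s: "s \<in> tub_closed h C" "s \<in> SH" using path_component_mem[OF qs] component_S[OF S] su(1) by auto
  then obtain x' z' where x': "x' \<in> C" "norm z' = 1" "s = tub h C (x', z')"
    using tub_closed_M_TT[OF C s(1)] SH_M by blast
  have "s \<in> \<Sigma>" using s(2) by (simp add: sheets_def)
  then have "z' \<in> Y_graph" using tub_in_\<Sigma>[OF C x'(1), of z'] x' by simp
  then obtain k where k: "k < 3" "z' = ray k" using Y_graph_sphere x'(2) by blast
  have sA: "s \<in> tub h C ` (C \<times> {ray k})" using x' k by auto
  have t: "tcell (Prong C k) = Sheet S" by (rule prong_component(1)[OF C k(1) S]) (use sA su(1) in blast)
  have Z: "?Z \<subseteq> tub_closed h C" "?Z \<inter> TT = {}" "?Z \<subseteq> hood (Sheet S)"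
    using bicol_open_hood[OF S] bicol_nbhd(2)[OF S] bicol_open_closed[OF S] by blast+
  have "path_component (hood (Branch C) \<inter> hood (Sheet S)) (tub_shrink C (r, ?q)) (tub_shrink C (r, s))"
    by (rule shrink_path[OF C r qs Z]) simp
  then have 1: "path_component (hood (Branch C) \<inter> hood (Sheet S)) y (tub h C (x', of_real r * z'))"
    using tub_shrink[OF C xz(1), of z r] tub_shrink[OF C x'(1), of z' r] xz x' yr by simp
  have "s \<in> hood (Sheet S)" using path_component_mem(2)[OF qs] Z(3) by blast
  then have 2: "path_component (tub_open h C \<inter> cone_at h C (tub h C ` (C \<times> {ray k}))) (tub h C (x', of_real r * z')) x'"
    "path_component (hood (Sheet S) \<inter> cone_at h C (tub h C ` (C \<times> {ray k}))) (tub h C (x', of_real r * z')) s"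
    using radial_ends[OF C x'(1,2) r, of "tub h C ` (C \<times> {ray k})" "Sheet S"] sA x'(3) by simp_all
  have "meets (Prong C k) y"
    unfolding meets_def
  proof (intro exI conjI bexI)
    show "path_component (hood (init_cell (Prong C k)) \<inter> hood (tcell (Prong C k))) y (tub h C (x', of_real r * z'))"
      unfolding t using 1 by simp
    show "path_component (hood (init_cell (Prong C k)) \<inter> strand_of (Prong C k)) (tub h C (x', of_real r * z')) x'"
      by (rule path_component_of_subset[OF _ 2(1)]) auto
    show "path_component (hood (tcell (Prong C k)) \<inter> strand_of (Prong C k)) (tub h C (x', of_real r * z')) s"
      by (rule path_component_of_subset[OF _ 2(2)]) (use t in auto)
    show "x' \<in> cell_set (init_cell (Prong C k))" "s \<in> cell_set (tcell (Prong C k))"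
      unfolding t using x'(1) su(1) by simp_all
  qed
  then show ?thesis using k t by blast
qed

text \<open>As for a prong, but a collar line is followed away from the sheet, to the value of
  \<open>retr_RG\<close>; an arc containing that point gives the sector. Along the line
  \<open>retr_RG\<close> is constant, which keeps the slide in the hood of \<open>N\<close>.\<close>

lemma meets_sector:
  assumes C: "C \<in> CC" and N: "N \<in> components RG" and y: "y \<in> hood (Branch C)" "y \<in> hood (Region N)"
  shows "\<exists>k<3. tcell (Sector C k) = Region N \<and> meets (Sector C k) y"
proof -
  obtain x z r where xz: "x \<in> C" "norm z = 1" and r: "0 < r" "r < 1"
    and yr: "y = tub h C (x, of_real r * z)" "rho y = tub h C (x, z)"
    using tub_open_polar[OF C, of y] y by auto
  let ?q = "tub h C (x, z)"
  have q: "?q \<in> OFF" "retr_RG ?q \<in> N" "?q \<in> tub_closed h C"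
    using y(2) yr(2) tub_closedI[OF C xz(1)] xz(2) by auto
  let ?Z = "tub_closed h C \<inter> {p \<in> OFF. retr_RG p = retr_RG ?q}"
  have qs: "path_component ?Z ?q (retr_RG ?q)"
    using q(1)
  proof (cases rule: OFF_cases)
    case 1
    then show ?thesis using q path_component_refl[of ?q ?Z] by (simp add: retr_RG_id)
  next
    case (2 S s u)
    note seg = segment_sgn[OF 2(4,3)]
    have "path_component ?Z (bicol h S (s, u)) (bicol h S (s, sgn u))"
    proof (rule bicol_path[OF 2(1,2)])
      show "closed_segment u (sgn u) \<subseteq> {-1..1}" using seg by blast
      fix w assume w: "w \<in> closed_segment u (sgn u)"
      note sw = seg[OF w]
      have "bicol h S (s, w) \<in> tub_closed h C" using bicol_in_tub[OF 2(1-3) sw(2) C] q(3) 2(6) by simp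
      moreover have "bicol h S (s, w) \<in> OFF" by (rule bicol_in_OFF[OF 2(1,2) sw(2,1)])
      moreover have "retr_RG (bicol h S (s, w)) = retr_RG ?q"
        unfolding 2(6) using retr_RG_bicol[OF 2(1,2) sw(2,1)] retr_RG_bicol[OF 2(1-4)] sw(3) by simp
      ultimately show "bicol h S (s, w) \<in> ?Z" by blast
    qed
    then show ?thesis unfolding 2(6) retr_RG_bicol[OF 2(1-4)] .
  qed
  let ?s = "retr_RG ?q"
  have s: "?s \<in> tub_closed h C" "?s \<in> OFF" "?s \<in> RG" using path_component_mem(2)[OF qs] retr_RG_in[OF q(1)] by auto
  obtain x' z' where x': "x' \<in> C" "norm z' = 1" "?s = tub h C (x', z')"
    using tub_closed_M_TT[OF C s(1)] s(2) by blast
  obtain k where k: "k < 3" "z' \<in> circle_arc k" using sphere_arc[OF x'(2)] by blast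
  have sA: "?s \<in> sector_part C k" using x' k s(3) by (auto simp: sector_part_def)
  have t: "tcell (Sector C k) = Region N" by (rule sector_component(1)[OF C k(1) N]) (use sA q(2) in blast)
  have Z: "?Z \<subseteq> tub_closed h C" "?Z \<inter> TT = {}" "?Z \<subseteq> hood (Region N)"
  proof -
    show "?Z \<subseteq> hood (Region N)"
    proof
      fix p assume "p \<in> ?Z"
      then have "p \<in> OFF" "retr_RG p \<in> N" using q(2) by auto
      then show "p \<in> hood (Region N)" by (rule OFF_hood)
    qed
  qed auto
  have "path_component (hood (Branch C) \<inter> hood (Region N)) (tub_shrink C (r, ?q)) (tub_shrink C (r, ?s))"
    by (rule shrink_path[OF C r qs Z]) simp
  then have 1: "path_component (hood (Branch C) \<inter> hood (Region N)) y (tub h C (x', of_real r * z'))"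
    using tub_shrink[OF C xz(1), of z r] tub_shrink[OF C x'(1), of z' r] xz x' yr by simp
  have "?s \<in> hood (Region N)" using path_component_mem(2)[OF qs] Z(3) by blast
  then have 2: "path_component (tub_open h C \<inter> cone_at h C (sector_part C k)) (tub h C (x', of_real r * z')) x'"
    "path_component (hood (Region N) \<inter> cone_at h C (sector_part C k)) (tub h C (x', of_real r * z')) ?s"
    using radial_ends[OF C x'(1,2) r, of "sector_part C k" "Region N"] sA unfolding x'(3) by simp_all
  have "meets (Sector C k) y"
    unfolding meets_def
  proof (intro exI conjI bexI)
    show "path_component (hood (init_cell (Sector C k)) \<inter> hood (tcell (Sector C k))) y (tub h C (x', of_real r * z'))"
      unfolding t using 1 by simp
    show "path_component (hood (init_cell (Sector C k)) \<inter> strand_of (Sector C k)) (tub h C (x', of_real r * z')) x'"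
      by (rule path_component_of_subset[OF _ 2(1)]) (simp only: strand_sector init_cell.simps hood_simps, blast)
    show "path_component (hood (tcell (Sector C k)) \<inter> strand_of (Sector C k)) (tub h C (x', of_real r * z')) ?s"
      by (rule path_component_of_subset[OF _ 2(2)]) (simp only: strand_sector t, blast)
    show "x' \<in> cell_set (init_cell (Sector C k))" "?s \<in> cell_set (tcell (Sector C k))"
      unfolding t using x'(1) q(2) by simp_all
  qed
  then show ?thesis using k t by blast
qed

text \<open>Here the slide is the radial push to \<open>rho y\<close>, which preserves both hoods.
  The sign of the collar coordinate gives the side, and the collar line through \<open>rho y\<close>
  on that side is part of the strand: inwards it ends on \<open>S\<close>, outwards in
  \<open>N\<close>.\<close>

lemma meets_side:
  assumes S: "S \<in> SS" and N: "N \<in> components RG" and y: "y \<in> hood (Sheet S)" "y \<in> hood (Region N)"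
  shows "\<exists>e\<in>{1, -1}. tcell (Side S e) = Region N \<and> meets (Side S e) y"
proof -
  let ?q = "rho y"
  have yM: "y \<in> M - BS" and q: "?q \<in> bicol_open h S" "?q \<in> OFF" "retr_RG ?q \<in> N" using y by auto
  then obtain s u where su: "s \<in> S" "u \<in> {-1<..<1}" "?q = bicol h S (s, u)" unfolding bicol_open_def by auto
  have u: "u \<in> {-1..1}" using su(2) by auto
  have u0: "u \<noteq> 0" using bicol_in_SH[OF S su(1) u] q(2) su(3) by auto
  define e where "e = sgn u"
  have e: "e \<in> {1, -1}" using u0 by (auto simp: e_def sgn_if)
  have retr: "retr_RG ?q = bicol h S (s, e)" unfolding su(3) e_def by (rule retr_RG_bicol[OF S su(1) u u0])
  have t: "tcell (Side S e) = Region N" by (rule side_component(1)[OF S e N]) (use retr q(3) su(1) in auto)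
  have "path (\<lambda>t. rad (t, y))"
    unfolding path_def using yM by (intro continuous_on_compose2[OF rad_cont] continuous_intros) auto
  then have 1: "path_component (hood (Sheet S) \<inter> hood (Region N)) y ?q"
    unfolding path_component_def using y rad_hood[of _ y] rad_0[OF yM]
    by (intro exI[of _ "\<lambda>t. rad (t, y)"]) (auto simp: path_image_def pathstart_def pathfinish_def rho_def simp del: hood_simps)
  have strand: "bicol h S (s, w) \<in> strand_of (Side S e)" if "w \<in> closed_segment 0 e" for w
    using that su(1) by auto
  have "path_component (hood (Sheet S) \<inter> strand_of (Side S e)) (bicol h S (s, u)) (bicol h S (s, 0))"
  proof (rule bicol_path[OF S su(1)])
    show "closed_segment u 0 \<subseteq> {-1..1}" using u by (simp add: closed_segment_subset)
    fix w assume "w \<in> closed_segment u 0"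
    then have w: "w \<in> {-1..1}" "\<bar>w\<bar> < 1" "w \<in> closed_segment 0 e"
      using su(2) e_def by (auto simp: closed_segment_eq_real_ivl sgn_if split: if_splits)
    then have "bicol h S (s, w) \<in> hood (Sheet S)"
      using bicol_in_open_same[OF S su(1) w(1)] bicol_open_hood[OF S] by blast
    then show "bicol h S (s, w) \<in> hood (Sheet S) \<inter> strand_of (Side S e)" using strand[OF w(3)] by blast
  qed
  then have 2: "path_component (hood (Sheet S) \<inter> strand_of (Side S e)) ?q s"
    using su(3) bicol_base[OF S su(1)] by simp
  note seg = segment_sgn[OF u0 u, folded e_def]
  have 3: "path_component (hood (Region N) \<inter> strand_of (Side S e)) ?q (bicol h S (s, e))"
    unfolding su(3)
  proof (rule bicol_path[OF S su(1)])
    show "closed_segment u e \<subseteq> {-1..1}" using seg by blast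
    fix w assume w: "w \<in> closed_segment u e"
    note sw = seg[OF w]
    have "bicol h S (s, w) \<in> OFF" by (rule bicol_in_OFF[OF S su(1) sw(2,1)])
    moreover have "retr_RG (bicol h S (s, w)) \<in> N"
      using retr_RG_bicol[OF S su(1) sw(2,1)] sw(3) e_def retr q(3) by simp
    ultimately have "bicol h S (s, w) \<in> hood (Region N)" by (rule OFF_hood)
    moreover have "w \<in> closed_segment 0 e"
      using w su(2) e_def by (auto simp: closed_segment_eq_real_ivl sgn_if split: if_splits)
    ultimately show "bicol h S (s, w) \<in> hood (Region N) \<inter> strand_of (Side S e)" using strand by blast
  qed
  have "meets (Side S e) y"
    unfolding meets_def
  proof (intro exI conjI bexI)
    show "path_component (hood (init_cell (Side S e)) \<inter> hood (tcell (Side S e))) y ?q"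
      unfolding t using 1 by simp
    show "path_component (hood (init_cell (Side S e)) \<inter> strand_of (Side S e)) ?q s"
      using 2 by simp
    show "path_component (hood (tcell (Side S e)) \<inter> strand_of (Side S e)) ?q (bicol h S (s, e))"
      using 3 unfolding t .
    show "s \<in> cell_set (init_cell (Side S e))" "bicol h S (s, e) \<in> cell_set (tcell (Side S e))"
      unfolding t using su(1) q(3) retr by simp_all
  qed
  then show ?thesis using e t by blast
qed

text \<open>Hoods of two different cells of the same kind are disjoint, so \<open>u\<close> and
  \<open>v\<close> have different kinds and one of the three preceding lemmas applies.\<close>

lemma meets_ex:
  assumes u: "u \<in> cells" and v: "v \<in> cells" and "u \<noteq> v" and y: "y \<in> hood u" "y \<in> hood v"
  shows "\<exists>a\<in>arcs. meets a y \<and> (init_cell a = u \<and> tcell a = v \<or> init_cell a = v \<and> tcell a = u)"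
  using u
proof (cases rule: cells_cases)
  case u1: (1 C)
  from v show ?thesis
  proof (cases rule: cells_cases)
    case v1: (1 C')
    then have "C' = C" using u1 y tub_closed_unique[of C C' y] tub_open_closed by auto
    then show ?thesis using u1 v1 \<open>u \<noteq> v\<close> by simp
  next
    case v2: (2 S)
    then show ?thesis using meets_prong[OF u1(2) v2(2), of y] u1 y edgesI(1)[OF u1(2)] by fastforce
  next
    case v3: (3 N)
    then show ?thesis using meets_sector[OF u1(2) v3(2), of y] u1 y edgesI(2)[OF u1(2)] by fastforce
  qed
next
  case u2: (2 S)
  from v show ?thesis
  proof (cases rule: cells_cases)
    case v1: (1 C)
    then show ?thesis using meets_prong[OF v1(2) u2(2), of y] u2 y edgesI(1)[OF v1(2)] by fastforce
  next
    case v2: (2 S')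
    then have "S' = S" using u2 y bicol_closed_unique[of S S' "rho y"] bicol_open_closed by auto
    then show ?thesis using u2 v2 \<open>u \<noteq> v\<close> by simp
  next
    case v3: (3 N)
    obtain e where e: "e \<in> {1, -1}" "tcell (Side S e) = Region N" "meets (Side S e) y"
      using meets_side[OF u2(2) v3(2)] y u2(1) v3(1) by metis
    then show ?thesis
      using edgesI(3)[OF u2(2) e(1)] u2(1) v3(1) by (intro bexI[of _ "Side S e"]) simp_all
  qed
next
  case u3: (3 N)
  from v show ?thesis
  proof (cases rule: cells_cases)
    case v1: (1 C)
    then show ?thesis using meets_sector[OF v1(2) u3(2), of y] u3 y edgesI(2)[OF v1(2)] by fastforce
  next
    case v2: (2 S)
    obtain e where e: "e \<in> {1, -1}" "tcell (Side S e) = Region N" "meets (Side S e) y"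
      using meets_side[OF v2(2) u3(2)] y u3(1) v2(1) by metis
    then show ?thesis
      using edgesI(3)[OF v2(2) e(1)] u3(1) v2(1) by (intro bexI[of _ "Side S e"]) simp_all
  next
    case v3: (3 N')
    then have "N' = N" using u3 y components_nonoverlap[of N RG N'] by auto
    then show ?thesis using u3 v3 \<open>u \<noteq> v\<close> by simp
  qed
qed

end

section \<open>The homomorphism to the fundamental group\<close>

lemma (in group) mult_inv_cancel:
  assumes "x \<in> carrier G" "y \<in> carrier G"
  shows "x \<otimes> (inv x \<otimes> y) = y" "inv x \<otimes> (x \<otimes> y) = y"
  using assms by (simp_all flip: m_assoc)

lemma path_from_to_subpath:
  assumes "path_from_to X a g b" "s \<in> {0..1}" "t \<in> {0..1}" "g ` closed_segment s t \<subseteq> Z"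
  shows "path_from_to Z (g s) (g \<circ> linepath s t) (g t)"
proof -
  have "closed_segment s t \<subseteq> {0..1}" using assms(2,3) by (simp add: closed_segment_subset)
  then have "continuous_on (closed_segment s t) g"
    using assms(1) continuous_on_subset by (auto simp: path_from_to_def path_def)
  moreover have "path_from_to (closed_segment s t) s (linepath s t) t" by (simp add: path_from_to_def)
  ultimately show ?thesis using path_from_to_image assms(4) by blast
qed

lemma homotopic_subpaths:
  assumes "path_from_to X a g b" "r \<in> {0..1}" "s \<in> {0..1}" "t \<in> {0..1}"
  shows "homotopic_paths X ((g \<circ> linepath r s) +++ (g \<circ> linepath s t)) (g \<circ> linepath r t)"
proof -
  have "homotopic_paths X (g \<circ> (linepath r s +++ linepath s t)) (g \<circ> linepath r t)"
    using assms
    by (intro homotopic_paths_unit_interval[of g X r _ t] path_from_to_join[OF path_from_to_linepath path_from_to_linepath]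
        path_from_to_linepath) (auto simp: path_from_to_def)
  then show ?thesis by (simp only: path_compose_join)
qed

locale tribranched_choices = tribranched_nbhds M \<Sigma> h
  for M \<Sigma> :: "'a::t2_space set" and h :: "'a tbs_nbhds" +
  fixes x0 :: 'a and P :: "'a cog_choices" and N0 :: "'a set"
  assumes N0: "N0 \<in> components (regions M \<Sigma> h)" and x0: "x0 \<in> N0"
    and choices: "valid_choices M \<Sigma> h x0 P"
begin

abbreviation "bp \<equiv> base P"
abbreviation "\<pi> \<equiv> fundamental_group M x0"
abbreviation "val u p v \<equiv> tailed M (spoke P u) p (spoke P v)"
abbreviation "GY \<equiv> tbs_cog M \<Sigma> h P"
abbreviation "\<phi> \<equiv> gen_image \<pi> (tbs_phi_vertex M P) (tbs_phi_edge M \<Sigma> h P)"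

lemma x0_M: "x0 \<in> M"
  using x0 component_N[OF N0] RG_M by blast

interpretation pi: group \<pi>
  by (rule group_fundamental_group[OF x0_M])

section \<open>The choices and the values of the generators\<close>

lemma base_in: "v \<in> cells \<Longrightarrow> bp v \<in> cell_set v"
  and spoke_path: "v \<in> cells \<Longrightarrow> path_from_to M x0 (spoke P v) (bp v)"
  using choices by (simp_all add: valid_choices_def path_from_to_def)

lemma cell_nbhd_M: "v \<in> cells \<Longrightarrow> cell_nbhd h v \<subseteq> M"
proof (erule cells_cases)
  fix C assume "v = Branch C" "C \<in> CC"
  then show "cell_nbhd h v \<subseteq> M" using tub_closed_M by simp
next
  fix S assume "v = Sheet S" "S \<in> SS"
  then show "cell_nbhd h v \<subseteq> M" using bicol_nbhd(2)[of S] by auto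
next
  fix N assume "v = Region N" "N \<in> components RG"
  then show "cell_nbhd h v \<subseteq> M" using component_N[of N] RG_M by auto
qed

lemma edge_choices:
  assumes a: "a \<in> arcs"
  shows "homotopic_paths M (link P a) (slink P a)"
    "path_from_to (strand_of a) (bp (init_cell a)) (slink P a) (bp (tcell a))"
    "path_from_to M (bp (init_cell a)) (link P a) (bp (tcell a))"
    "deformation_retraction (strand_of a) (cell_set (tcell a)) (retr P a)"
proof -
  let ?U = "cell_nbhd h (init_cell a) \<union> cell_nbhd h (tcell a)"
  have c: "path (link P a)" "path_image (link P a) \<subseteq> ?U"
    "pathstart (link P a) = bp (init_cell a)" "pathfinish (link P a) = bp (tcell a)"
    "path_image (slink P a) \<subseteq> strand_of a" "homotopic_paths ?U (link P a) (slink P a)"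
    "deformation_retraction (strand_of a) (cell_set (tcell a)) (retr P a)"
    using choices[unfolded valid_choices_def, THEN conjunct2, THEN conjunct1, THEN bspec, OF a]
    unfolding Let_def by blast+
  have U: "?U \<subseteq> M" using cell_nbhd_M init_cell_in[OF a] term_cell_in[OF a] by blast
  show "homotopic_paths M (link P a) (slink P a)" by (rule homotopic_paths_subset[OF c(6) U])
  have l: "path_from_to ?U (bp (init_cell a)) (link P a) (bp (tcell a))" using c by (simp add: path_from_to_def)
  show "path_from_to M (bp (init_cell a)) (link P a) (bp (tcell a))" by (rule path_from_to_mono[OF l U])
  show "path_from_to (strand_of a) (bp (init_cell a)) (slink P a) (bp (tcell a))"
    using homotopic_paths_path_from_to[OF c(6) l] c(5) by (simp add: path_from_to_def)
  show "deformation_retraction (strand_of a) (cell_set (tcell a)) (retr P a)" by (rule c(7))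
qed

lemma slink_M: "a \<in> arcs \<Longrightarrow> path_from_to M (bp (init_cell a)) (slink P a) (bp (tcell a))"
  by (rule path_from_to_mono[OF edge_choices(2) strand_M])

lemma GY_simps [simp]:
  "verts GY = cells" "edges GY = arcs" "ini GY = init_cell" "ter GY = tcell" "cmp GY = comp_edge h"
  "grp GY v = fundamental_group (cell_set v) (bp v)"
  "emb GY a = class_map (cell_set (tcell a)) (\<lambda>c. retr P a \<circ> (reversepath (slink P a) +++ c +++ slink P a))"
  "twist GY a b = path_class (cell_set (tcell a))
     (flag_retr P a b \<circ> (reversepath (slink P a) +++ reversepath (slink P b) +++ slink P (comp_edge h a b)))"
  "composable GY a b \<longleftrightarrow> composable (tbs_scwol M \<Sigma> h) a b"
  by (simp_all add: tbs_cog_def tbs_scwol_def composable_def scwol.defs complex_of_groups.defs)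

lemma val_carrier:
  "u \<in> cells \<Longrightarrow> v \<in> cells \<Longrightarrow> path_from_to M (bp u) p (bp v) \<Longrightarrow> val u p v \<in> carrier \<pi>"
  by (rule tailed_carrier[OF spoke_path _ spoke_path])

lemma phi_vertex:
  assumes v: "v \<in> cells" and c: "path_from_to (cell_set v) (bp v) c (bp v)"
  shows "tbs_phi_vertex M P v (path_class (cell_set v) c) = val v c v"
  unfolding tbs_phi_vertex_def tailed_def
proof (rule class_map_path_class[OF c])
  fix q assume "homotopic_paths (cell_set v) c q"
  then have q: "homotopic_paths M c q" by (rule homotopic_paths_subset[OF _ cell_M[OF v]])
  note s = spoke_path[OF v] and s' = path_from_to_rev[OF spoke_path[OF v]] and cM = path_from_to_mono[OF c cell_M[OF v]]
  show "homotopic_paths M (spoke P v +++ c +++ reversepath (spoke P v)) (spoke P v +++ q +++ reversepath (spoke P v))"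
    by (rule homotopic_paths_join_from_to[OF homotopic_paths_refl_from_to[OF s]
        homotopic_paths_join_from_to[OF q homotopic_paths_refl_from_to[OF s'] cM s'] s path_from_to_join[OF cM s']])
qed

text \<open>\<open>link\<close> and \<open>slink\<close> are homotopic in \<open>M\<close>; from
  here on the representative in the strand is used, since it is the strand that
  \<open>retr P a\<close> retracts.\<close>

lemma phi_edge: "a \<in> arcs \<Longrightarrow> tbs_phi_edge M \<Sigma> h P a = val (tcell a) (reversepath (slink P a)) (init_cell a)"
proof -
  assume a: "a \<in> arcs"
  have "tbs_phi_edge M \<Sigma> h P a = val (tcell a) (reversepath (link P a)) (init_cell a)"
    by (simp add: tbs_phi_edge_def tailed_def)
  also have "\<dots> = val (tcell a) (reversepath (slink P a)) (init_cell a)"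
    by (rule tailed_cong[OF spoke_path[OF term_cell_in[OF a]] path_from_to_rev[OF edge_choices(3)[OF a]]
        spoke_path[OF init_cell_in[OF a]] homotopic_paths_reversepath_D[OF edge_choices(1)[OF a]]])
  finally show ?thesis .
qed

lemma phi_Pos: "a \<in> arcs \<Longrightarrow> \<phi> (Pos a) = val (tcell a) (reversepath (slink P a)) (init_cell a)"
  by (simp add: phi_edge)

lemma phi_Pos_inv: "a \<in> arcs \<Longrightarrow> inv\<^bsub>\<pi>\<^esub> (\<phi> (Pos a)) = val (init_cell a) (slink P a) (tcell a)"
  using tailed_inv[OF spoke_path path_from_to_rev[OF slink_M] spoke_path, of a]
  by (simp add: phi_edge init_cell_in term_cell_in)

lemma phi_Pos_carrier: "a \<in> arcs \<Longrightarrow> \<phi> (Pos a) \<in> carrier \<pi>"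
  unfolding phi_Pos by (intro val_carrier path_from_to_rev slink_M init_cell_in term_cell_in)

lemma grp_carrierE:
  assumes "g \<in> carrier (grp GY v)"
  obtains c where "path_from_to (cell_set v) (bp v) c (bp v)" "g = path_class (cell_set v) c"
  using assms by (auto simp: fundamental_group_carrier)

lemma val_mult:
  assumes "u \<in> cells" "v \<in> cells" "w \<in> cells" "path_from_to M (bp u) p (bp v)" "path_from_to M (bp v) q (bp w)"
  shows "val u p v \<otimes>\<^bsub>\<pi>\<^esub> val v q w = val u (p +++ q) w"
  by (rule tailed_mult[OF spoke_path[OF assms(1)] assms(4) spoke_path[OF assms(2)] assms(5) spoke_path[OF assms(3)]])

lemma phi_vertex_hom: "v \<in> cells \<Longrightarrow> (\<lambda>g. \<phi> (Elt v g)) \<in> hom (grp GY v) \<pi>"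
proof (rule homI)
  fix g assume v: "v \<in> cells" and "g \<in> carrier (grp GY v)"
  then obtain c where c: "path_from_to (cell_set v) (bp v) c (bp v)" "g = path_class (cell_set v) c"
    by (elim grp_carrierE)
  show "\<phi> (Elt v g) \<in> carrier \<pi>"
    using val_carrier[OF v v path_from_to_mono[OF c(1) cell_M[OF v]]] phi_vertex[OF v c(1)] c(2) by simp
next
  fix g g' assume v: "v \<in> cells" and "g \<in> carrier (grp GY v)" "g' \<in> carrier (grp GY v)"
  then obtain c c' where c: "path_from_to (cell_set v) (bp v) c (bp v)" "g = path_class (cell_set v) c"
    and c': "path_from_to (cell_set v) (bp v) c' (bp v)" "g' = path_class (cell_set v) c'"
    by (elim grp_carrierE)
  note M = path_from_to_mono[OF _ cell_M[OF v]]
  have "g \<otimes>\<^bsub>grp GY v\<^esub> g' = path_class (cell_set v) (c +++ c')"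
    using path_class_mult[OF c(1) c'(1)] c(2) c'(2) by simp
  then have "\<phi> (Elt v (g \<otimes>\<^bsub>grp GY v\<^esub> g')) = val v (c +++ c') v"
    using phi_vertex[OF v path_from_to_join[OF c(1) c'(1)]] by simp
  then show "\<phi> (Elt v (g \<otimes>\<^bsub>grp GY v\<^esub> g')) = \<phi> (Elt v g) \<otimes>\<^bsub>\<pi>\<^esub> \<phi> (Elt v g')"
    using val_mult[OF v v v M[OF c(1)] M[OF c'(1)]] phi_vertex[OF v c(1)] phi_vertex[OF v c'(1)] c(2) c'(2) by simp
qed

lemma phi_closed: "\<phi> ` fg_gens GY \<subseteq> carrier \<pi>"
proof (intro image_subsetI)
  fix x assume "x \<in> fg_gens GY"
  then consider v g where "x = Elt v g" "v \<in> cells" "g \<in> carrier (grp GY v)"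
    | a where "x = Pos a" "a \<in> arcs" | a where "x = Neg a" "a \<in> arcs"
    unfolding fg_gens_def by auto
  then show "\<phi> x \<in> carrier \<pi>"
  proof cases
    case 1
    then show ?thesis using phi_vertex_hom[OF 1(2)] by (auto simp: hom_def simp del: gen_image.simps)
  next
    case 2
    then show ?thesis using phi_Pos_carrier by simp
  next
    case 3
    then show ?thesis using phi_Pos_carrier[OF 3(2)] by simp
  qed
qed

section \<open>The relations of \<open>FG\<close>\<close>

lemma retraction_loop_M:
  assumes "deformation_retraction X (cell_set v) r" "X \<subseteq> M" "v \<in> cells" "path_from_to X (bp v) c (bp v)"
  shows "path_from_to (cell_set v) (bp v) (r \<circ> c) (bp v)" "val v (r \<circ> c) v = val v c v"
proof -
  note l = deformation_retraction_loop[OF assms(1) base_in[OF assms(3)] assms(4)]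
  show "path_from_to (cell_set v) (bp v) (r \<circ> c) (bp v)" by (rule l(2))
  show "val v (r \<circ> c) v = val v c v"
    by (rule tailed_cong[OF spoke_path[OF assms(3)] path_from_to_mono[OF assms(4,2)] spoke_path[OF assms(3)]
        homotopic_paths_subset[OF l(1) assms(2)], symmetric])
qed

text \<open>Once the retraction is dropped, the class is that of l^-1 c l with l =
  \<open>slink P a\<close>, which factors at the base points into the values of
  \<open>Pos a\<close>, of \<open>g\<close> and of the inverse of \<open>Pos a\<close>.\<close>

lemma emb_relation:
  assumes a: "a \<in> arcs" and g: "g \<in> carrier (grp GY (init_cell a))"
  shows "\<phi> (Elt (tcell a) (emb GY a g)) = \<phi> (Pos a) \<otimes>\<^bsub>\<pi>\<^esub> (\<phi> (Elt (init_cell a) g) \<otimes>\<^bsub>\<pi>\<^esub> inv\<^bsub>\<pi>\<^esub> (\<phi> (Pos a)))"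
proof -
  let ?u = "init_cell a" and ?v = "tcell a" and ?l = "slink P a" and ?X = "strand_of a"
  note u = init_cell_in[OF a] and v = term_cell_in[OF a]
  obtain c where c: "path_from_to (cell_set ?u) (bp ?u) c (bp ?u)" "g = path_class (cell_set ?u) c"
    using g by (rule grp_carrierE)
  note cX = path_from_to_mono[OF c(1) init_strand[OF a]] and l = edge_choices(2)[OF a]
  note l' = path_from_to_rev[OF l]
  note cl = path_from_to_join[OF cX l]
  note lcl = path_from_to_join[OF l' cl]
  let ?c = "reversepath ?l +++ c +++ ?l"
  note M = path_from_to_mono[OF _ strand_M[OF a]]
  have r: "retraction ?X (cell_set ?v) (retr P a)" using edge_choices(4)[OF a] by (simp add: deformation_retraction_def)
  note R = retraction_loop_M[OF edge_choices(4)[OF a] strand_M[OF a] v lcl]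
  have "emb GY a g = path_class (cell_set ?v) (retr P a \<circ> ?c)"
    unfolding GY_simps c(2)
  proof (rule class_map_path_class[OF c(1)])
    fix q assume "homotopic_paths (cell_set ?u) c q"
    then have "homotopic_paths ?X c q" by (rule homotopic_paths_subset[OF _ init_strand[OF a]])
    then have "homotopic_paths ?X ?c (reversepath ?l +++ q +++ ?l)"
      by (intro homotopic_paths_join_from_to[OF homotopic_paths_refl_from_to[OF l'] _ l' cl]
          homotopic_paths_join_from_to[OF _ homotopic_paths_refl_from_to[OF l] cX l])
    then show "homotopic_paths (cell_set ?v) (retr P a \<circ> ?c) (retr P a \<circ> (reversepath ?l +++ q +++ ?l))"
      by (rule homotopic_paths_continuous_image) (use r in \<open>auto simp: retraction_def\<close>)
  qed
  then have "\<phi> (Elt ?v (emb GY a g)) = val ?v ?c ?v" using phi_vertex[OF v R(1)] R(2) by simp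
  also have "\<dots> = val ?v (reversepath ?l) ?u \<otimes>\<^bsub>\<pi>\<^esub> (val ?u c ?u \<otimes>\<^bsub>\<pi>\<^esub> val ?u ?l ?v)"
    using val_mult[OF v u v M[OF l'] M[OF cl]] val_mult[OF u u v M[OF cX] M[OF l]] by simp
  finally show ?thesis using phi_Pos[OF a] phi_Pos_inv[OF a] phi_vertex[OF u c(1)] c(2) by simp
qed

text \<open>The three paths form a loop in the flag strand, since ab starts where b does and ends
  where a does. Without the retraction its class is the product of the values of a, of b and of the
  inverse of ab, and the relation follows by cancelling.\<close>

lemma twist_relation:
  assumes ab: "composable (tbs_scwol M \<Sigma> h) a b"
  shows "\<phi> (Pos a) \<otimes>\<^bsub>\<pi>\<^esub> \<phi> (Pos b) = \<phi> (Elt (tcell a) (twist GY a b)) \<otimes>\<^bsub>\<pi>\<^esub> \<phi> (Pos (comp_edge h a b))"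
proof -
  obtain C k S e where *: "a = Side S e" "b = Prong C k" "C \<in> CC" "k < 3" "S \<in> SS" "e \<in> {1, -1}"
    "tcell (Prong C k) = Sheet S"
    using ab by (rule composable_cases)
  obtain j where j: "j < 3" "comp_edge h a b = Sector C j" "tcell (Sector C j) = tcell a"
    using comp_edge_sector[OF *(3-7)] *(1,2) by auto
  let ?c = "Sector C j" and ?X = "flag_strand M \<Sigma> h a b"
  have arcs: "a \<in> arcs" "b \<in> arcs" "?c \<in> arcs" using * j edgesI by auto
  have tb: "tcell b = init_cell a" "init_cell ?c = init_cell b" using * by simp_all
  have X: "?X = strand_of a \<union> strand_of b \<union> strand_of ?c \<union>
      cone_at h C (bicol h S ` (tub h C ` (C \<times> {ray k}) \<times> closed_segment 0 e))"
    using * j(2) by (simp del: strand.simps comp_edge.simps)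
  have sub: "strand_of a \<subseteq> ?X" "strand_of b \<subseteq> ?X" "strand_of ?c \<subseteq> ?X" unfolding X by blast+
  have XM: "?X \<subseteq> M"
    unfolding X using strand_M[OF arcs(1)] strand_M[OF arcs(2)] strand_M[OF arcs(3)]
      cone_at_subset[OF *(3)] tub_closed_M[OF *(3)] by blast
  let ?u = "init_cell b" and ?s = "init_cell a" and ?v = "tcell a"
  note u = init_cell_in[OF arcs(2)] and s = init_cell_in[OF arcs(1)] and v = term_cell_in[OF arcs(1)]
  note la = path_from_to_rev[OF path_from_to_mono[OF edge_choices(2)[OF arcs(1)] sub(1)]]
  have lb: "path_from_to ?X (bp ?s) (reversepath (slink P b)) (bp ?u)"
    using path_from_to_rev[OF path_from_to_mono[OF edge_choices(2)[OF arcs(2)] sub(2)]] tb by simp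
  have lc: "path_from_to ?X (bp ?u) (slink P ?c) (bp ?v)"
    using path_from_to_mono[OF edge_choices(2)[OF arcs(3)] sub(3)] tb j(3) by simp
  note lbc = path_from_to_join[OF lb lc]
  note labc = path_from_to_join[OF la lbc]
  note M = path_from_to_mono[OF _ XM]
  have dr: "deformation_retraction ?X (cell_set ?v) (flag_retr P a b)"
    using choices ab by (simp add: valid_choices_def)
  note R = retraction_loop_M[OF dr XM v labc]
  have "\<phi> (Elt ?v (twist GY a b)) = val ?v (reversepath (slink P a) +++ reversepath (slink P b) +++ slink P ?c) ?v"
    using phi_vertex[OF v R(1)] R(2) j(2) by simp
  also have "\<dots> = val ?v (reversepath (slink P a)) ?s \<otimes>\<^bsub>\<pi>\<^esub> (val ?s (reversepath (slink P b)) ?u \<otimes>\<^bsub>\<pi>\<^esub> val ?u (slink P ?c) ?v)"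
    using val_mult[OF v s v M[OF la] M[OF lbc]] val_mult[OF s u v M[OF lb] M[OF lc]] by simp
  also have "\<dots> = \<phi> (Pos a) \<otimes>\<^bsub>\<pi>\<^esub> (\<phi> (Pos b) \<otimes>\<^bsub>\<pi>\<^esub> inv\<^bsub>\<pi>\<^esub> (\<phi> (Pos ?c)))"
    using phi_Pos[OF arcs(1)] phi_Pos[OF arcs(2)] phi_Pos_inv[OF arcs(3)] tb j(3) by simp
  finally show ?thesis
    unfolding j(2) using phi_Pos_carrier[OF arcs(1)] phi_Pos_carrier[OF arcs(2)] phi_Pos_carrier[OF arcs(3)]
    by (simp add: pi.m_assoc del: gen_image.simps)
qed

lemma fg_relations:
  assumes "(u, w) \<in> fg_rels GY" "u \<in> words (fg_gens GY)" "w \<in> words (fg_gens GY)"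
  shows "eval_word \<pi> \<phi> u = eval_word \<pi> \<phi> w"
proof -
  have elt: "\<phi> (Elt v g) \<in> carrier \<pi>" if "v \<in> cells" "g \<in> carrier (grp GY v)" for v g
    using phi_closed that by (auto simp: fg_gens_def simp del: gen_image.simps GY_simps(6))
  have gens: "\<phi> x \<in> carrier \<pi>" if "x \<in> fg_gens GY" for x
    using phi_closed that by blast
  consider v g g' where "u = [(Elt v g, True), (Elt v g', True)]" "w = [(Elt v (g \<otimes>\<^bsub>grp GY v\<^esub> g'), True)]"
      "v \<in> cells" "g \<in> carrier (grp GY v)" "g' \<in> carrier (grp GY v)"
    | a where "u = [(Pos a, False)]" "w = [(Neg a, True)]" "a \<in> arcs"
    | a where "u = [(Neg a, False)]" "w = [(Pos a, True)]" "a \<in> arcs"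
    | a b where "u = [(Pos a, True), (Pos b, True)]" "w = [(Elt (tcell a) (twist GY a b), True), (Pos (comp_edge h a b), True)]"
      "composable (tbs_scwol M \<Sigma> h) a b"
    | a g where "u = [(Elt (tcell a) (emb GY a g), True)]" "w = [(Pos a, True), (Elt (init_cell a) g, True), (Neg a, True)]"
      "a \<in> arcs" "g \<in> carrier (grp GY (init_cell a))"
    using assms(1) unfolding fg_rels_def by (auto simp del: GY_simps(6-8))
  then show ?thesis
  proof cases
    case (1 v g g')
    then show ?thesis
      using hom_mult[OF phi_vertex_hom[OF 1(3)] 1(4,5)] elt[OF 1(3,4)] elt[OF 1(3,5)] assms(3) gens
      by (simp add: pi.m_assoc del: gen_image.simps GY_simps(6))
  next
    case (2 a)
    then show ?thesis using phi_Pos_carrier[OF 2(3)] by simp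
  next
    case (3 a)
    then show ?thesis using phi_Pos_carrier[OF 3(3)] by simp
  next
    case (4 a b)
    have "\<phi> (Pos b) \<in> carrier \<pi>" "\<phi> (Pos (comp_edge h a b)) \<in> carrier \<pi>"
      using assms(2,3) gens unfolding 4(1,2) words_simps by blast+
    then show ?thesis using twist_relation[OF 4(3)] unfolding 4(1,2) eval_word_Cons eval_word_Nil by (simp only: if_True pi.r_one)
  next
    case (5 a g)
    have "\<phi> (Neg a) = inv\<^bsub>\<pi>\<^esub> (\<phi> (Pos a))" by simp
    moreover have "\<phi> (Elt (tcell a) (emb GY a g)) \<in> carrier \<pi>"
      using assms(2) gens unfolding 5(1) words_simps by blast
    ultimately show ?thesis
      using emb_relation[OF 5(3,4)] phi_Pos_carrier[OF 5(3)]
      unfolding 5(1,2) eval_word_Cons eval_word_Nil by (simp only: if_True pi.r_one pi.inv_closed)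
  qed
qed

subsection \<open>Surjectivity\<close>

abbreviation "v0 \<equiv> Region N0"
abbreviation "values v \<equiv> edge_path_values \<pi> \<phi> GY v0 v"

lemma v0_cell: "v0 \<in> cells" by (rule cellsI(3)[OF N0])

lemma cog_conditions:
  "ini GY ` edges GY \<subseteq> verts GY" "ter GY ` edges GY \<subseteq> verts GY"
  "v \<in> verts GY \<Longrightarrow> group (grp GY v)"
  "v \<in> verts GY \<Longrightarrow> (\<lambda>g. \<phi> (Elt v g)) \<in> hom (grp GY v) \<pi>"
  "a \<in> edges GY \<Longrightarrow> \<phi> (Neg a) = inv\<^bsub>\<pi>\<^esub> (\<phi> (Pos a))"
  using init_cell_in term_cell_in group_fundamental_group[OF base_in] phi_vertex_hom
  by (auto simp del: gen_image.simps(1))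

lemma values_local:
  assumes "g \<in> values v" "v \<in> cells" "path_from_to (cell_set v) (bp v) c (bp v)"
  shows "g \<otimes>\<^bsub>\<pi>\<^esub> val v c v \<in> values v"
proof -
  have "path_class (cell_set v) c \<in> carrier (grp GY v)"
    using path_class_in_carrier[OF assms(3)] by simp
  from edge_path_values_local[OF pi.is_group phi_closed cog_conditions assms(1) this]
  show ?thesis using phi_vertex[OF assms(2,3)] by simp
qed

lemma values_slink:
  assumes "a \<in> arcs"
  shows "g \<in> values (tcell a) \<Longrightarrow> g \<otimes>\<^bsub>\<pi>\<^esub> val (tcell a) (reversepath (slink P a)) (init_cell a) \<in> values (init_cell a)"
    "g \<in> values (init_cell a) \<Longrightarrow> g \<otimes>\<^bsub>\<pi>\<^esub> val (init_cell a) (slink P a) (tcell a) \<in> values (tcell a)"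
  using edge_path_values_cross[OF pi.is_group phi_closed cog_conditions, of a g v0]
    phi_Pos[OF assms] phi_Pos_inv[OF assms] assms by simp_all

lemma values_one: "\<one>\<^bsub>\<pi>\<^esub> \<in> values v0"
  using edge_path_values_one[OF pi.is_group phi_closed cog_conditions, of v0] v0_cell by simp

lemma values_carrier: "g \<in> values v \<Longrightarrow> g \<in> carrier \<pi>"
  using eval_word_closed[OF pi.is_group phi_closed] edge_path_word_gens[OF _ cog_conditions(1,2)]
  unfolding edge_path_values_def by blast

text \<open>A loop in the hood contracts, with fixed base point, to a loop in the cell, and that
  represents an element of the local group.\<close>

lemma values_hood_loop:
  assumes g: "g \<in> values v" and v: "v \<in> cells" and l: "path_from_to (hood v) (bp v) l (bp v)"
  shows "g \<otimes>\<^bsub>\<pi>\<^esub> val v l v \<in> values v"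
proof -
  obtain c where c: "path_from_to (cell_set v) (bp v) c (bp v)" "homotopic_paths (hood v) l c"
    using hood_deform(1)[OF v l base_in[OF v] base_in[OF v]] by blast
  have "val v l v = val v c v"
    by (rule tailed_cong[OF spoke_path[OF v] path_from_to_mono[OF l hood_M[OF v]] spoke_path[OF v]
        homotopic_paths_subset[OF c(2) hood_M[OF v]]])
  then show ?thesis using values_local[OF g v c(1)] by simp
qed

text \<open>Write p as l (l^-1 p) with l = \<open>slink P a\<close>. The second factor is a loop in
  the strand based in t(a), hence up to the retraction a local group element at t(a); p differs from
  the crossing of the edge only by this element.\<close>

lemma values_strand:
  assumes a: "a \<in> arcs" and p: "path_from_to (strand_of a) (bp (init_cell a)) p (bp (tcell a))"
  shows "g \<in> values (init_cell a) \<Longrightarrow> g \<otimes>\<^bsub>\<pi>\<^esub> val (init_cell a) p (tcell a) \<in> values (tcell a)"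
    and "g \<in> values (tcell a) \<Longrightarrow> g \<otimes>\<^bsub>\<pi>\<^esub> inv\<^bsub>\<pi>\<^esub> (val (init_cell a) p (tcell a)) \<in> values (init_cell a)"
proof -
  let ?u = "init_cell a" and ?v = "tcell a" and ?l = "slink P a"
  note u = init_cell_in[OF a] and v = term_cell_in[OF a]
  note l = edge_choices(2)[OF a]
  note l' = path_from_to_rev[OF l]
  note lp = path_from_to_join[OF l' p]
  note M = path_from_to_mono[OF _ strand_M[OF a]]
  let ?c = "retr P a \<circ> (reversepath ?l +++ p)"
  note R = retraction_loop_M[OF edge_choices(4)[OF a] strand_M[OF a] v lp]
  let ?L = "val ?u ?l ?v" and ?p = "val ?u p ?v"
  have carr: "?L \<in> carrier \<pi>" "?p \<in> carrier \<pi>" "val ?v ?c ?v \<in> carrier \<pi>"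
    using val_carrier[OF u v M[OF l]] val_carrier[OF u v M[OF p]]
      val_carrier[OF v v path_from_to_mono[OF R(1) cell_M[OF v]]] by blast+
  have "val ?v ?c ?v = val ?v (reversepath ?l) ?u \<otimes>\<^bsub>\<pi>\<^esub> ?p"
    using R(2) val_mult[OF v u v M[OF l'] M[OF p]] by simp
  also have "val ?v (reversepath ?l) ?u = inv\<^bsub>\<pi>\<^esub> ?L"
    using tailed_inv[OF spoke_path[OF u] M[OF l] spoke_path[OF v]] by simp
  finally have c: "val ?v ?c ?v = inv\<^bsub>\<pi>\<^esub> ?L \<otimes>\<^bsub>\<pi>\<^esub> ?p" .
  show "g \<otimes>\<^bsub>\<pi>\<^esub> ?p \<in> values ?v" if g: "g \<in> values ?u"
  proof -
    have "(g \<otimes>\<^bsub>\<pi>\<^esub> ?L) \<otimes>\<^bsub>\<pi>\<^esub> val ?v ?c ?v \<in> values ?v"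
      by (rule values_local[OF values_slink(2)[OF a g] v R(1)])
    moreover have "(g \<otimes>\<^bsub>\<pi>\<^esub> ?L) \<otimes>\<^bsub>\<pi>\<^esub> val ?v ?c ?v = g \<otimes>\<^bsub>\<pi>\<^esub> ?p"
      unfolding c using carr values_carrier[OF g] by (simp add: pi.m_assoc pi.mult_inv_cancel)
    ultimately show ?thesis by simp
  qed
  \<comment> \<open>Backwards the local element comes first: it is absorbed at t(a) before the edge
    is crossed.\<close>
  show "g \<otimes>\<^bsub>\<pi>\<^esub> inv\<^bsub>\<pi>\<^esub> ?p \<in> values ?u" if g: "g \<in> values ?v"
  proof -
    have "val ?v (reversepath ?c) ?v = inv\<^bsub>\<pi>\<^esub> (val ?v ?c ?v)"
      using tailed_inv[OF spoke_path[OF v] path_from_to_mono[OF R(1) cell_M[OF v]] spoke_path[OF v]] by simp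
    moreover have "(g \<otimes>\<^bsub>\<pi>\<^esub> val ?v (reversepath ?c) ?v) \<otimes>\<^bsub>\<pi>\<^esub> val ?v (reversepath ?l) ?u \<in> values ?u"
      by (rule values_slink(1)[OF a values_local[OF g v path_from_to_rev[OF R(1)]]])
    moreover have "val ?v (reversepath ?l) ?u = inv\<^bsub>\<pi>\<^esub> ?L"
      using tailed_inv[OF spoke_path[OF u] M[OF l] spoke_path[OF v]] by simp
    ultimately have "(g \<otimes>\<^bsub>\<pi>\<^esub> inv\<^bsub>\<pi>\<^esub> (inv\<^bsub>\<pi>\<^esub> ?L \<otimes>\<^bsub>\<pi>\<^esub> ?p)) \<otimes>\<^bsub>\<pi>\<^esub> inv\<^bsub>\<pi>\<^esub> ?L \<in> values ?u" unfolding c by simp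
    moreover have "(g \<otimes>\<^bsub>\<pi>\<^esub> inv\<^bsub>\<pi>\<^esub> (inv\<^bsub>\<pi>\<^esub> ?L \<otimes>\<^bsub>\<pi>\<^esub> ?p)) \<otimes>\<^bsub>\<pi>\<^esub> inv\<^bsub>\<pi>\<^esub> ?L = g \<otimes>\<^bsub>\<pi>\<^esub> inv\<^bsub>\<pi>\<^esub> ?p"
      using carr values_carrier[OF g] by (simp add: pi.m_assoc pi.inv_mult_group)
    ultimately show ?thesis by simp
  qed
qed

text \<open>Both claims are computed with one auxiliary tail \<open>t\<close> to \<open>y\<close>,
  which turns \<open>du\<close> and \<open>dv\<close> into group elements U and V: rejoining
  multiplies by U^-1 V, and a common initial piece \<open>e\<close> cancels from this
  product.\<close>

lemma val_rejoin:
  assumes u: "u \<in> cells" and v: "v \<in> cells" and du: "path_from_to M y du (bp u)" and dv: "path_from_to M y dv (bp v)"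
  shows "path_from_to M (bp v0) p y \<Longrightarrow>
      val v0 (p +++ dv) v = val v0 (p +++ du) u \<otimes>\<^bsub>\<pi>\<^esub> val u (reversepath du +++ dv) v"
    and "path_from_to M w e y \<Longrightarrow>
      val u (reversepath (e +++ du) +++ e +++ dv) v = val u (reversepath du +++ dv) v"
proof -
  define t where "t = spoke P u +++ reversepath du"
  note su = spoke_path[OF u] and sv = spoke_path[OF v] and s0 = spoke_path[OF v0_cell]
  have t: "path_from_to M x0 t y" unfolding t_def by (rule path_from_to_join[OF su path_from_to_rev[OF du]])
  let ?U = "tailed M t du (spoke P u)" and ?V = "tailed M t dv (spoke P v)"
  have UV: "?U \<in> carrier \<pi>" "?V \<in> carrier \<pi>" using tailed_carrier[OF t du su] tailed_carrier[OF t dv sv] .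
  have d: "val u (reversepath du +++ dv) v = inv\<^bsub>\<pi>\<^esub> ?U \<otimes>\<^bsub>\<pi>\<^esub> ?V"
    using tailed_mult[OF su path_from_to_rev[OF du] t dv sv] tailed_inv[OF t du su] by simp
  { assume p: "path_from_to M (bp v0) p y"
    let ?p = "tailed M (spoke P v0) p t"
    have "val v0 (p +++ du) u = ?p \<otimes>\<^bsub>\<pi>\<^esub> ?U" "val v0 (p +++ dv) v = ?p \<otimes>\<^bsub>\<pi>\<^esub> ?V"
      using tailed_mult[OF s0 p t du su] tailed_mult[OF s0 p t dv sv] by simp_all
    moreover have "?p \<in> carrier \<pi>" by (rule tailed_carrier[OF s0 p t])
    ultimately show "val v0 (p +++ dv) v = val v0 (p +++ du) u \<otimes>\<^bsub>\<pi>\<^esub> val u (reversepath du +++ dv) v"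
      unfolding d using UV by (simp add: pi.m_assoc pi.mult_inv_cancel) }
  { assume e: "path_from_to M w e y"
    define t' where "t' = t +++ reversepath e"
    have t': "path_from_to M x0 t' w" unfolding t'_def by (rule path_from_to_join[OF t path_from_to_rev[OF e]])
    let ?e = "tailed M t' e t"
    have E: "?e \<in> carrier \<pi>" by (rule tailed_carrier[OF t' e t])
    note eu = path_from_to_join[OF e du] and ev = path_from_to_join[OF e dv]
    have "val u (reversepath (e +++ du) +++ e +++ dv) v
        = inv\<^bsub>\<pi>\<^esub> (tailed M t' (e +++ du) (spoke P u)) \<otimes>\<^bsub>\<pi>\<^esub> tailed M t' (e +++ dv) (spoke P v)"
      using tailed_mult[OF su path_from_to_rev[OF eu] t' ev sv] tailed_inv[OF t' eu su] by simp
    also have "\<dots> = inv\<^bsub>\<pi>\<^esub> (?e \<otimes>\<^bsub>\<pi>\<^esub> ?U) \<otimes>\<^bsub>\<pi>\<^esub> (?e \<otimes>\<^bsub>\<pi>\<^esub> ?V)"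
      using tailed_mult[OF t' e t du su] tailed_mult[OF t' e t dv sv] by simp
    also have "\<dots> = inv\<^bsub>\<pi>\<^esub> ?U \<otimes>\<^bsub>\<pi>\<^esub> ?V"
      using UV E by (simp add: pi.inv_mult_group pi.m_assoc pi.mult_inv_cancel)
    finally show "val u (reversepath (e +++ du) +++ e +++ dv) v = val u (reversepath du +++ dv) v" using d by simp }
qed

text \<open>Two closing paths in one hood differ by a loop there, so within a hood the closing path
  is free (\<open>same\<close>). For different cells the closing paths are taken through the point
  \<open>w\<close> supplied by \<open>meets\<close>; they then differ by a path in the strand, which
  \<open>values_strand\<close> handles in whichever direction the edge points.\<close>

lemma values_change:
  assumes p: "path_from_to M (bp v0) p y" and u: "u \<in> cells" and v: "v \<in> cells"
    and du: "path_from_to (hood u) y du (bp u)" and dv: "path_from_to (hood v) y dv (bp v)"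
    and val: "val v0 (p +++ du) u \<in> values u"
  shows "val v0 (p +++ dv) v \<in> values v"
proof -
  have same: "val v0 (p +++ d') w \<in> values w"
    if w: "w \<in> cells" and d: "path_from_to (hood w) y d (bp w)" "path_from_to (hood w) y d' (bp w)"
      and val: "val v0 (p +++ d) w \<in> values w" for w d d'
    using val_rejoin(1)[OF w w path_from_to_mono[OF d(1) hood_M[OF w]] path_from_to_mono[OF d(2) hood_M[OF w]] p]
      values_hood_loop[OF val w path_from_to_join[OF path_from_to_rev[OF d(1)] d(2)]] by simp
  show ?thesis
  proof (cases "u = v")
    case True
    then show ?thesis using same[OF u du _ val] dv by blast
  next
    case False
    have y: "y \<in> hood u" "y \<in> hood v" using path_from_to_in(1)[OF du] path_from_to_in(1)[OF dv] .
    obtain a where a: "a \<in> arcs" "meets a y" "init_cell a = u \<and> tcell a = v \<or> init_cell a = v \<and> tcell a = u"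
      using meets_ex[OF u v False y] by blast
    let ?i = "init_cell a" and ?t = "tcell a"
    note i = init_cell_in[OF a(1)] and t = term_cell_in[OF a(1)]
    obtain w bi bt where w: "path_component (hood ?i \<inter> hood ?t) y w"
      and bi: "bi \<in> cell_set ?i" "path_component (hood ?i \<inter> strand_of a) w bi"
      and bt: "bt \<in> cell_set ?t" "path_component (hood ?t \<inter> strand_of a) w bt"
      using a(2) unfolding meets_def by blast
    have "path_component (hood ?i \<inter> strand_of a) w (bp ?i)"
      using path_component_trans[OF bi(2) path_component_of_subset[OF _ path_in_cell[OF i bi(1) base_in[OF i]]]]
        cell_hood[OF i] init_strand[OF a(1)] by blast
    then obtain fi where fi: "path_from_to (hood ?i \<inter> strand_of a) w fi (bp ?i)"
      unfolding path_component_iff_path_from_to by blast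
    have "path_component (hood ?t \<inter> strand_of a) w (bp ?t)"
      using path_component_trans[OF bt(2) path_component_of_subset[OF _ path_in_cell[OF t bt(1) base_in[OF t]]]]
        cell_hood[OF t] term_strand[of a] by blast
    then obtain ft where ft: "path_from_to (hood ?t \<inter> strand_of a) w ft (bp ?t)"
      unfolding path_component_iff_path_from_to by blast
    obtain e where e: "path_from_to (hood ?i \<inter> hood ?t) y e w"
      using w unfolding path_component_iff_path_from_to by blast
    have di: "path_from_to (hood ?i) y (e +++ fi) (bp ?i)"
      by (rule path_from_to_join[OF path_from_to_mono[OF e Int_lower1] path_from_to_mono[OF fi Int_lower1]])
    have dt: "path_from_to (hood ?t) y (e +++ ft) (bp ?t)"
      by (rule path_from_to_join[OF path_from_to_mono[OF e Int_lower2] path_from_to_mono[OF ft Int_lower1]])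
    note Mi = path_from_to_mono[OF _ hood_M[OF i]] and Mt = path_from_to_mono[OF _ hood_M[OF t]]
    note eM = Mi[OF path_from_to_mono[OF e Int_lower1]]
    note fiM = Mi[OF path_from_to_mono[OF fi Int_lower1]] and ftM = Mt[OF path_from_to_mono[OF ft Int_lower1]]
    have strand: "path_from_to (strand_of a) (bp ?i) (reversepath fi +++ ft) (bp ?t)"
      by (rule path_from_to_join[OF path_from_to_rev[OF path_from_to_mono[OF fi Int_lower2]] path_from_to_mono[OF ft Int_lower2]])
    let ?g = "val ?i (reversepath fi +++ ft) ?t"
    have g: "val v0 (p +++ e +++ ft) ?t = val v0 (p +++ e +++ fi) ?i \<otimes>\<^bsub>\<pi>\<^esub> ?g"
      using val_rejoin(1)[OF i t Mi[OF di] Mt[OF dt] p] val_rejoin(2)[OF i t fiM ftM eM] by simp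
    have carr: "?g \<in> carrier \<pi>" "val v0 (p +++ e +++ fi) ?i \<in> carrier \<pi>"
      using val_carrier[OF i t path_from_to_mono[OF strand strand_M[OF a(1)]]]
        val_carrier[OF v0_cell i path_from_to_join[OF p Mi[OF di]]] by blast+
    from a(3) show ?thesis
    proof
      assume uv: "init_cell a = u \<and> tcell a = v"
      have "val v0 (p +++ e +++ fi) ?i \<in> values ?i" using same[OF i _ di] du val uv by simp
      then have "val v0 (p +++ e +++ ft) ?t \<in> values ?t" unfolding g by (rule values_strand(1)[OF a(1) strand])
      then show ?thesis using same[OF t dt] dv uv by simp
    next
      assume uv: "init_cell a = v \<and> tcell a = u"
      have "val v0 (p +++ e +++ ft) ?t \<in> values ?t" using same[OF t _ dt] du val uv by simp
      then have "val v0 (p +++ e +++ ft) ?t \<otimes>\<^bsub>\<pi>\<^esub> inv\<^bsub>\<pi>\<^esub> ?g \<in> values ?i" by (rule values_strand(2)[OF a(1) strand])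
      then have "val v0 (p +++ e +++ fi) ?i \<in> values ?i"
        unfolding g using carr by (simp add: pi.m_assoc)
      then show ?thesis using same[OF i di] dv uv by simp
    qed
  qed
qed

lemma values_loop:
  assumes g: "path_from_to M (bp v0) \<gamma> (bp v0)" shows "val v0 \<gamma> v0 \<in> values v0"
proof -
  define Q where "Q t \<longleftrightarrow> (\<forall>v\<in>cells. \<forall>d. path_from_to (hood v) (\<gamma> t) d (bp v) \<longrightarrow> val v0 ((\<gamma> \<circ> linepath 0 t) +++ d) v \<in> values v)"
    for t
  have g01: "\<gamma> 0 = bp v0" "\<gamma> 1 = bp v0" using g by (auto simp: path_from_to_def pathstart_def pathfinish_def)
  have gM: "\<gamma> t \<in> M" if "t \<in> {0..1}" for t using g that by (auto simp: path_from_to_def path_image_def)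
  have sub: "path_from_to M (\<gamma> s) (\<gamma> \<circ> linepath s t) (\<gamma> t)" if "s \<in> {0..1}" "t \<in> {0..1}" for s t
  proof (rule path_from_to_subpath[OF g that])
    have "closed_segment s t \<subseteq> {0..1}" using that by (simp add: closed_segment_subset)
    then show "\<gamma> ` closed_segment s t \<subseteq> M" using gM by blast
  qed
  have sub0: "path_from_to M (bp v0) ((\<gamma> \<circ> linepath 0 t)) (\<gamma> t)" if "t \<in> {0..1}" for t
    using sub[of 0 t] that g01 by simp
  have const: "path_from_to (hood v0) (bp v0) (\<lambda>_. bp v0) (bp v0)"
    using path_from_to_const base_in[OF v0_cell] cell_hood[OF v0_cell] by blast
  have constM: "path_from_to M (bp v0) (\<lambda>_. bp v0) (bp v0)" by (rule path_from_to_mono[OF const hood_M[OF v0_cell]])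
  have one: "val v0 (\<lambda>_. bp v0) v0 = \<one>\<^bsub>\<pi>\<^esub>" by (rule tailed_const[OF spoke_path[OF v0_cell]])
  \<comment> \<open>The constant closing path in the hood of \<open>v0\<close> has value one; every
    other cell around the starting point follows by \<open>values_change\<close>.\<close>
  have "Q 0"
    unfolding Q_def
  proof (intro ballI allI impI)
    fix v d assume v: "v \<in> cells" and d: "path_from_to (hood v) (\<gamma> 0) d (bp v)"
    have s0: "(\<gamma> \<circ> linepath 0 0) = (\<lambda>_. bp v0)" using g01 by (simp add: o_def)
    have "val v0 ((\<lambda>_. bp v0) +++ (\<lambda>_. bp v0)) v0 = \<one>\<^bsub>\<pi>\<^esub>"
      using val_mult[OF v0_cell v0_cell v0_cell constM constM] one by simp
    then have "val v0 ((\<lambda>_. bp v0) +++ (\<lambda>_. bp v0)) v0 \<in> values v0" using values_one by simp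
    then show "val v0 ((\<gamma> \<circ> linepath 0 0) +++ d) v \<in> values v"
      unfolding s0 using values_change[OF constM v0_cell v const] d g01 by simp
  qed
  \<comment> \<open>The local form demanded by connected induction: all times in one neighbourhood
    imply each other.\<close>
  moreover have "\<exists>T. openin (top_of_set {0..1}) T \<and> a \<in> T \<and> (\<forall>s\<in>T. \<forall>t\<in>T. Q s \<longrightarrow> Q t)" if a: "a \<in> {0..1}" for a
  proof -
    obtain v where v: "v \<in> cells" "\<gamma> a \<in> hood v" using hood_cover[OF gM[OF a]] by blast
    have "openin (top_of_set {0..1}) ({0..1} \<inter> \<gamma> -` hood v)"
      using g by (intro continuous_openin_preimage[OF _ _ hood_openin[OF v(1)]])
        (auto simp: path_from_to_def path_def path_image_def)
    then obtain O' where O': "open O'" "{0..1} \<inter> \<gamma> -` hood v = {0..1} \<inter> O'" unfolding openin_open by auto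
    then have "a \<in> O'" using a v by blast
    then obtain r where r: "r > 0" "ball a r \<subseteq> O'" using O'(1) openE by blast
    show ?thesis
    proof (intro exI conjI ballI impI)
      show "openin (top_of_set {0..1}) ({0..1} \<inter> ball a r)" by (simp add: openin_open_Int)
      show "a \<in> {0..1} \<inter> ball a r" using a r by simp
      fix s t assume st: "s \<in> {0..1} \<inter> ball a r" "t \<in> {0..1} \<inter> ball a r" and Qs: "Q s"
      then have s: "s \<in> {0..1}" and t: "t \<in> {0..1}" by auto
      have "convex ({0..1} \<inter> ball a r)" by (intro convex_Int convex_ball) auto
      then have "closed_segment t s \<subseteq> {0..1} \<inter> ball a r" using st by (simp add: closed_segment_subset)
      then have seg: "\<gamma> ` closed_segment t s \<subseteq> hood v" using O' r by blast
      \<comment> \<open>At time \<open>t\<close> the closing path first follows the loop to time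
        \<open>s\<close> and then \<open>d\<close>; the result is homotopic to the partial loop of
        time \<open>s\<close> closed by \<open>d\<close>.\<close>
      have k: "path_from_to (hood v) (\<gamma> t) ((\<gamma> \<circ> linepath t s)) (\<gamma> s)" by (rule path_from_to_subpath[OF g t s seg])
      obtain d where d: "path_from_to (hood v) (\<gamma> s) d (bp v)"
        using path_in_hood[OF v(1) path_from_to_in(2)[OF k] base_in[OF v(1)]] path_component_iff_path_from_to by metis
      note M = path_from_to_mono[OF _ hood_M[OF v(1)]]
      note s0 = spoke_path[OF v0_cell] and sv = spoke_path[OF v(1)]
      have "homotopic_paths M ((\<gamma> \<circ> linepath 0 t) +++ (\<gamma> \<circ> linepath t s) +++ d) ((\<gamma> \<circ> linepath 0 s) +++ d)"
      proof (rule homotopic_paths_trans)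
        show "homotopic_paths M ((\<gamma> \<circ> linepath 0 t) +++ (\<gamma> \<circ> linepath t s) +++ d) (((\<gamma> \<circ> linepath 0 t) +++ (\<gamma> \<circ> linepath t s)) +++
            d)"
          by (rule homotopic_paths_sym[OF homotopic_paths_assoc_from_to[OF sub0[OF t] sub[OF t s] M[OF d]]])
        show "homotopic_paths M (((\<gamma> \<circ> linepath 0 t) +++ (\<gamma> \<circ> linepath t s)) +++ d) ((\<gamma> \<circ> linepath 0 s) +++ d)"
          using homotopic_paths_join_from_to[OF homotopic_subpaths[OF g _ t s, of 0]
              homotopic_paths_refl_from_to[OF M[OF d]] path_from_to_join[OF sub0[OF t] sub[OF t s]] M[OF d]] by simp
      qed
      then have "val v0 ((\<gamma> \<circ> linepath 0 t) +++ (\<gamma> \<circ> linepath t s) +++ d) v = val v0 ((\<gamma> \<circ> linepath 0 s) +++ d) v"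
        by (rule tailed_cong[OF s0 path_from_to_join[OF sub0[OF t] path_from_to_join[OF sub[OF t s] M[OF d]]] sv])
      also have "\<dots> \<in> values v" using Qs v(1) d unfolding Q_def by blast
      finally have val: "val v0 ((\<gamma> \<circ> linepath 0 t) +++ (\<gamma> \<circ> linepath t s) +++ d) v \<in> values v" .
      show "Q t"
        unfolding Q_def using values_change[OF sub0[OF t] v(1) _ path_from_to_join[OF k d] _ val] by blast
    qed
  qed
  ultimately have "Q 1"
    by (intro connected_induction_simple[of "{0..1::real}" 0 1 Q]) auto
  then have "val v0 ((\<gamma> \<circ> linepath 0 1) +++ (\<lambda>_. bp v0)) v0 \<in> values v0"
    unfolding Q_def using v0_cell const g01 by simp
  also have "val v0 ((\<gamma> \<circ> linepath 0 1) +++ (\<lambda>_. bp v0)) v0 = val v0 \<gamma> v0"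
    using tailed_cong[OF spoke_path[OF v0_cell] path_from_to_join[OF g constM] spoke_path[OF v0_cell]
        homotopic_paths_rid_const[OF g]] by (simp add: comp_linepath_0_1)
  finally show ?thesis .
qed

text \<open>\<open>values_loop\<close> concerns loops at \<open>bp v0\<close>, whereas elements of
  \<open>\<pi>\<close> are classes at \<open>x0\<close>. Conjugation by the spoke of
  \<open>v0\<close> passes between them; evaluating with a constant tail at \<open>x0\<close> shows
  that the two copies of the spoke contribute one.\<close>

lemma values_all: "carrier \<pi> \<subseteq> values v0"
proof
  fix g assume "g \<in> carrier \<pi>"
  then obtain \<delta> where \<delta>: "path_from_to M x0 \<delta> x0" "g = path_class M \<delta>" unfolding fundamental_group_carrier by blast
  let ?s = "spoke P v0" and ?c = "\<lambda>_::real. x0"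
  note s = spoke_path[OF v0_cell] and c = path_from_to_const[OF x0_M]
  note s' = path_from_to_rev[OF s]
  let ?\<gamma> = "reversepath ?s +++ \<delta> +++ ?s"
  have rc: "reversepath ?c = ?c" by (auto simp: reversepath_def)
  have "homotopic_paths M (?c +++ ?s +++ reversepath ?s) (?s +++ reversepath ?s)"
    by (rule homotopic_paths_lid_const[OF path_from_to_join[OF s s']])
  also have "homotopic_paths M (?s +++ reversepath ?s) ?c" by (rule homotopic_paths_rinv_const[OF s])
  finally have 1: "tailed M ?c ?s ?s = \<one>\<^bsub>\<pi>\<^esub>"
    by (simp add: tailed_def fundamental_group_one path_class_eqI)
  have 2: "tailed M ?s (reversepath ?s) ?c = \<one>\<^bsub>\<pi>\<^esub>"
    using tailed_inv[OF c s s] 1 by simp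
  have "homotopic_paths M (?c +++ \<delta> +++ ?c) (\<delta> +++ ?c)"
    by (rule homotopic_paths_lid_const[OF path_from_to_join[OF \<delta>(1) c]])
  also have "homotopic_paths M (\<delta> +++ ?c) \<delta>" by (rule homotopic_paths_rid_const[OF \<delta>(1)])
  finally have 3: "tailed M ?c \<delta> ?c = g"
    by (simp add: tailed_def rc path_class_eqI \<delta>(2))
  have "val v0 ?\<gamma> v0 = tailed M ?s (reversepath ?s) ?c \<otimes>\<^bsub>\<pi>\<^esub> (tailed M ?c \<delta> ?c \<otimes>\<^bsub>\<pi>\<^esub> tailed M ?c ?s ?s)"
    using tailed_mult[OF s s' c path_from_to_join[OF \<delta>(1) s] s] tailed_mult[OF c \<delta>(1) c s s] by simp
  also have "\<dots> = g" unfolding 1 2 3 using \<open>g \<in> carrier \<pi>\<close> by simp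
  finally have "val v0 ?\<gamma> v0 = g" .
  moreover have "val v0 ?\<gamma> v0 \<in> values v0"
    by (rule values_loop[OF path_from_to_join[OF s' path_from_to_join[OF \<delta>(1) s]]])
  ultimately show "g \<in> values v0" by simp
qed

lemma phi_star_epi: "tbs_phi_star M \<Sigma> h x0 P \<in> epi (pi1_cog GY v0) \<pi>"
  unfolding tbs_phi_star_def
  by (rule pi1_cog_epi[OF pi.is_group phi_closed cog_conditions fg_relations values_all])

end

theorem proposition2p5:
  fixes M \<Sigma> :: "'a::t2_space set" and h :: "'a tbs_nbhds" and x0 :: 'a
    and P :: "'a cog_choices" and N0 :: "'a set"
  assumes "compact M" and "connected M" and "three_manifold M"
    and "irreducible3 M" and "orientable TYPE(complex \<times> real) M"
    and "nbhd_system M \<Sigma> h"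
    and "essential_tribranched_surface M \<Sigma> h"
    and "N0 \<in> components (regions M \<Sigma> h)" and "x0 \<in> N0"
    and "valid_choices M \<Sigma> h x0 P"
  shows "tbs_phi_star M \<Sigma> h x0 P
           \<in> epi (pi1_cog (tbs_cog M \<Sigma> h P) (Region N0)) (fundamental_group M x0)"
proof -
  interpret tribranched_choices M \<Sigma> h x0 P N0
    using assms by unfold_locales (simp_all add: essential_tribranched_surface_def)
  show ?thesis by (rule phi_star_epi)
qed

end
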